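(* Let $P,Q\in\mathcal{P}^\omega$. Then $E(\Sigma_P)\leq_B E(\Sigma_Q)$ if and only if $Q\preceq P$, if and only if there is a nonzero (i.e. non-trivial) continuous homomorphism $f:\Sigma_P\to\Sigma_Q$.
   Context: $\mathcal{P}$ is the set of all prime numbers and $\mathbb{T}$ the multiplicative group of complex numbers of modulus $1$. For $P\in\mathcal{P}^\omega$, the $P$-adic solenoid is the compact group $\Sigma_P=\{g\in\mathbb{T}^\omega:\forall l\,(g(l)=g(l+1)^{P(l)})\}$ (subgroup of $\mathbb{T}^\omega$ with the product topology). For $P,Q\in\mathcal{P}^\omega$, $Q\preceq P$ means there is an injection $f:\omega\to\omega$ such that $Q(n)=P(f(n))$ for all sufficiently large $n$. For a Polish group $G$, $E(G)$ is the equivalence relation on $G^\omega$ given by $x\,E(G)\,y$ iff $(x(n)y(n)^{-1})_n$ converges in $G$. $E\leq_B F$ means there is a Borel map $\theta$ with $x E y\iff \theta(x) F \theta(y)$.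
   Formalization: In Q ⪯ P, f need only be injective on a cofinite set of n on which Q(n)=P(f(n)), not on all of ω; with a total injection the claim fails for P=(2,3,5,7,…), Q=(2,2,2,3,5,7,…), whose solenoids are isomorphic. *)

theory Defs
  imports "HOL-Analysis.Analysis" "HOL-Algebra.Group" "HOL-Computational_Algebra.Primes"
begin

text \<open>
  The type \<^typ>\<open>nat \<Rightarrow> 'a\<close> carries the product topology, so the solenoid, as a subset of
  \<^typ>\<open>nat \<Rightarrow> complex\<close>, has the subspace topology inherited from the countable power of the
  circle group.
\<close>

definition solenoid :: "(nat \<Rightarrow> nat) \<Rightarrow> (nat \<Rightarrow> complex) monoid" where
  "solenoid P =
    \<lparr>carrier = {g. (\<forall>l. g l \<in> sphere 0 1) \<and> (\<forall>l. g l = g (Suc l) ^ P l)},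
     mult = (\<lambda>g h l. g l * h l),
     one = (\<lambda>l. 1)\<rparr>"

lemma mem_solenoid_iff:
  "g \<in> carrier (solenoid P) \<longleftrightarrow> (\<forall>l. norm (g l) = 1) \<and> (\<forall>l. g (Suc l) ^ P l = g l)"
proof -
  have "(\<forall>l. g l = g (Suc l) ^ P l) \<longleftrightarrow> (\<forall>l. g (Suc l) ^ P l = g l)"
    by (metis (no_types))
  then show ?thesis
    unfolding solenoid_def partial_object.simps mem_Collect_eq mem_sphere_0 by argo
qed

lemma mult_solenoid: "g \<otimes>\<^bsub>solenoid P\<^esub> h = (\<lambda>l. g l * h l)"
  by (simp add: solenoid_def)

lemma one_solenoid: "\<one>\<^bsub>solenoid P\<^esub> = (\<lambda>l. 1)"
  by (simp add: solenoid_def)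

lemma comm_group_solenoid: "comm_group (solenoid P)"
proof (rule comm_groupI)
  fix g assume g: "g \<in> carrier (solenoid P)"
  have "(\<lambda>l. inverse (g l)) \<in> carrier (solenoid P)"
    using g by (simp add: mem_solenoid_iff norm_inverse power_inverse)
  moreover have "(\<lambda>l. inverse (g l)) \<otimes>\<^bsub>solenoid P\<^esub> g = \<one>\<^bsub>solenoid P\<^esub>"
  proof -
    have "g l \<noteq> 0" for l
      using g by (metis mem_solenoid_iff norm_zero zero_neq_one)
    then show ?thesis by (simp add: mult_solenoid one_solenoid)
  qed
  ultimately show "\<exists>h\<in>carrier (solenoid P). h \<otimes>\<^bsub>solenoid P\<^esub> g = \<one>\<^bsub>solenoid P\<^esub>"
    by blast
qed (simp_all add: mem_solenoid_iff mult_solenoid one_solenoid norm_mult power_mult_distrib mult_ac)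

text \<open>
  The matching \<open>f\<close> is an injection on the cofinite set where \<open>Q n = P (f n)\<close> is required; it
  need not extend to an injection on all of \<open>\<nat>\<close>. For \<open>P = (2,3,5,7,\<dots>)\<close> and
  \<open>Q = (2,2,2,3,5,7,\<dots>)\<close> no such extension exists, although dropping two coordinates is an
  isomorphism from the solenoid of \<open>Q\<close> onto that of \<open>P\<close>.
\<close>

definition prime_seq_le :: "(nat \<Rightarrow> nat) \<Rightarrow> (nat \<Rightarrow> nat) \<Rightarrow> bool" (infix "\<preceq>" 50) where
  "Q \<preceq> P \<longleftrightarrow> (\<exists>A f. finite (- A) \<and> inj_on f A \<and> (\<forall>n\<in>A. Q n = P (f n)))"

definition seqs :: "('a, 'b) monoid_scheme \<Rightarrow> (nat \<Rightarrow> 'a) set" where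
  "seqs G = {x. \<forall>n. x n \<in> carrier G}"

definition coset_rel ::
  "('a :: topological_space, 'b) monoid_scheme \<Rightarrow> ((nat \<Rightarrow> 'a) \<times> (nat \<Rightarrow> 'a)) set" where
  "coset_rel G = {(x, y). x \<in> seqs G \<and> y \<in> seqs G \<and>
     (\<exists>l\<in>carrier G. (\<lambda>n. x n \<otimes>\<^bsub>G\<^esub> inv\<^bsub>G\<^esub> y n) \<longlonglongrightarrow> l)}"

definition borel_reducible ::
  "'a :: topological_space set \<Rightarrow> ('a \<times> 'a) set \<Rightarrow> 'b :: topological_space set \<Rightarrow> ('b \<times> 'b) set \<Rightarrow> bool"
  where
  "borel_reducible X E Y F \<longleftrightarrow>
     (\<exists>\<theta> \<in> restrict_space borel X \<rightarrow>\<^sub>M restrict_space borel Y.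
        \<forall>x\<in>X. \<forall>y\<in>X. (x, y) \<in> E \<longleftrightarrow> (\<theta> x, \<theta> y) \<in> F)"

end

theory Submission imports Defs begin

text \<open>
  Let \<open>\<iota>\<close> be the dense one-parameter subgroup of the solenoid of \<open>P\<close>. Both \<open>Q \<preceq> P\<close> and the existence
  of a nontrivial continuous homomorphism amount to the existence of \<open>c > 0\<close> such that every
  finite product \<open>Q 0 \<cdots> Q (j - 1)\<close> divides some \<open>c P 0 \<cdots> P (k - 1)\<close>: restricted to \<open>\<iota>\<close>,
  coordinate \<open>j\<close> of a homomorphism is a character \<open>cis (a t)\<close>, and continuity for the
  solenoid topology forces it to be periodic with some period \<open>P 0 \<cdots> P (k - 1)\<close>.

  Such a homomorphism yields a reduction: a sequence in the solenoid of \<open>P\<close> converges iff its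
  image converges and consecutive quotients tend to the identity, because the kernel is totally
  disconnected; the second condition is coded by small real numbers on the one-parameter
  subgroup of the target.

  Conversely, a Borel reduction is continuous on a comeagre set. Feeding it increments from finite
  sets of rationals (via \<open>\<iota>\<close>), separated by suitable fixed words, makes it nearly additive: the
  entry \<open>g\<close> at place \<open>n\<close> contributes \<open>S n g\<close> to the limit. Moving a small increment to the next
  place does not change the equivalence class, which forces \<open>S n (g + h) - S n g - S n h\<close> to
  tend to zero coordinatewise; a limit point of \<open>S n\<close> is a continuous homomorphism. If it were
  trivial, the harmonic increments \<open>1 / (k + 1)\<close>, placed sparsely, would be
  equivalent to the zero sequence although their sums do not converge on the circle.
\<close>

subsection \<open>Solenoids and their one-parameter subgroups\<close>

text \<open>The constant \<open>c\<close> pays for the finitely many indices that a matching may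
  leave out. The hard direction is the one from reductions to divisibility: a Borel map is tame only
  on a comeagre set and knows nothing of the group operations. All algebra has to come from the fact
  that the relation sees only sums of increments, so that splitting \<open>g + h\<close> over
  neighbouring places is almost invisible.

  Increments are rational and taken from finite sets so that each stage meets finitely many prefixes
  and a single filling word can serve all of them; the errors \<open>(1 / 2) ^ n\<close> are
  summable and cannot spoil convergence. Countability gives a limit point of the \<open>S n\<close>
  by sequential compactness, and divisibility allows any \<open>h\<close> to be written as a
  multiple of a small \<open>h / n\<close>. The price is that a character of the rationals need not
  have the form \<open>cis (a * t)\<close>; this is recovered from smallness near 0. The harmonic
  increments work because they tend to zero, so that outputs inside a block stay close, while the
  increments between \<open>K\<close> and \<open>2 * K\<close> add up to nearly \<open>ln 2\<close>,
  which is not an integer.\<close>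

lemma tendsto_fun_iff:
  fixes f :: "'b \<Rightarrow> 'i \<Rightarrow> 'a::topological_space"
  shows "(f \<longlongrightarrow> L) F \<longleftrightarrow> (\<forall>i. ((\<lambda>n. f n i) \<longlongrightarrow> L i) F)"
  using limitin_componentwise[of "\<lambda>_. euclidean" UNIV f L F]
  by (simp add: euclidean_product_topology)

lemma convergent_fun_iff:
  fixes f :: "nat \<Rightarrow> 'i \<Rightarrow> 'a::topological_space"
  shows "convergent f \<longleftrightarrow> (\<forall>i. convergent (\<lambda>n. f n i))"
  unfolding convergent_def tendsto_fun_iff by metis

lemma solenoid_norm: "g \<in> carrier (solenoid P) \<Longrightarrow> norm (g l) = 1"
  by (simp add: mem_solenoid_iff)

lemma solenoid_nonzero: "g \<in> carrier (solenoid P) \<Longrightarrow> g l \<noteq> 0"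
  using solenoid_norm[of g P l] by auto

lemma inv_solenoid:
  assumes "g \<in> carrier (solenoid P)"
  shows "inv\<^bsub>solenoid P\<^esub> g = (\<lambda>l. inverse (g l))"
proof -
  interpret comm_group "solenoid P" by (rule comm_group_solenoid)
  have "(\<lambda>l. inverse (g l)) \<in> carrier (solenoid P)"
    using assms by (simp add: mem_solenoid_iff norm_inverse power_inverse)
  moreover have "(\<lambda>l. inverse (g l)) \<otimes>\<^bsub>solenoid P\<^esub> g = \<one>\<^bsub>solenoid P\<^esub>"
    using solenoid_nonzero[OF assms] by (simp add: mult_solenoid one_solenoid)
  ultimately show ?thesis
    using assms inv_equality by blast
qed

lemma solenoid_divide:
  "g \<in> carrier (solenoid P) \<Longrightarrow> h \<in> carrier (solenoid P) \<Longrightarrow> (\<lambda>l. g l / h l) \<in> carrier (solenoid P)"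
  by (simp add: mem_solenoid_iff norm_divide power_divide)

lemma solenoid_limit:
  assumes "\<And>n. f n \<in> carrier (solenoid P)" and "f \<longlonglongrightarrow> L"
  shows "L \<in> carrier (solenoid P)"
proof -
  have lim: "(\<lambda>n. f n l) \<longlonglongrightarrow> L l" for l
    using assms(2) by (simp add: tendsto_fun_iff)
  have "norm (L l) = 1" for l
    using tendsto_norm[OF lim[of l]] solenoid_norm[OF assms(1)] by (simp add: LIMSEQ_const_iff)
  moreover have "L (Suc l) ^ P l = L l" for l
  proof -
    have "(\<lambda>n. f n (Suc l) ^ P l) \<longlonglongrightarrow> L (Suc l) ^ P l"
      by (intro tendsto_power lim)
    then have "(\<lambda>n. f n l) \<longlonglongrightarrow> L (Suc l) ^ P l"
      using assms(1) by (simp add: mem_solenoid_iff)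
    then show ?thesis
      using lim LIMSEQ_unique by blast
  qed
  ultimately show ?thesis
    by (simp add: mem_solenoid_iff)
qed

text \<open>The solenoid is closed in the power of the circle, so a limit of quotients belongs to it
  automatically and only convergence in the ambient space remains.\<close>

lemma coset_rel_solenoid_iff:
  assumes "x \<in> seqs (solenoid P)" "y \<in> seqs (solenoid P)"
  shows "(x, y) \<in> coset_rel (solenoid P) \<longleftrightarrow> convergent (\<lambda>n l. x n l / y n l)"
proof -
  have eq: "(\<lambda>n. x n \<otimes>\<^bsub>solenoid P\<^esub> inv\<^bsub>solenoid P\<^esub> y n) = (\<lambda>n l. x n l / y n l)"
    using assms by (simp add: seqs_def mult_solenoid inv_solenoid divide_inverse)
  have "L \<in> carrier (solenoid P)" if "(\<lambda>n l. x n l / y n l) \<longlonglongrightarrow> L" for L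
    using assms solenoid_limit[OF solenoid_divide that] by (auto simp: seqs_def)
  then show ?thesis
    using assms unfolding coset_rel_def convergent_def by (auto simp: eq)
qed

text \<open>Normalised so that coordinate \<open>l\<close> has period
  \<open>P 0 * ... * P (l - 1)\<close>, hence coordinate 0 has period 1.\<close>

definition one_param :: "(nat \<Rightarrow> nat) \<Rightarrow> real \<Rightarrow> nat \<Rightarrow> complex" where
  "one_param P t l = cis (2 * pi * t / real (\<Prod>i<l. P i))"

lemma one_param_add: "one_param P (s + t) l = one_param P s l * one_param P t l"
  by (simp add: one_param_def cis_mult add_divide_distrib distrib_left)

lemma one_param_diff: "one_param P (s - t) l = one_param P s l / one_param P t l"
  by (simp add: one_param_def cis_divide diff_divide_distrib right_diff_distrib)

lemma one_param_0 [simp]: "one_param P 0 = (\<lambda>_. 1)"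
  by (simp add: one_param_def fun_eq_iff)

lemma norm_one_param [simp]: "norm (one_param P t l) = 1"
  by (simp add: one_param_def)

lemma one_param_in_solenoid:
  assumes "\<And>n. P n > 0"
  shows "one_param P t \<in> carrier (solenoid P)"
proof -
  have "one_param P t (Suc l) ^ P l = one_param P t l" for l
  proof -
    have "real (P l) * (2 * pi * t / real (\<Prod>i<Suc l. P i)) = 2 * pi * t / real (\<Prod>i<l. P i)"
      using assms[of l] by simp
    then show ?thesis
      by (simp only: one_param_def Complex.DeMoivre)
  qed
  then show ?thesis
    by (simp add: mem_solenoid_iff)
qed

lemma continuous_on_one_param: "continuous_on A (one_param P)"
  unfolding one_param_def
  by (intro continuous_on_coordinatewise_then_product) (simp add: divide_inverse continuous_intros)

lemma one_param_period:
  assumes "\<And>n. P n > 0" and "l \<le> k"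
  shows "one_param P (of_int a * real (\<Prod>i<k. P i)) l = 1"
proof -
  define A B where "A = (\<Prod>i<l. P i)" and "B = (\<Prod>i=l..<k. P i)"
  have "A > 0"
    unfolding A_def using assms(1) by (simp add: prod_pos)
  moreover have "(\<Prod>i<k. P i) = A * B"
    unfolding A_def B_def using assms(2) by (metis atLeast0LessThan le0 prod.atLeastLessThan_concat)
  ultimately have "2 * pi * (of_int a * real (\<Prod>i<k. P i)) / real A = 2 * pi * of_int (a * int B)"
    by simp
  then show ?thesis
    unfolding one_param_def A_def by (metis cis_multiple_2pi Ints_of_int)
qed

text \<open>A coordinate determines all earlier ones; this makes it enough to arrange or control a
  single coordinate.\<close>

lemma solenoid_power_prod:
  assumes "g \<in> carrier (solenoid P)" and "l \<le> k"
  shows "g k ^ (\<Prod>i=l..<k. P i) = g l"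
  using assms(2)
proof (induction k rule: dec_induct)
  case (step k)
  have "g (Suc k) ^ (\<Prod>i=l..<Suc k. P i) = (g (Suc k) ^ P k) ^ (\<Prod>i=l..<k. P i)"
    using step by (simp add: power_mult[symmetric] mult.commute)
  then show ?case
    using step assms(1) by (simp add: mem_solenoid_iff)
qed simp

subsection \<open>The divisibility criterion\<close>

lemma multiplicity_prod_primes:
  fixes P :: "nat \<Rightarrow> nat"
  assumes "\<And>n. prime (P n)" and "prime p"
  shows "multiplicity p (\<Prod>i<k. P i) = card {i. i < k \<and> P i = p}"
proof (induction k)
  case 0
  then show ?case by simp
next
  case (Suc k)
  have "(\<Prod>i<k. P i) \<noteq> 0" "P k \<noteq> 0"
    using assms(1) by (simp_all add: prime_gt_0_nat)
  then have "multiplicity p (\<Prod>i<Suc k. P i) = multiplicity p (\<Prod>i<k. P i) + multiplicity p (P k)"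
    using assms by (simp add: prime_elem_multiplicity_mult_distrib)
  moreover have "multiplicity p (P k) = (if P k = p then 1 else 0)"
    using assms by (simp add: prime_multiplicity_other)
  moreover have "{i. i < Suc k \<and> P i = p} = (if P k = p then insert k {i. i < k \<and> P i = p} else {i. i < k \<and> P i = p})"
    by (auto simp: less_Suc_eq)
  ultimately show ?case
    using Suc by simp
qed

lemma prime_seq_leD:
  assumes P: "\<And>n. prime (P n)" and Q: "\<And>n. prime (Q n)" and "Q \<preceq> P"
  obtains c where "c > 0" "\<And>j. \<exists>k. (\<Prod>i<j. Q i) dvd c * (\<Prod>i<k. P i)"
proof -
  obtain A f where A: "finite (- A)" and f: "inj_on f A" "\<And>n. n \<in> A \<Longrightarrow> Q n = P (f n)"
    using assms(3) unfolding prime_seq_le_def by blast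
  \<comment> \<open>The unmatched indices go into the constant; the matched ones inject into indices
    of \<open>P\<close>, and \<open>k\<close> bounds their images.\<close>
  have "\<exists>k. (\<Prod>i<j. Q i) dvd (\<Prod>i\<in>-A. Q i) * (\<Prod>i<k. P i)" for j
  proof -
    obtain k where k: "f ` ({..<j} \<inter> A) \<subseteq> {..<k}"
      by (metis finite_Int finite_imageI finite_lessThan finite_nat_iff_bounded)
    have "(\<Prod>i<j. Q i) = (\<Prod>i\<in>{..<j} \<inter> -A. Q i) * (\<Prod>i\<in>{..<j} \<inter> A. Q i)"
      by (subst prod.union_disjoint[symmetric]) (auto intro!: prod.cong)
    also have "(\<Prod>i\<in>{..<j} \<inter> A. Q i) = (\<Prod>i\<in>{..<j} \<inter> A. P (f i))"
      using f(2) by (intro prod.cong) auto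
    also have "\<dots> = (\<Prod>i\<in>f ` ({..<j} \<inter> A). P i)"
      using f(1) by (subst prod.reindex) (auto intro: inj_on_subset)
    finally have "(\<Prod>i<j. Q i) = (\<Prod>i\<in>{..<j} \<inter> -A. Q i) * (\<Prod>i\<in>f ` ({..<j} \<inter> A). P i)" .
    also have "\<dots> dvd (\<Prod>i\<in>-A. Q i) * (\<Prod>i<k. P i)"
      using A k by (intro mult_dvd_mono prod_dvd_prod_subset) auto
    finally show ?thesis by blast
  qed
  moreover have "(\<Prod>i\<in>-A. Q i) > 0"
    using Q by (simp add: prod_pos prime_gt_0_nat)
  ultimately show ?thesis
    using that by blast
qed

lemma card_le_all_initial_segments:
  fixes A :: "nat set"
  assumes "\<And>j. card {i. i < j \<and> i \<in> A} \<le> N"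
  shows "finite A \<and> card A \<le> N"
proof -
  have fin: "finite A"
  proof (rule ccontr)
    assume "infinite A"
    then obtain B where B: "B \<subseteq> A" "finite B" "card B = Suc N"
      using infinite_arbitrarily_large by blast
    obtain j where "B \<subseteq> {..<j}"
      using B(2) finite_nat_iff_bounded by blast
    then have "card B \<le> card {i. i < j \<and> i \<in> A}"
      using B by (intro card_mono) auto
    then show False
      using assms[of j] B by simp
  qed
  then obtain j where "A \<subseteq> {..<j}"
    using finite_nat_iff_bounded by blast
  then have "{i. i < j \<and> i \<in> A} = A" by auto
  then show ?thesis
    using fin assms[of j] by simp
qed

text \<open>Compare multiplicities of each prime \<open>p\<close>. If \<open>p\<close> occurs
  finitely often in \<open>P\<close>, it occurs in \<open>Q\<close> at most
  \<open>multiplicity p c\<close> times more, so an excess is possible only for the finitely many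
  prime divisors of \<open>c\<close>.\<close>

lemma prime_seq_leI:
  assumes P: "\<And>n. prime (P n)" and Q: "\<And>n. prime (Q n)" and c: "c > 0"
    and dvd: "\<And>j. \<exists>k. (\<Prod>i<j. Q i) dvd c * (\<Prod>i<k. P i)"
  shows "Q \<preceq> P"
proof -
  define B where "B p = {n. P n = p}" for p
  define D where "D p = {n. Q n = p}" for p
  have bound: "finite (D p) \<and> card (D p) \<le> multiplicity p c + card (B p)"
    if p: "prime p" and fin: "finite (B p)" for p
  proof (rule card_le_all_initial_segments)
    fix j
    obtain k where k: "(\<Prod>i<j. Q i) dvd c * (\<Prod>i<k. P i)"
      using dvd by blast
    have nz: "c * (\<Prod>i<k. P i) \<noteq> 0" "(\<Prod>i<k. P i) \<noteq> 0"
      using c P by (simp_all add: prime_gt_0_nat)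
    have "card {i. i < j \<and> i \<in> D p} = multiplicity p (\<Prod>i<j. Q i)"
      using Q p by (simp add: multiplicity_prod_primes D_def)
    also have "\<dots> \<le> multiplicity p (c * (\<Prod>i<k. P i))"
      using k nz(1) by (rule dvd_imp_multiplicity_le)
    also have "\<dots> = multiplicity p c + card {i. i < k \<and> P i = p}"
      using p c nz P by (subst prime_elem_multiplicity_mult_distrib) (simp_all add: multiplicity_prod_primes)
    also have "\<dots> \<le> multiplicity p c + card (B p)"
      using fin by (intro add_left_mono card_mono) (auto simp: B_def)
    finally show "card {i. i < j \<and> i \<in> D p} \<le> multiplicity p c + card (B p)" .
  qed
  \<comment> \<open>Discards all occurrences in \<open>Q\<close> of those primes that divide
    \<open>c\<close> and are finite in number in \<open>P\<close>: finitely many primes, each with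
    finitely many occurrences by \<open>bound\<close>.\<close>
  define A where "A = {n. infinite (B (Q n)) \<or> \<not> Q n dvd c}"
  have "- A \<subseteq> (\<Union>p\<in>{p. p dvd c \<and> prime p \<and> finite (B p)}. D p)"
    using Q by (auto simp: A_def D_def)
  moreover have "finite {p. p dvd c \<and> prime p \<and> finite (B p)}"
    using c by (intro finite_subset[OF _ finite_divisors_nat[OF c]]) auto
  then have "finite (\<Union>p\<in>{p. p dvd c \<and> prime p \<and> finite (B p)}. D p)"
    using bound by blast
  ultimately have finA: "finite (- A)"
    by (rule finite_subset)
  have "\<exists>f. inj_on f (D p) \<and> f ` D p \<subseteq> B p" if p: "prime p" "infinite (B p) \<or> \<not> p dvd c" for p
  proof (cases "finite (B p)")
    case True
    with p have "multiplicity p c = 0"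
      by (simp add: not_dvd_imp_multiplicity_0)
    with bound[OF p(1) True] True have "finite (D p)" "card (D p) \<le> card (B p)"
      by auto
    with True show ?thesis
      by (metis card_le_inj)
  next
    case False
    then have "inj_on (enumerate (B p)) (D p)" "enumerate (B p) ` D p \<subseteq> B p"
      using strict_mono_imp_inj_on[OF strict_mono_enumerate] inj_on_subset enumerate_in_set by blast+
    then show ?thesis
      by blast
  qed
  then obtain f where f: "\<And>p. prime p \<Longrightarrow> infinite (B p) \<or> \<not> p dvd c \<Longrightarrow> inj_on (f p) (D p) \<and> f p ` D p \<subseteq> B p"
    by metis
  \<comment> \<open>The injections for different primes have disjoint images, because
    \<open>P (F n)\<close> recovers the prime \<open>Q n\<close>.\<close>
  define F where "F n = f (Q n) n" for n
  have F: "inj_on (f (Q n)) (D (Q n))" "P (F n) = Q n" if "n \<in> A" for n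
    using f[OF Q, of n] that unfolding A_def F_def D_def B_def by auto
  have "inj_on F A"
  proof (rule inj_onI)
    fix m n assume mn: "m \<in> A" "n \<in> A" "F m = F n"
    then have eq: "Q m = Q n" using F(2) by metis
    then have "f (Q n) m = f (Q n) n" using mn unfolding F_def by simp
    then show "m = n"
      by (rule inj_onD[OF F(1)[OF mn(2)]]) (simp_all add: D_def eq)
  qed
  then show ?thesis
    unfolding prime_seq_le_def using finA F(2)
    by (intro exI[of _ A] exI[of _ F]) simp
qed

subsection \<open>The circle group\<close>

lemma cos_pos_imp_abs_less: "cos t > 0 \<Longrightarrow> \<bar>t\<bar> < pi \<Longrightarrow> \<bar>t\<bar> < pi / 2"
  using cos_monotone_0_pi_le[of "pi / 2" "\<bar>t\<bar>"] by (cases "\<bar>t\<bar> < pi / 2") auto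

text \<open>There is no wrap-around: a multiple below \<open>pi / 2\<close> plus one more step below
  \<open>pi / 2\<close> stays below \<open>pi\<close>, where a positive cosine forces it below
  \<open>pi / 2\<close> again.\<close>

lemma cos_multiples_pos_imp:
  assumes "\<And>j. 1 \<le> j \<Longrightarrow> j \<le> n \<Longrightarrow> cos (real j * b) > 0" and "\<bar>b\<bar> < pi"
  shows "\<bar>real n * b\<bar> < pi / 2"
  using assms(1)
proof (induction n)
  case (Suc n)
  have "cos (real 1 * b) > 0"
    using Suc.prems[of 1] by simp
  then have "\<bar>b\<bar> < pi / 2"
    using assms(2) by (intro cos_pos_imp_abs_less) auto
  moreover have "\<bar>real n * b\<bar> < pi / 2"
    using Suc by simp
  ultimately have "\<bar>real (Suc n) * b\<bar> < pi"
    by (simp add: algebra_simps)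
  then show ?case
    using Suc.prems[of "Suc n"] by (intro cos_pos_imp_abs_less) auto
qed simp

text \<open>Distance less than 1 from 1 means a positive real part, so the multiples of the angle
  cannot wrap around the circle.\<close>

lemma unit_circle_small_powers:
  fixes z :: complex
  assumes "norm z = 1" and "\<And>j. 1 \<le> j \<Longrightarrow> j \<le> n \<Longrightarrow> norm (z ^ j - 1) < 1" and "n \<ge> 1"
  obtains b where "z = cis b" "\<bar>real n * b\<bar> < pi / 2"
proof -
  obtain b where z: "z = cis b" and b: "- pi < b" "b \<le> pi"
    using assms(1) Arg_bounded[of z] rcis_cmod_Arg[of z] by (metis rcis_def mult_1 of_real_1)
  have pos: "cos (real j * b) > 0" if "1 \<le> j" "j \<le> n" for j
  proof -
    have "\<bar>Re (z ^ j - 1)\<bar> < 1"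
      using assms(2)[OF that] abs_Re_le_cmod by (rule le_less_trans[rotated])
    then show ?thesis
      by (simp add: z Complex.DeMoivre)
  qed
  have "b \<noteq> pi"
    using pos[of 1] assms(3) by auto
  then show ?thesis
    using that[OF z] cos_multiples_pos_imp[of n b] pos b by auto
qed

text \<open>All multiples of the angle stay below \<open>pi / 2\<close>, which the Archimedean
  property permits only for the angle 0.\<close>

lemma unit_circle_no_small_subgroups:
  fixes z :: complex
  assumes "norm z = 1" and "\<And>j. norm (z ^ j - 1) < 1"
  shows "z = 1"
proof -
  obtain b where b: "z = cis b" "\<bar>b\<bar> < pi / 2"
    by (rule unit_circle_small_powers[of z 1]) (use assms assms(2)[of 1] in auto)
  have cos: "cos (real j * b) > 0" for j
  proof -
    have "\<bar>Re (z ^ j - 1)\<bar> < 1"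
      using assms(2) abs_Re_le_cmod by (rule le_less_trans[rotated])
    then show ?thesis
      by (simp add: b Complex.DeMoivre)
  qed
  have "\<bar>real n * b\<bar> < pi / 2" for n
    using b(2) cos by (intro cos_multiples_pos_imp) auto
  then have "real n * \<bar>b\<bar> < pi / 2" for n
    by (simp add: abs_mult)
  then have "\<not> \<bar>b\<bar> > 0"
    using ex_less_of_nat_mult[of "\<bar>b\<bar>" "pi / 2"] by (meson less_asym)
  then show ?thesis
    using b by simp
qed

text \<open>Without \<open>small\<close> a character of the rationals can choose its roots wildly.
  Smallness forces the value at \<open>1 / (n * K)\<close> to be the root of the value at
  \<open>1 / K\<close> whose angle is divided by \<open>n\<close>.\<close>

lemma rat_circle_hom:
  fixes S :: "rat \<Rightarrow> complex"
  assumes add: "\<And>s t. S (s + t) = S s * S t" and unit: "\<And>t. norm (S t) = 1"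
    and "d > 0" and small: "\<And>t. \<bar>t\<bar> \<le> d \<Longrightarrow> norm (S t - 1) < 1"
  obtains a where "\<And>t. S t = cis (a * of_rat t)"
proof -
  have nz: "S t \<noteq> 0" for t
    using unit[of t] by auto
  have S0: "S 0 = 1"
    using add[of 0 0] nz[of 0] by simp
  have mult: "S (of_nat j * t) = S t ^ j" for j t
    by (induction j) (simp_all add: S0 add distrib_right)
  \<comment> \<open>All fractions \<open>j / (n * K)\<close> with \<open>j\<close> at most
    \<open>n\<close> then lie within \<open>d\<close> of 0, for every \<open>n\<close> at
    once.\<close>
  obtain K where K: "K > 0" "1 / of_nat K < d"
    using \<open>d > 0\<close> by (metis ex_inverse_of_nat_less inverse_eq_divide)
  have step: "\<exists>b. S (1 / of_nat (n * K)) = cis b \<and> \<bar>real n * b\<bar> < pi / 2" if "n \<ge> 1" for n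
  proof -
    have powers: "norm (S (1 / of_nat (n * K)) ^ j - 1) < 1" if "1 \<le> j" "j \<le> n" for j
    proof -
      have "of_nat j * (1 / of_nat (n * K)) \<le> (1 / of_nat K :: rat)"
        using that K(1) \<open>n \<ge> 1\<close> by (simp add: field_simps)
      moreover have "of_nat j * (1 / of_nat (n * K)) \<ge> (0 :: rat)"
        by simp
      ultimately have "\<bar>of_nat j * (1 / of_nat (n * K))\<bar> \<le> d"
        using K(2) by linarith
      then show ?thesis
        using small[of "of_nat j * (1 / of_nat (n * K))"] unfolding mult by simp
    qed
    obtain b where "S (1 / of_nat (n * K)) = cis b" "\<bar>real n * b\<bar> < pi / 2"
      by (rule unit_circle_small_powers[OF unit powers \<open>n \<ge> 1\<close>])
    then show ?thesis
      by blast
  qed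
  obtain b where b: "S (1 / of_nat K) = cis b" "\<bar>b\<bar> < pi / 2"
    using step[of 1] by auto
  have root: "S (1 / of_nat (n * K)) = cis (b / real n)" if "n \<ge> 1" for n
  proof -
    obtain c where c: "S (1 / of_nat (n * K)) = cis c" "\<bar>real n * c\<bar> < pi / 2"
      using step[OF \<open>n \<ge> 1\<close>] by blast
    have "of_nat n * (1 / of_nat (n * K)) = (1 / of_nat K :: rat)"
      using that by (simp add: field_simps)
    then have "cis (real n * c) = cis b"
      using mult[of n "1 / of_nat (n * K)"] b(1) c(1) by (simp add: Complex.DeMoivre)
    \<comment> \<open>Both angles lie strictly between \<open>- pi / 2\<close> and
      \<open>pi / 2\<close>, where the sine is injective.\<close>
    then have "sin (real n * c) = sin b"
      by (metis cis.simps(2))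
    then have "real n * c = b"
      using c(2) b(2) sin_inj_pi[of "real n * c" b] by simp
    then have "c = b / real n"
      using that by (simp add: field_simps)
    then show ?thesis
      using c(1) by simp
  qed
  have pos: "S (of_nat p / of_nat q) = cis (b * of_nat K * (of_nat p / of_nat q))" if "q \<ge> 1" for p q
  proof -
    have "of_nat p / of_nat q = of_nat (p * K) * (1 / of_nat (q * K) :: rat)"
      using K that by (simp add: field_simps)
    then have "S (of_nat p / of_nat q) = cis (b / real q) ^ (p * K)"
      by (simp only: mult root[OF that])
    then show ?thesis
      by (simp add: Complex.DeMoivre mult_ac)
  qed
  have nonneg: "S t = cis (b * of_nat K * of_rat t)" if "t \<ge> 0" for t
  proof -
    obtain p q where pq: "quotient_of t = (p, q)"
      by (metis surj_pair)
    then have "q > 0" "t = of_int p / of_int q"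
      using quotient_of_denom_pos quotient_of_div by blast+
    moreover have "p \<ge> 0"
      using that calculation by (simp add: zero_le_divide_iff)
    ultimately have "t = of_nat (nat p) / of_nat (nat q)" "nat q \<ge> 1"
      by auto
    then show ?thesis
      using pos[of "nat q" "nat p"] by (simp add: of_rat_divide)
  qed
  have "S t = cis (b * of_nat K * of_rat t)" for t
  proof (cases "t \<ge> 0")
    case False
    have "S t * S (- t) = 1"
      using add[of t "- t"] S0 by simp
    then have "S t = inverse (S (- t))"
      using nz by (simp add: field_simps)
    then show ?thesis
      using False nonneg[of "- t"] by (simp add: of_rat_minus)
  qed (use nonneg in simp)
  then show ?thesis
    using that by blast
qed

text \<open>By compactness the sequence is eventually close to the finite set of \<open>M\<close>-th
  roots of \<open>w\<close>. Its steps tend to zero, so it cannot jump between roots at distance at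
  least \<open>d\<close>: three errors of \<open>d / 4\<close> add up to less than \<open>d\<close>.
  This is where total disconnectedness of the kernel enters.\<close>

lemma convergent_if_power_tendsto_slowly_varying:
  fixes z :: "nat \<Rightarrow> complex"
  assumes unit: "\<And>n. norm (z n) = 1" and "M > 0" and lim: "(\<lambda>n. z n ^ M) \<longlonglongrightarrow> w"
    and slow: "(\<lambda>n. z (Suc n) / z n) \<longlonglongrightarrow> 1"
  shows "convergent z"
proof -
  define R where "R = {r. r ^ M = w}"
  have finR: "finite R"
    unfolding R_def using \<open>M > 0\<close> by (rule finite_nth_roots)
  have near: "\<forall>\<^sub>F n in sequentially. \<exists>r\<in>R. dist (z n) r < e" if "e > 0" for e
  proof (rule ccontr)
    assume "\<not> ?thesis"
    then have "infinite {n. \<forall>r\<in>R. dist (z n) r \<ge> e}"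
      by (simp add: cofinite_eq_sequentially[symmetric] eventually_cofinite not_less)
    then obtain f :: "nat \<Rightarrow> nat" where f: "strict_mono f" "\<And>n. \<forall>r\<in>R. dist (z (f n)) r \<ge> e"
      using infinite_enumerate[of "{n. \<forall>r\<in>R. dist (z n) r \<ge> e}"] by auto
    have "seq_compact (sphere (0::complex) 1)"
      by (simp add: compact_imp_seq_compact)
    then obtain r g where g: "strict_mono (g :: nat \<Rightarrow> nat)" "((z \<circ> f) \<circ> g) \<longlonglongrightarrow> r"
      by (rule seq_compactE[of _ "z \<circ> f"]) (use unit in auto)
    have "(\<lambda>n. z (f (g n)) ^ M) \<longlonglongrightarrow> r ^ M"
      using g(2) by (intro tendsto_power) (simp add: o_def)
    moreover have "(\<lambda>n. z (f (g n)) ^ M) \<longlonglongrightarrow> w"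
      using LIMSEQ_subseq_LIMSEQ[OF lim strict_mono_o[OF f(1) g(1)]] by (simp add: o_def)
    ultimately have "r \<in> R"
      unfolding R_def using LIMSEQ_unique by blast
    then have "dist (z (f (g n))) r \<ge> e" for n
      using f(2) by blast
    moreover have "\<forall>\<^sub>F n in sequentially. dist (z (f (g n))) r < e"
      using tendstoD[OF g(2) that] by simp
    ultimately show False
      by (simp add: not_less[symmetric])
  qed
  obtain d where d: "d > 0" "\<And>r s. r \<in> R \<Longrightarrow> s \<in> R \<Longrightarrow> dist r s < d \<Longrightarrow> r = s"
  proof -
    \<comment> \<open>The extra element 1 keeps the minimum defined when there are no two distinct
      roots.\<close>
    define D where "D = insert 1 ((\<lambda>(r, s). dist r s) ` {(r, s) \<in> R \<times> R. r \<noteq> s})"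
    have "finite D"
      unfolding D_def using finR by (auto intro!: finite_imageI intro: finite_subset[of _ "R \<times> R"])
    then have Min: "Min D > 0" "\<And>x. x \<in> D \<Longrightarrow> Min D \<le> x"
      by (auto simp: D_def)
    have "r = s" if "r \<in> R" "s \<in> R" "dist r s < Min D" for r s
      using that Min(2)[of "dist r s"] unfolding D_def by (cases "r = s") auto
    then show ?thesis
      using that[of "Min D"] Min(1) by blast
  qed
  have "(\<lambda>n. dist (z (Suc n)) (z n)) \<longlonglongrightarrow> 0"
  proof -
    have "dist (z (Suc n)) (z n) = norm (z (Suc n) / z n - 1)" for n
    proof -
      have "z (Suc n) - z n = (z (Suc n) / z n - 1) * z n"
        using unit[of n] by (auto simp: field_simps)
      then show ?thesis
        using unit[of n] by (simp add: dist_norm norm_mult)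
    qed
    moreover have "(\<lambda>n. norm (z (Suc n) / z n - 1)) \<longlonglongrightarrow> 0"
      using slow by (simp add: LIM_zero tendsto_norm_zero)
    ultimately show ?thesis by simp
  qed
  then have "\<forall>\<^sub>F n in sequentially. dist (z (Suc n)) (z n) < d / 4"
    using d(1) by (intro order_tendstoD) auto
  then have "\<forall>\<^sub>F n in sequentially. dist (z (Suc n)) (z n) < d / 4 \<and> (\<exists>r\<in>R. dist (z n) r < d / 4)"
    using near[of "d / 4"] d(1) eventually_conj by auto
  then obtain N where N: "\<And>n. n \<ge> N \<Longrightarrow> dist (z (Suc n)) (z n) < d / 4 \<and> (\<exists>r\<in>R. dist (z n) r < d / 4)"
    unfolding eventually_sequentially by blast
  then obtain r where r: "r \<in> R" "dist (z N) r < d / 4"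
    by blast
  have close: "dist (z n) r < d / 4" if "n \<ge> N" for n
    using that
  proof (induction n rule: dec_induct)
    case (step n)
    obtain s where s: "s \<in> R" "dist (z (Suc n)) s < d / 4"
      using N[of "Suc n"] step by auto
    have "dist r s \<le> dist (z n) r + dist (z (Suc n)) (z n) + dist (z (Suc n)) s"
      by metric
    then have "dist r s < d"
      using N[OF \<open>N \<le> n\<close>] step s d(1) by linarith
    then show ?case
      using d(2) r(1) s by blast
  qed (use r in simp)
  have "z \<longlonglongrightarrow> r"
  proof (rule tendstoI)
    fix e :: real assume e: "e > 0"
    have "\<forall>\<^sub>F n in sequentially. (\<exists>s\<in>R. dist (z n) s < min e (d / 4)) \<and> n \<ge> N"
      using near[of "min e (d / 4)"] e d(1) eventually_ge_at_top[of N] by (simp add: eventually_conj)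
    then show "\<forall>\<^sub>F n in sequentially. dist (z n) r < e"
    proof (rule eventually_mono)
      fix n assume n: "(\<exists>s\<in>R. dist (z n) s < min e (d / 4)) \<and> n \<ge> N"
      then obtain s where s: "s \<in> R" "dist (z n) s < e" "dist (z n) s < d / 4"
        by auto
      have "dist r s \<le> dist (z n) r + dist (z n) s"
        by metric
      then have "dist r s < d"
        using close[of n] n s d(1) by linarith
      then show "dist (z n) r < e"
        using d(2) r(1) s by blast
    qed
  qed
  then show ?thesis
    unfolding convergent_def by blast
qed

subsection \<open>From divisibility to homomorphisms and reductions\<close>

text \<open>The exponent \<open>e j\<close> is chosen so that \<open>one_param P t\<close> is sent
  to \<open>one_param Q (c * t)\<close>; the divisibility assumption says that such exponents are
  integers once the coordinate \<open>k j\<close> is late enough.\<close>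

lemma solenoid_hom_of_dvd:
  assumes P: "\<And>n. P n > 0" and Q: "\<And>n. Q n > 0"
    and dvd: "\<And>j. \<exists>k. (\<Prod>i<j. Q i) dvd c * (\<Prod>i<k. P i)"
  obtains k e where "k 0 = 0" "e 0 = c"
    "\<And>g. g \<in> carrier (solenoid P) \<Longrightarrow> (\<lambda>j. g (k j) ^ e j) \<in> carrier (solenoid Q)"
proof -
  \<comment> \<open>Taking the least index makes \<open>k\<close> monotone and gives
    \<open>k 0 = 0\<close>.\<close>
  define k where "k j = (LEAST k. (\<Prod>i<j. Q i) dvd c * (\<Prod>i<k. P i))" for j
  define e where "e j = c * (\<Prod>i<k j. P i) div (\<Prod>i<j. Q i)" for j
  have k: "(\<Prod>i<j. Q i) dvd c * (\<Prod>i<k j. P i)" for j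
    unfolding k_def using dvd by (rule LeastI_ex)
  have e: "e j * (\<Prod>i<j. Q i) = c * (\<Prod>i<k j. P i)" for j
    unfolding e_def using k by simp
  have k_mono: "k j \<le> k (Suc j)" for j
  proof -
    have "(\<Prod>i<j. Q i) dvd (\<Prod>i<Suc j. Q i)"
      by simp
    then have "(\<Prod>i<j. Q i) dvd c * (\<Prod>i<k (Suc j). P i)"
      using k dvd_trans by blast
    then show ?thesis
      unfolding k_def[of j] by (rule Least_le)
  qed
  \<comment> \<open>In exponents, this is the defining relation of the target solenoid: the powers
    of coordinates \<open>k (Suc j)\<close> and \<open>k j\<close> are compatible.\<close>
  have step: "e (Suc j) * Q j = (\<Prod>i=k j..<k (Suc j). P i) * e j" for j
  proof -
    have "(\<Prod>i<k (Suc j). P i) = (\<Prod>i<k j. P i) * (\<Prod>i=k j..<k (Suc j). P i)"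
      using k_mono by (metis atLeast0LessThan le0 prod.atLeastLessThan_concat)
    then have "(e (Suc j) * Q j) * (\<Prod>i<j. Q i) = ((\<Prod>i=k j..<k (Suc j). P i) * e j) * (\<Prod>i<j. Q i)"
      using e[of "Suc j"] e[of j] by (simp add: ac_simps)
    moreover have "(\<Prod>i<j. Q i) > 0"
      using Q by (simp add: prod_pos)
    ultimately show ?thesis
      using mult_cancel2 by (metis less_irrefl)
  qed
  have k0: "k 0 = 0"
    unfolding k_def by (rule Least_eq_0) simp
  show thesis
  proof (rule that[of k e, OF k0])
    show "e 0 = c"
      unfolding e_def k0 by simp
    fix g assume g: "g \<in> carrier (solenoid P)"
    have "(g (k (Suc j)) ^ e (Suc j)) ^ Q j = g (k j) ^ e j" for j
      unfolding power_mult[symmetric] step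
      unfolding power_mult solenoid_power_prod[OF g k_mono] ..
    then show "(\<lambda>j. g (k j) ^ e j) \<in> carrier (solenoid Q)"
      using g by (simp add: mem_solenoid_iff norm_power)
  qed
qed

lemma continuous_on_coordinate_powers:
  "continuous_on A (\<lambda>(g :: nat \<Rightarrow> complex) j. g (k j) ^ e j)"
  by (intro continuous_on_coordinatewise_then_product continuous_on_power
      continuous_on_subset[OF continuous_on_product_coordinates]) simp

lemma solenoid_nontrivial_hom_of_dvd:
  assumes P: "\<And>n. P n > 0" and Q: "\<And>n. Q n > 0" and c: "c > 0"
    and dvd: "\<And>j. \<exists>k. (\<Prod>i<j. Q i) dvd c * (\<Prod>i<k. P i)"
  shows "\<exists>h \<in> hom (solenoid P) (solenoid Q). continuous_on (carrier (solenoid P)) h \<and>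
           (\<exists>g \<in> carrier (solenoid P). h g \<noteq> \<one>\<^bsub>solenoid Q\<^esub>)"
proof -
  obtain k e where k0: "k 0 = 0" and e0: "e 0 = c"
    and carrier: "\<And>g. g \<in> carrier (solenoid P) \<Longrightarrow> (\<lambda>j. g (k j) ^ e j) \<in> carrier (solenoid Q)"
    using solenoid_hom_of_dvd[OF P Q dvd] by metis
  let ?h = "\<lambda>g j. g (k j) ^ e j"
  have "?h \<in> hom (solenoid P) (solenoid Q)"
    using carrier by (auto intro!: homI simp: mult_solenoid power_mult_distrib)
  \<comment> \<open>Coordinate 0 of this point is \<open>cis (pi / c)\<close>, and its
    \<open>c\<close>-th power is -1.\<close>
  moreover have "one_param P (1 / (2 * real c)) \<in> carrier (solenoid P)"
    using P by (rule one_param_in_solenoid)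
  moreover have "?h (one_param P (1 / (2 * real c))) 0 = -1"
    using c by (simp add: k0 e0 one_param_def Complex.DeMoivre)
  then have "?h (one_param P (1 / (2 * real c))) \<noteq> \<one>\<^bsub>solenoid Q\<^esub>"
    unfolding one_solenoid by (metis one_neq_neg_one)
  ultimately show ?thesis
    using continuous_on_coordinate_powers by blast
qed

text \<open>The bound \<open>b q\<close> handles all large \<open>q\<close> uniformly in
  \<open>n\<close>; each of the finitely many other \<open>q\<close> has only finitely many
  exceptional \<open>n\<close>.\<close>

lemma tendsto_zero_prod_decode:
  fixes a :: "nat \<Rightarrow> nat \<Rightarrow> real"
  assumes bound: "\<And>n q. \<bar>a n q\<bar> \<le> b q" and b: "b \<longlonglongrightarrow> 0" and lim: "\<And>q. (\<lambda>n. a n q) \<longlonglongrightarrow> 0"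
  shows "(\<lambda>m. a (fst (prod_decode m)) (snd (prod_decode m))) \<longlonglongrightarrow> 0"
proof (rule tendstoI)
  fix r :: real assume r: "r > 0"
  have "\<forall>\<^sub>F q in sequentially. \<bar>b q\<bar> < r"
    using tendstoD[OF b r] by simp
  then obtain q0 where q0: "\<And>q. q \<ge> q0 \<Longrightarrow> \<bar>b q\<bar> < r"
    unfolding eventually_sequentially by blast
  have fin: "finite {n. \<not> \<bar>a n q\<bar> < r}" for q
    using tendstoD[OF lim r] by (simp add: eventually_cofinite cofinite_eq_sequentially[symmetric])
  have "{m. \<not> \<bar>a (fst (prod_decode m)) (snd (prod_decode m))\<bar> < r}
      \<subseteq> prod_encode ` (\<Union>q<q0. {n. \<not> \<bar>a n q\<bar> < r} \<times> {q})"
  proof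
    fix m assume m: "m \<in> {m. \<not> \<bar>a (fst (prod_decode m)) (snd (prod_decode m))\<bar> < r}"
    obtain n q where nq: "prod_decode m = (n, q)"
      by (metis surj_pair)
    with m have "\<not> \<bar>a n q\<bar> < r" by simp
    moreover from this have "q < q0"
      using q0[of q] bound[of n q] by (cases "q < q0") auto
    moreover have "m = prod_encode (n, q)"
      using nq by (metis prod_decode_inverse)
    ultimately show "m \<in> prod_encode ` (\<Union>q<q0. {n. \<not> \<bar>a n q\<bar> < r} \<times> {q})"
      by blast
  qed
  then have "finite {m. \<not> \<bar>a (fst (prod_decode m)) (snd (prod_decode m))\<bar> < r}"
    by (rule finite_subset) (use fin in auto)
  then show "\<forall>\<^sub>F m in sequentially. dist (a (fst (prod_decode m)) (snd (prod_decode m))) 0 < r"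
    by (simp add: eventually_cofinite cofinite_eq_sequentially[symmetric])
qed

text \<open>The bound \<open>1 / 4\<close> keeps the angles away from the branch cut, so
  \<open>Arg\<close> recovers them continuously.\<close>

lemma cis_tendsto_1_imp:
  fixes d :: "nat \<Rightarrow> real"
  assumes "(\<lambda>m. cis (2 * pi * d m)) \<longlonglongrightarrow> 1" and "\<And>m. \<bar>d m\<bar> \<le> 1 / 4"
  shows "d \<longlonglongrightarrow> 0"
proof -
  have "isCont Arg 1"
    by (intro continuous_at_Arg) simp
  then have "(\<lambda>m. Arg (cis (2 * pi * d m))) \<longlonglongrightarrow> Arg 1"
    using assms(1) by (rule isCont_tendsto_compose)
  moreover have "Arg (cis (2 * pi * d m)) = 2 * pi * d m" for m
  proof (rule Arg_cis)
    have "\<bar>2 * pi * d m\<bar> \<le> 2 * pi * (1 / 4)"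
      using assms(2)[of m] by (simp add: abs_mult)
    then have "- pi < 2 * pi * d m" "2 * pi * d m \<le> pi"
      using pi_gt_zero by linarith+
    then show "2 * pi * d m \<in> {-pi<..pi}"
      by simp
  qed
  ultimately have "(\<lambda>m. 2 * pi * d m) \<longlonglongrightarrow> 0"
    by (simp add: Arg_1)
  then have "(\<lambda>m. 2 * pi * d m / (2 * pi)) \<longlonglongrightarrow> 0 / (2 * pi)"
    by (intro tendsto_divide) auto
  then show ?thesis
    by simp
qed

text \<open>
  The real number \<open>jump x (prod_encode (n, q))\<close> is a scaled real (\<open>q\<close> even) or imaginary
  (\<open>q\<close> odd) part of coordinate \<open>q div 2\<close> of the quotient of \<open>x (n + 1)\<close> by \<open>x n\<close>. The weight
  \<open>2 ^ q\<close> makes \<open>jump x m - jump y m\<close> tend to zero along \<open>m\<close> as soon as all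
  coordinates of these quotients become close for \<open>x\<close> and \<open>y\<close>.
\<close>

definition jump :: "(nat \<Rightarrow> nat \<Rightarrow> complex) \<Rightarrow> nat \<Rightarrow> real" where
  "jump x m = (case prod_decode m of (n, q) \<Rightarrow>
     (let v = x (Suc n) (q div 2) * cnj (x n (q div 2)) in (if even q then Re v else Im v) / (8 * 2 ^ q)))"

text \<open>The factor 8 makes the difference of two jumps at most \<open>1 / 4\<close>, as
  \<open>cis_tendsto_1_imp\<close> requires.\<close>

lemma abs_jump_le:
  assumes "x \<in> seqs (solenoid P)"
  shows "\<bar>jump x m\<bar> \<le> 1 / 8 * (1 / 2) ^ snd (prod_decode m)"
proof -
  obtain n q where nq: "prod_decode m = (n, q)"
    by (metis surj_pair)
  let ?v = "x (Suc n) (q div 2) * cnj (x n (q div 2))"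
  have "norm ?v = 1"
    using assms solenoid_norm[of _ P] by (simp add: seqs_def norm_mult)
  then have "\<bar>Re ?v\<bar> \<le> 1" "\<bar>Im ?v\<bar> \<le> 1"
    using abs_Re_le_cmod[of ?v] abs_Im_le_cmod[of ?v] by simp_all
  then show ?thesis
    by (simp add: jump_def nq Let_def abs_divide field_simps del: times_complex.sel)
qed

lemma continuous_on_jump: "continuous_on UNIV (\<lambda>x. jump x m)"
proof -
  have coord: "continuous_on UNIV (\<lambda>x :: nat \<Rightarrow> nat \<Rightarrow> complex. x n l)" for n l
    by (rule continuous_on_product_then_coordinatewise[OF continuous_on_product_coordinates])
  show ?thesis
    unfolding jump_def Let_def
    by (cases "prod_decode m"; cases "even (snd (prod_decode m))") (auto intro!: continuous_intros coord simp del: times_complex.sel)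
qed

text \<open>The power condition at coordinate 0 controls a fixed power of every coordinate of the
  quotient, and the jumps say that the quotient varies slowly;
  \<open>convergent_if_power_tendsto_slowly_varying\<close> combines the two.\<close>

lemma convergent_iff_power_and_jump:
  assumes P: "\<And>n. P n > 0" and c: "c > 0" and x: "x \<in> seqs (solenoid P)" and y: "y \<in> seqs (solenoid P)"
  shows "convergent (\<lambda>n l. x n l / y n l) \<longleftrightarrow>
    convergent (\<lambda>n. (x n 0 / y n 0) ^ c) \<and> (\<lambda>m. jump x m - jump y m) \<longlonglongrightarrow> 0"
proof -
  define w where "w n l = x n l / y n l" for n l
  have unit: "norm (x n l) = 1" "norm (y n l) = 1" "norm (w n l) = 1" for n l
    using x y solenoid_norm[of _ P] by (auto simp: seqs_def w_def norm_divide)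
  then have nz: "x n l \<noteq> 0" "y n l \<noteq> 0" "w n l \<noteq> 0" for n l
    by (metis norm_zero zero_neq_one)+
  have cnj_eq: "cnj (x n l) = inverse (x n l)" "cnj (y n l) = inverse (y n l)" for n l
    using unit complex_norm_square[of "x n l"] complex_norm_square[of "y n l"] inverse_unique by fastforce+
  \<comment> \<open>Conjugation is inversion on the circle, so the difference is a factor of modulus
    1 times the step of the quotient \<open>w\<close> minus 1.\<close>
  have ratio: "norm (x (Suc n) l * cnj (x n l) - y (Suc n) l * cnj (y n l)) = norm (w (Suc n) l / w n l - 1)" for n l
  proof -
    have "x (Suc n) l * cnj (x n l) - y (Suc n) l * cnj (y n l)
        = (y (Suc n) l / y n l) * (w (Suc n) l / w n l - 1)"
      using nz by (simp add: cnj_eq w_def field_simps)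
    then show ?thesis
      using unit by (simp add: norm_mult norm_divide)
  qed
  have part: "jump x (prod_encode (n, q)) - jump y (prod_encode (n, q)) =
      (if even q then Re (x (Suc n) (q div 2) * cnj (x n (q div 2)) - y (Suc n) (q div 2) * cnj (y n (q div 2)))
       else Im (x (Suc n) (q div 2) * cnj (x n (q div 2)) - y (Suc n) (q div 2) * cnj (y n (q div 2)))) / (8 * 2 ^ q)" for n q
    by (simp add: jump_def Let_def diff_divide_distrib del: times_complex.sel)
  show ?thesis
  proof safe
    assume conv: "convergent (\<lambda>n l. x n l / y n l)"
    then obtain L where L: "\<And>l. (\<lambda>n. w n l) \<longlonglongrightarrow> L l"
      unfolding w_def convergent_def tendsto_fun_iff by blast
    then show "convergent (\<lambda>n. (x n 0 / y n 0) ^ c)"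
      unfolding w_def convergent_def using tendsto_power by blast
    have "norm (L l) = 1" for l
      using tendsto_norm[OF L] unit by (simp add: LIMSEQ_const_iff)
    then have "L l \<noteq> 0" for l
      by (metis norm_zero zero_neq_one)
    then have "(\<lambda>n. w (Suc n) l / w n l) \<longlonglongrightarrow> L l / L l" for l
      by (intro tendsto_divide L LIMSEQ_Suc)
    then have "(\<lambda>n. w (Suc n) l / w n l) \<longlonglongrightarrow> 1" for l
      using \<open>\<And>l. L l \<noteq> 0\<close> by simp
    then have lim: "(\<lambda>n. x (Suc n) l * cnj (x n l) - y (Suc n) l * cnj (y n l)) \<longlonglongrightarrow> 0" for l
      by (subst tendsto_norm_zero_iff[symmetric]) (simp add: ratio LIM_zero tendsto_norm_zero)
    let ?a = "\<lambda>n q. jump x (prod_encode (n, q)) - jump y (prod_encode (n, q))"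
    have "(\<lambda>m. ?a (fst (prod_decode m)) (snd (prod_decode m))) \<longlonglongrightarrow> 0"
    proof (rule tendsto_zero_prod_decode[where a = ?a and b = "\<lambda>q. 1 / 4 * (1 / 2) ^ q"])
      show "\<bar>?a n q\<bar> \<le> 1 / 4 * (1 / 2) ^ q" for n q
        using abs_jump_le[OF x, of "prod_encode (n, q)"] abs_jump_le[OF y, of "prod_encode (n, q)"]
        unfolding prod_encode_inverse snd_conv by linarith
      show "(\<lambda>q. 1 / 4 * (1 / 2 :: real) ^ q) \<longlonglongrightarrow> 0"
        by (intro tendsto_mult_right_zero LIMSEQ_realpow_zero) auto
      show "(\<lambda>n. ?a n q) \<longlonglongrightarrow> 0" for q
        unfolding part using tendsto_Re[OF lim[of "q div 2"]] tendsto_Im[OF lim[of "q div 2"]]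
        by (cases "even q") (auto intro!: tendsto_divide_zero simp del: times_complex.sel)
    qed
    then show "(\<lambda>m. jump x m - jump y m) \<longlonglongrightarrow> 0"
      by simp
  next
    assume conv0: "convergent (\<lambda>n. (x n 0 / y n 0) ^ c)" and jump: "(\<lambda>m. jump x m - jump y m) \<longlonglongrightarrow> 0"
    have "convergent (\<lambda>n. w n l)" for l
    proof -
      have sub: "filterlim (\<lambda>n. prod_encode (n, q)) sequentially sequentially" for q
        by (rule filterlim_at_top_mono[OF filterlim_ident]) (simp add: le_prod_encode_1)
      have lim: "(\<lambda>n. (jump x (prod_encode (n, q)) - jump y (prod_encode (n, q))) * (8 * 2 ^ q)) \<longlonglongrightarrow> 0" for q
        using filterlim_compose[OF jump sub] by (rule tendsto_mult_left_zero)
      have "(\<lambda>n. x (Suc n) l * cnj (x n l) - y (Suc n) l * cnj (y n l)) \<longlonglongrightarrow> 0"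
        using lim[of "2 * l"] lim[of "2 * l + 1"] unfolding part tendsto_complex_iff by simp
      then have "(\<lambda>n. norm (w (Suc n) l / w n l - 1)) \<longlonglongrightarrow> 0"
        unfolding ratio[symmetric] by (rule tendsto_norm_zero)
      then have slow: "(\<lambda>n. w (Suc n) l / w n l) \<longlonglongrightarrow> 1"
        by (rule LIM_zero_cancel[OF tendsto_norm_zero_cancel])
      have "w n l ^ ((\<Prod>i<l. P i) * c) = (x n 0 / y n 0) ^ c" for n
        using x y solenoid_power_prod[of "x n" P 0 l] solenoid_power_prod[of "y n" P 0 l]
        by (simp add: w_def seqs_def power_mult power_divide atLeast0LessThan)
      then have "convergent (\<lambda>n. w n l ^ ((\<Prod>i<l. P i) * c))"
        using conv0 by simp
      then obtain v where "(\<lambda>n. w n l ^ ((\<Prod>i<l. P i) * c)) \<longlonglongrightarrow> v"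
        unfolding convergent_def by blast
      moreover have "(\<Prod>i<l. P i) * c > 0"
        using P c by (simp add: prod_pos)
      ultimately show ?thesis
        using convergent_if_power_tendsto_slowly_varying[of "\<lambda>n. w n l"] unit(3) slow by blast
    qed
    then show "convergent (\<lambda>n l. x n l / y n l)"
      unfolding convergent_fun_iff w_def by blast
  qed
qed

text \<open>Even outputs carry the image of the input under the homomorphism, odd outputs the same
  image multiplied by the point of the one-parameter subgroup that codes the jump. Dividing odd by
  even outputs at coordinate 0 isolates the jump differences.\<close>

lemma borel_reducible_of_dvd:
  assumes P: "\<And>n. P n > 0" and Q: "\<And>n. Q n > 0" and c: "c > 0"
    and dvd: "\<And>j. \<exists>k. (\<Prod>i<j. Q i) dvd c * (\<Prod>i<k. P i)"
  shows "borel_reducible (seqs (solenoid P)) (coset_rel (solenoid P)) (seqs (solenoid Q)) (coset_rel (solenoid Q))"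
proof -
  obtain k e where k0: "k 0 = 0" and e0: "e 0 = c"
    and carrier: "\<And>g. g \<in> carrier (solenoid P) \<Longrightarrow> (\<lambda>j. g (k j) ^ e j) \<in> carrier (solenoid Q)"
    using solenoid_hom_of_dvd[OF P Q dvd] by metis
  \<comment> \<open>The factor \<open>n mod 2\<close> switches the jump on at odd indices
    only.\<close>
  define \<theta> where "\<theta> x n j = x (n div 2) (k j) ^ e j * one_param Q (real (n mod 2) * jump x (n div 2)) j"
    for x n j
  have in_seqs: "\<theta> x \<in> seqs (solenoid Q)" if "x \<in> seqs (solenoid P)" for x
  proof -
    interpret comm_group "solenoid Q" by (rule comm_group_solenoid)
    have "\<theta> x n = (\<lambda>j. x (n div 2) (k j) ^ e j) \<otimes>\<^bsub>solenoid Q\<^esub> one_param Q (real (n mod 2) * jump x (n div 2))" for n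
      by (simp add: \<theta>_def mult_solenoid fun_eq_iff)
    then have "\<theta> x n \<in> carrier (solenoid Q)" for n
      using that carrier one_param_in_solenoid[of Q, OF Q] by (simp add: seqs_def)
    then show ?thesis by (simp add: seqs_def)
  qed
  have coord: "continuous_on UNIV (\<lambda>x :: nat \<Rightarrow> nat \<Rightarrow> complex. x n l)" for n l
    by (rule continuous_on_product_then_coordinatewise[OF continuous_on_product_coordinates])
  have "continuous_on UNIV \<theta>"
    unfolding \<theta>_def one_param_def divide_inverse
    by (intro continuous_on_coordinatewise_then_product continuous_intros coord continuous_on_jump)
  then have meas: "\<theta> \<in> restrict_space borel (seqs (solenoid P)) \<rightarrow>\<^sub>M restrict_space borel (seqs (solenoid Q))"
    using in_seqs by (intro measurable_restrict_space2 measurable_restrict_space1 borel_measurable_continuous_onI)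
      (auto simp: space_restrict_space)
  have "(x, y) \<in> coset_rel (solenoid P) \<longleftrightarrow> (\<theta> x, \<theta> y) \<in> coset_rel (solenoid Q)"
    if x: "x \<in> seqs (solenoid P)" and y: "y \<in> seqs (solenoid P)" for x y
  proof -
    define d where "d m = jump x m - jump y m" for m
    have quot: "\<theta> x n j / \<theta> y n j
        = (x (n div 2) (k j) / y (n div 2) (k j)) ^ e j * one_param Q (real (n mod 2) * d (n div 2)) j" for n j
      by (simp add: \<theta>_def d_def one_param_diff right_diff_distrib power_divide)
    have div2: "filterlim (\<lambda>n::nat. n div 2) sequentially sequentially"
      unfolding filterlim_at_top eventually_sequentially by (metis div_le_mono nonzero_mult_div_cancel_left zero_neq_numeral)
    have "convergent (\<lambda>n l. x n l / y n l) \<longleftrightarrow> convergent (\<lambda>n j. \<theta> x n j / \<theta> y n j)"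
    proof
      assume conv: "convergent (\<lambda>n l. x n l / y n l)"
      then have d: "d \<longlonglongrightarrow> 0"
        using convergent_iff_power_and_jump[OF P c x y] unfolding d_def by blast
      have "(\<lambda>n. real (n mod 2) * d (n div 2)) \<longlonglongrightarrow> 0"
      proof (rule Lim_null_comparison)
        show "(\<lambda>n. \<bar>d (n div 2)\<bar>) \<longlonglongrightarrow> 0"
          using filterlim_compose[OF d div2] by (rule tendsto_rabs_zero)
        have "real (n mod 2) * \<bar>d (n div 2)\<bar> \<le> 1 * \<bar>d (n div 2)\<bar>" for n
          by (intro mult_right_mono) auto
        then show "\<forall>\<^sub>F n in sequentially. norm (real (n mod 2) * d (n div 2)) \<le> \<bar>d (n div 2)\<bar>"
          by (intro always_eventually) (simp add: abs_mult)
      qed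
      then have "(\<lambda>n. one_param Q (real (n mod 2) * d (n div 2))) \<longlonglongrightarrow> one_param Q 0"
        by (rule continuous_on_tendsto_compose[OF continuous_on_one_param[of UNIV Q]]) auto
      then have lim1: "(\<lambda>n. one_param Q (real (n mod 2) * d (n div 2)) j) \<longlonglongrightarrow> 1" for j
        by (simp add: tendsto_fun_iff)
      obtain L where L: "\<And>l. (\<lambda>n. x n l / y n l) \<longlonglongrightarrow> L l"
        using conv unfolding convergent_def tendsto_fun_iff by blast
      have "(\<lambda>n. \<theta> x n j / \<theta> y n j) \<longlonglongrightarrow> L (k j) ^ e j * 1" for j
        unfolding quot by (intro tendsto_mult tendsto_power lim1 filterlim_compose[OF L div2])
      then show "convergent (\<lambda>n j. \<theta> x n j / \<theta> y n j)"
        unfolding convergent_fun_iff convergent_def by blast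
    next
      assume "convergent (\<lambda>n j. \<theta> x n j / \<theta> y n j)"
      then obtain L where L: "(\<lambda>n. \<theta> x n 0 / \<theta> y n 0) \<longlonglongrightarrow> L"
        unfolding convergent_fun_iff unfolding convergent_def by blast
      have sub: "filterlim (\<lambda>n::nat. 2 * n) sequentially sequentially" "filterlim (\<lambda>n::nat. 2 * n + 1) sequentially sequentially"
        by (auto intro!: filterlim_subseq strict_monoI)
      have even: "(\<lambda>n. (x n 0 / y n 0) ^ c) \<longlonglongrightarrow> L"
        using filterlim_compose[OF L sub(1)] by (simp add: quot k0 e0)
      have odd: "(\<lambda>n. (x n 0 / y n 0) ^ c * one_param Q (d n) 0) \<longlonglongrightarrow> L"
        using filterlim_compose[OF L sub(2)] by (simp add: quot k0 e0)
      have unit: "norm ((x n 0 / y n 0) ^ c) = 1" for n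
        using x y solenoid_norm[of _ P] by (simp add: seqs_def norm_power norm_divide)
      then have nz: "(x n 0 / y n 0) ^ c \<noteq> 0" for n
        by (metis norm_zero zero_neq_one)
      have "norm L = 1"
        using tendsto_norm[OF even] unfolding unit by (simp add: LIMSEQ_const_iff)
      then have "L \<noteq> 0" by auto
      then have "(\<lambda>n. (x n 0 / y n 0) ^ c * one_param Q (d n) 0 / (x n 0 / y n 0) ^ c) \<longlonglongrightarrow> L / L"
        by (intro tendsto_divide odd even)
      then have "(\<lambda>n. cis (2 * pi * d n)) \<longlonglongrightarrow> 1"
        unfolding nonzero_mult_div_cancel_left[OF nz] using \<open>L \<noteq> 0\<close> by (simp add: one_param_def)
      moreover have "\<bar>d m\<bar> \<le> 1 / 4" for m
        using abs_jump_le[OF x, of m] abs_jump_le[OF y, of m] power_le_one[of "1 / 2 :: real" "snd (prod_decode m)"]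
        unfolding d_def by linarith
      ultimately have "d \<longlonglongrightarrow> 0"
        by (rule cis_tendsto_1_imp)
      then show "convergent (\<lambda>n l. x n l / y n l)"
        using convergent_iff_power_and_jump[OF P c x y] even unfolding d_def convergent_def by blast
    qed
    then show ?thesis
      using coset_rel_solenoid_iff[OF x y] coset_rel_solenoid_iff[OF in_seqs[OF x] in_seqs[OF y]] by simp
  qed
  then show ?thesis
    unfolding borel_reducible_def using meas by blast
qed

subsection \<open>From homomorphisms to divisibility\<close>

lemma one_param_tendsto:
  assumes "(f \<longlongrightarrow> t) F"
  shows "((\<lambda>n. one_param P (f n)) \<longlongrightarrow> one_param P t) F"
  by (rule continuous_on_tendsto_compose[OF continuous_on_one_param[of UNIV P] assms]) auto

lemma dist_one_param_less:
  assumes "d > 0"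
  obtains e where "e > 0" "\<And>s. \<bar>s - t\<bar> < e \<Longrightarrow> dist (one_param P s) (one_param P t) < d"
proof -
  have "\<forall>\<^sub>F s in at t. dist (one_param P s) (one_param P t) < d"
    using assms by (intro tendstoD one_param_tendsto tendsto_ident_at)
  then obtain e where "e > 0" "\<And>s. s \<noteq> t \<Longrightarrow> dist s t < e \<Longrightarrow> dist (one_param P s) (one_param P t) < d"
    unfolding eventually_at by auto
  then show ?thesis
    using that[of e] assms by (metis dist_real_def dist_self)
qed

lemma cis_rat_multiples_eq_1_imp:
  assumes "\<And>t. cis (b * of_rat t) = 1"
  shows "b = 0"
proof (rule ccontr)
  assume "b \<noteq> 0"
  then have "0 < pi / \<bar>b\<bar>"
    by simp
  then obtain r where r: "0 < r" "r < pi / \<bar>b\<bar>" "r \<in> \<rat>"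
    using Rats_dense_in_real by blast
  obtain t where t: "r = of_rat t"
    using r(3) by (auto elim: Rats_cases)
  have "0 < \<bar>b\<bar> * r" "\<bar>b\<bar> * r < pi"
    using r \<open>b \<noteq> 0\<close> by (simp_all add: field_simps)
  then have "sin (\<bar>b\<bar> * r) > 0"
    by (rule sin_gt_zero)
  moreover have "sin (b * r) = 0"
    using assms[of t] unfolding t by (metis cis.simps(2) one_complex.sel(2))
  ultimately show False
    by (cases "b \<ge> 0") auto
qed

text \<open>The multiples of \<open>P 0 * ... * P (k - 1)\<close> are invisible to the coordinates
  up to \<open>k\<close>, so they form arbitrarily small subgroups of the one-parameter group in the
  solenoid topology. This is what forces characters to be periodic.\<close>

lemma one_param_multiples_small:
  assumes P: "\<And>n. P n > 0" and "d > 0"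
  shows "\<exists>k. \<forall>n :: nat. dist (one_param P (of_nat n * real (\<Prod>i<k. P i))) (\<lambda>_. 1) < d"
proof (rule ccontr)
  assume "\<not> ?thesis"
  then obtain m :: "nat \<Rightarrow> nat" where m: "\<And>k. \<not> dist (one_param P (of_nat (m k) * real (\<Prod>i<k. P i))) (\<lambda>_. 1) < d"
    by metis
  have "(\<lambda>k. one_param P (of_nat (m k) * real (\<Prod>i<k. P i)) l) \<longlonglongrightarrow> 1" for l
  proof (rule tendsto_eventually)
    have "one_param P (of_nat (m k) * real (\<Prod>i<k. P i)) l = 1" if "k \<ge> l" for k
      using one_param_period[OF P that, where a = "int (m k)"] by simp
    then show "\<forall>\<^sub>F k in sequentially. one_param P (of_nat (m k) * real (\<Prod>i<k. P i)) l = 1"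
      unfolding eventually_sequentially by blast
  qed
  then have "(\<lambda>k. one_param P (of_nat (m k) * real (\<Prod>i<k. P i))) \<longlonglongrightarrow> (\<lambda>_. 1)"
    by (simp add: tendsto_fun_iff)
  from tendstoD[OF this \<open>d > 0\<close>] show False
    using m by simp
qed

text \<open>Coordinate \<open>j\<close> is \<open>cis (a j * t)\<close> with
  \<open>a 0 = a j * (Q 0 * ... * Q (j - 1))\<close>. A small subgroup of the source is mapped into
  a short arc, hence trivially, so some product of the \<open>P i\<close> times \<open>a j\<close>
  is a multiple of \<open>2 * pi\<close>. Comparing this for 0 and for \<open>j\<close> gives the
  divisibility.\<close>

lemma dvd_of_rat_hom:
  fixes S :: "rat \<Rightarrow> nat \<Rightarrow> complex"
  assumes P: "\<And>n. P n > 0" and Q: "\<And>n. Q n > 0"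
    and sol: "\<And>t. S t \<in> carrier (solenoid Q)"
    and add: "\<And>s t j. S (s + t) j = S s j * S t j"
    and cont: "\<And>j. \<exists>d>0. \<forall>t. dist (one_param P (of_rat t)) (\<lambda>_. 1) < d \<longrightarrow> norm (S t j - 1) < 1"
    and nontriv: "S t0 \<noteq> (\<lambda>_. 1)"
  obtains c where "c > 0" "\<And>j. \<exists>k. (\<Prod>i<j. Q i) dvd c * (\<Prod>i<k. P i)"
proof -
  have "\<exists>a. \<forall>t. S t j = cis (a * of_rat t)" for j
  proof -
    obtain d where d: "d > 0" "\<And>t. dist (one_param P (of_rat t)) (\<lambda>_. 1) < d \<Longrightarrow> norm (S t j - 1) < 1"
      using cont by blast
    obtain e where e: "e > 0" "\<And>s. \<bar>s\<bar> < e \<Longrightarrow> dist (one_param P s) (\<lambda>_. 1) < d"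
      using dist_one_param_less[OF d(1), of 0 P] by (auto simp del: one_param_def)
    obtain r where r: "0 < r" "of_rat r < e"
      using e(1) Rats_dense_in_real[of 0 e] by (metis Rats_cases zero_less_of_rat_iff)
    have "norm (S t j - 1) < 1" if "\<bar>t\<bar> \<le> r" for t
    proof -
      have "\<bar>of_rat t :: real\<bar> \<le> of_rat r"
        using that by (metis of_rat_less_eq abs_of_rat)
      then show ?thesis
        using r(2) e(2) d(2) by simp
    qed
    then show ?thesis
      using rat_circle_hom[of "\<lambda>t. S t j" r] add solenoid_norm[OF sol] r(1) by metis
  qed
  then obtain a where a: "\<And>t j. S t j = cis (a j * of_rat t)"
    by metis
  have a_Suc: "a j = a (Suc j) * real (Q j)" for j
  proof -
    have "cis ((a (Suc j) * real (Q j) - a j) * of_rat t) = 1" for t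
    proof -
      have "cis (real (Q j) * (a (Suc j) * of_rat t)) = cis (a j * of_rat t)"
        using sol[of t] unfolding mem_solenoid_iff a Complex.DeMoivre by blast
      then have "cis (real (Q j) * (a (Suc j) * of_rat t)) / cis (a j * of_rat t) = 1"
        by simp
      then show ?thesis
        by (simp add: cis_divide algebra_simps)
    qed
    then show ?thesis
      using cis_rat_multiples_eq_1_imp[of "a (Suc j) * real (Q j) - a j"] by simp
  qed
  have a_prod: "a 0 = a j * real (\<Prod>i<j. Q i)" for j
  proof (induction j)
    case (Suc j)
    then show ?case
      by (simp add: a_Suc[of j] mult_ac)
  qed simp
  have period: "\<exists>k m. a j * real (\<Prod>i<k. P i) = of_int m * 2 * pi" for j
  proof -
    obtain d where d: "d > 0" "\<And>t. dist (one_param P (of_rat t)) (\<lambda>_. 1) < d \<Longrightarrow> norm (S t j - 1) < 1"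
      using cont by blast
    obtain k where k: "\<And>n :: nat. dist (one_param P (of_nat n * real (\<Prod>i<k. P i))) (\<lambda>_. 1) < d"
      using one_param_multiples_small[of P d, OF P d(1)] by metis
    let ?N = "\<Prod>i<k. P i"
    have "norm (S (of_nat ?N) j ^ n - 1) < 1" for n
    proof -
      have "norm (S (of_nat (n * ?N)) j - 1) < 1"
        using k[of n] by (intro d(2)) (simp only: of_rat_of_nat_eq of_nat_mult of_rat_mult)
      then show ?thesis
        by (simp only: a Complex.DeMoivre mult_ac of_nat_mult of_rat_mult of_rat_of_nat_eq)
    qed
    then have "S (of_nat ?N) j = 1"
      using unit_circle_no_small_subgroups[OF solenoid_norm[OF sol]] by blast
    then have "cos (a j * real ?N) = 1"
      unfolding a by (metis cis.simps(1) of_rat_of_nat_eq one_complex.sel(1))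
    then show ?thesis
      using cos_one_2pi_int by blast
  qed
  \<comment> \<open>The integer obtained from coordinate 0 does not depend on \<open>j\<close>; its
    absolute value becomes \<open>c\<close>.\<close>
  obtain k0 m0 where m0: "a 0 * real (\<Prod>i<k0. P i) = of_int m0 * 2 * pi"
    using period by blast
  obtain j0 where "S t0 j0 \<noteq> 1"
    using nontriv by (auto simp: fun_eq_iff)
  then have "a j0 \<noteq> 0"
    by (auto simp: a)
  have posP: "(\<Prod>i<k. P i) > 0" and posQ: "(\<Prod>i<k. Q i) > 0" for k
    using P Q by (simp_all add: prod_pos)
  have "a 0 \<noteq> 0"
    using \<open>a j0 \<noteq> 0\<close> a_prod[of j0] posQ[of j0] by (metis less_irrefl mult_eq_0_iff of_nat_0_eq_iff)
  then have "m0 \<noteq> 0"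
    using m0 posP[of k0] by (metis less_irrefl mult_eq_0_iff of_int_0 of_nat_0_eq_iff)
  have "\<exists>k. (\<Prod>i<j. Q i) dvd nat \<bar>m0\<bar> * (\<Prod>i<k. P i)" for j
  proof -
    define A where "A = (\<Prod>i<j. Q i)"
    define N0 where "N0 = (\<Prod>i<k0. P i)"
    obtain k m where km: "a j * real (\<Prod>i<k. P i) = of_int m * 2 * pi"
      using period by blast
    define N where "N = (\<Prod>i<k. P i)"
    have "(of_int m * 2 * pi) * (real A * real N0) = (a 0 * real N0) * real N"
      unfolding km[symmetric] a_prod[of j] A_def N0_def N_def by (simp add: mult_ac)
    also have "\<dots> = of_int m0 * 2 * pi * real N"
      using m0 unfolding N0_def by simp
    finally have "real_of_int (m * int A * int N0) * (2 * pi) = real_of_int (m0 * int N) * (2 * pi)"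
      by (simp add: mult_ac)
    then have "m * int A * int N0 = m0 * int N"
      by (metis mult_cancel_right of_int_eq_iff pi_neq_zero mult_eq_0_iff zero_neq_numeral)
    then have "int A dvd m0 * int N"
      by (metis dvd_triv_left mult.assoc mult.commute)
    then have "A dvd nat \<bar>m0 * int N\<bar>"
      by (simp add: nat_dvd_iff flip: int_dvd_int_iff)
    then show ?thesis
      unfolding A_def N_def by (auto simp: nat_abs_mult_distrib simp del: of_nat_prod)
  qed
  then show ?thesis
    using that[of "nat \<bar>m0\<bar>"] \<open>m0 \<noteq> 0\<close> by simp
qed

text \<open>A real \<open>u n\<close> is chosen to match coordinate \<open>n\<close>; all earlier
  coordinates then match as powers, and a nearby rational replaces \<open>u n\<close>.\<close>

lemma one_param_rat_dense:
  assumes P: "\<And>n. P n > 0" and g: "g \<in> carrier (solenoid P)"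
  obtains t where "(\<lambda>n. one_param P (of_rat (t n))) \<longlonglongrightarrow> g"
proof -
  have "\<exists>u. \<forall>l\<le>n. one_param P u l = g l" for n
  proof -
    have "norm (g n) = 1"
      using g by (rule solenoid_norm)
    then obtain b where b: "g n = cis b"
      using rcis_cmod_Arg[of "g n"] by (metis rcis_def mult_1 of_real_1)
    define u where "u = b * real (\<Prod>i<n. P i) / (2 * pi)"
    have "real (\<Prod>i<n. P i) > 0"
      using P by (simp add: prod_pos)
    then have "2 * pi * u / real (\<Prod>i<n. P i) = b"
      unfolding u_def by (simp only: field_simps) simp
    then have n: "one_param P u n = g n"
      by (simp only: one_param_def b)
    have "one_param P u l = g l" if "l \<le> n" for l
      using solenoid_power_prod[OF one_param_in_solenoid[of P, OF P] that, of u] solenoid_power_prod[OF g that] n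
      by simp
    then show ?thesis by blast
  qed
  then obtain u where u: "\<And>n l. l \<le> n \<Longrightarrow> one_param P (u n) l = g l"
    by metis
  have "\<exists>t. dist (one_param P (of_rat t)) (one_param P (u n)) < 1 / real (Suc n)" for n
  proof -
    obtain e where e: "e > 0" "\<And>s. \<bar>s - u n\<bar> < e \<Longrightarrow> dist (one_param P s) (one_param P (u n)) < 1 / real (Suc n)"
      using dist_one_param_less[of "1 / real (Suc n)" "u n" P] by auto
    obtain r where "u n < r" "r < u n + e" "r \<in> \<rat>"
      using e(1) Rats_dense_in_real[of "u n" "u n + e"] by auto
    then show ?thesis
      using e(2)[of r] by (auto elim!: Rats_cases)
  qed
  then obtain t where t: "\<And>n. dist (one_param P (of_rat (t n))) (one_param P (u n)) < 1 / real (Suc n)"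
    by metis
  have "(\<lambda>n. one_param P (u n) l) \<longlonglongrightarrow> g l" for l
    using u by (intro tendsto_eventually) (auto simp: eventually_sequentially)
  then have lim: "(\<lambda>n. one_param P (u n)) \<longlonglongrightarrow> g"
    by (simp add: tendsto_fun_iff)
  have "(\<lambda>n. dist (one_param P (of_rat (t n))) (one_param P (u n))) \<longlonglongrightarrow> 0"
    by (rule tendsto_sandwich[OF _ _ tendsto_const LIMSEQ_inverse_real_of_nat])
      (use t in \<open>auto intro!: always_eventually less_imp_le simp: inverse_eq_divide\<close>)
  then have "(\<lambda>n. dist (one_param P (of_rat (t n))) (one_param P (u n)) + dist (one_param P (u n)) g) \<longlonglongrightarrow> 0 + 0"
    by (intro tendsto_add iffD1[OF tendsto_dist_iff lim])
  then have bound: "(\<lambda>n. dist (one_param P (of_rat (t n))) (one_param P (u n)) + dist (one_param P (u n)) g) \<longlonglongrightarrow> 0"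
    by simp
  have "(\<lambda>n. dist (one_param P (of_rat (t n))) g) \<longlonglongrightarrow> 0"
    by (rule Lim_null_comparison[OF always_eventually bound]) (simp add: dist_triangle)
  then have "(\<lambda>n. one_param P (of_rat (t n))) \<longlonglongrightarrow> g"
    by (rule iffD2[OF tendsto_dist_iff])
  then show ?thesis
    by (rule that)
qed

text \<open>Restriction to rational points of the one-parameter subgroup loses nothing: by density
  and continuity a homomorphism trivial there is trivial.\<close>

lemma dvd_of_solenoid_hom:
  assumes P: "\<And>n. P n > 0" and Q: "\<And>n. Q n > 0"
    and h: "h \<in> hom (solenoid P) (solenoid Q)" and cont: "continuous_on (carrier (solenoid P)) h"
    and nontriv: "g \<in> carrier (solenoid P)" "h g \<noteq> \<one>\<^bsub>solenoid Q\<^esub>"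
  obtains c where "c > 0" "\<And>j. \<exists>k. (\<Prod>i<j. Q i) dvd c * (\<Prod>i<k. P i)"
proof -
  define S where "S t = h (one_param P (of_rat t))" for t
  have in_P: "one_param P t \<in> carrier (solenoid P)" for t
    using P by (rule one_param_in_solenoid)
  have sol: "S t \<in> carrier (solenoid Q)" for t
    unfolding S_def using h in_P hom_in_carrier by metis
  have add: "S (s + t) j = S s j * S t j" for s t j
  proof -
    have "one_param P (of_rat (s + t)) = one_param P (of_rat s) \<otimes>\<^bsub>solenoid P\<^esub> one_param P (of_rat t)"
      by (simp add: mult_solenoid one_param_add of_rat_add fun_eq_iff)
    then have "S (s + t) = S s \<otimes>\<^bsub>solenoid Q\<^esub> S t"
      unfolding S_def using h in_P hom_mult by metis
    then show ?thesis
      by (simp add: mult_solenoid)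
  qed
  have "S 0 j = 1" for j
    using add[of 0 0 j] solenoid_nonzero[OF sol[of 0]] by simp
  then have h1: "h (\<lambda>_. 1) = (\<lambda>_. 1)"
    unfolding S_def by (simp add: fun_eq_iff)
  have "\<exists>d>0. \<forall>t. dist (one_param P (of_rat t)) (\<lambda>_. 1) < d \<longrightarrow> norm (S t j - 1) < 1" for j
  proof -
    have "continuous_on (carrier (solenoid P)) (\<lambda>g. h g j)"
      using cont by (rule continuous_on_product_then_coordinatewise)
    moreover have one: "(\<lambda>_. 1) \<in> carrier (solenoid P)"
      using in_P[of 0] by simp
    ultimately obtain d where "d > 0"
      "\<And>g. g \<in> carrier (solenoid P) \<Longrightarrow> dist g (\<lambda>_. 1) < d \<Longrightarrow> dist (h g j) (h (\<lambda>_. 1) j) < 1"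
      unfolding continuous_on_iff by (metis zero_less_one)
    then show ?thesis
      unfolding S_def using in_P h1 by (metis dist_norm)
  qed
  moreover have "\<exists>t. S t \<noteq> (\<lambda>_. 1)"
  proof (rule ccontr)
    assume triv: "\<nexists>t. S t \<noteq> (\<lambda>_. 1)"
    obtain t where "(\<lambda>n. one_param P (of_rat (t n))) \<longlonglongrightarrow> g"
      using one_param_rat_dense[OF P nontriv(1)] by blast
    then have "(\<lambda>n. S (t n)) \<longlonglongrightarrow> h g"
      unfolding S_def using in_P nontriv(1) by (intro continuous_on_tendsto_compose[OF cont]) auto
    then have "h g = (\<lambda>_. 1)"
      using triv by (simp add: LIMSEQ_const_iff)
    then show False
      using nontriv(2) by (simp add: one_solenoid)
  qed
  ultimately show ?thesis
    using dvd_of_rat_hom[of P Q S, OF P Q sol add] that by metis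
qed

subsection \<open>The infinite torus\<close>

text \<open>
  The ambient group of all solenoids is written additively. It carries the metric of the product
  space, which is translation invariant.
\<close>

typedef torus = "{h :: nat \<Rightarrow> complex. \<forall>j. norm (h j) = 1}"
  morphisms coord Abs_torus
  by (intro exI[of _ "\<lambda>_. 1"]) simp

lemma norm_coord [simp]: "norm (coord a j) = 1"
  using coord[of a] by simp

lemma coord_nonzero [simp]: "coord a j \<noteq> 0"
  using norm_coord[of a j] by (metis norm_zero zero_neq_one)

lemma coord_Abs_torus: "(\<And>j. norm (h j) = 1) \<Longrightarrow> coord (Abs_torus h) = h"
  by (simp add: Abs_torus_inverse)

lemma torus_eqI: "(\<And>j. coord a j = coord b j) \<Longrightarrow> a = b"
  using coord_inject by (metis ext)

instantiation torus :: ab_group_add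
begin

definition "0 = Abs_torus (\<lambda>_. 1)"
definition "a + b = Abs_torus (\<lambda>j. coord a j * coord b j)"
definition "a - b = Abs_torus (\<lambda>j. coord a j / coord b j)"
definition "- a = Abs_torus (\<lambda>j. inverse (coord a j))"

lemma coord_arith [simp]:
  "coord 0 j = 1" "coord (a + b) j = coord a j * coord b j"
  "coord (a - b) j = coord a j / coord b j" "coord (- a) j = inverse (coord a j)"
  by (simp_all add: zero_torus_def plus_torus_def minus_torus_def uminus_torus_def coord_Abs_torus
      norm_mult norm_divide norm_inverse)

instance
  by standard (rule torus_eqI; simp add: divide_inverse)+

end

instantiation torus :: metric_space
begin

definition "dist a b = dist (coord a) (coord b)"
definition "uniformity = (INF e\<in>{0<..}. principal {(x :: torus, y). dist x y < e})"
definition "open U = (\<forall>x\<in>U. eventually (\<lambda>(x', y). x' = x \<longrightarrow> y \<in> U) (uniformity :: (torus \<times> torus) filter))"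

instance
proof
  fix a b c :: torus
  show "dist a b = 0 \<longleftrightarrow> a = b"
    by (simp add: dist_torus_def coord_inject)
  show "dist a b \<le> dist a c + dist b c"
    unfolding dist_torus_def by (rule dist_triangle2)
qed (simp_all only: uniformity_torus_def open_torus_def)

end

lemma tendsto_torus_iff: "(f \<longlongrightarrow> a) F \<longleftrightarrow> (\<forall>j. ((\<lambda>n. coord (f n) j) \<longlongrightarrow> coord a j) F)"
  by (simp add: tendsto_dist_iff[of f] dist_torus_def flip: tendsto_dist_iff tendsto_fun_iff)

lemma convergent_torus_iff: "convergent f \<longleftrightarrow> convergent (\<lambda>n. coord (f n))"
proof
  assume "convergent (\<lambda>n. coord (f n))"
  then obtain h where h: "\<And>j. (\<lambda>n. coord (f n) j) \<longlonglongrightarrow> h j"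
    unfolding convergent_def tendsto_fun_iff by blast
  have "norm (h j) = 1" for j
    using tendsto_norm[OF h[of j]] by (simp add: LIMSEQ_const_iff)
  then have "f \<longlonglongrightarrow> Abs_torus h"
    using h by (simp add: tendsto_torus_iff coord_Abs_torus)
  then show "convergent f"
    unfolding convergent_def by blast
qed (auto simp: convergent_def tendsto_torus_iff tendsto_fun_iff)

instance torus :: complete_space
proof
  fix X :: "nat \<Rightarrow> torus" assume "Cauchy X"
  then have "Cauchy (\<lambda>n. coord (X n))"
    by (simp add: Cauchy_def dist_torus_def)
  then show "convergent X"
    by (simp add: convergent_torus_iff Cauchy_convergent_iff)
qed

lemma dist_torus_add_right [simp]: "dist (a + c) (b + c) = dist a b" for a b c :: torus
proof -
  have "dist (coord a j * coord c j) (coord b j * coord c j) = dist (coord a j) (coord b j)" for j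
    by (simp add: dist_norm norm_mult flip: left_diff_distrib)
  then show ?thesis
    by (simp add: dist_torus_def dist_fun_def)
qed

definition size_torus :: "torus \<Rightarrow> real" where
  "size_torus a = dist a 0"

lemma dist_torus_eq_size: "dist a b = size_torus (a - b)"
  using dist_torus_add_right[of "a - b" b 0] by (simp add: size_torus_def)

lemma size_torus_0 [simp]: "size_torus 0 = 0"
  by (simp add: size_torus_def)

lemma size_torus_nonneg [simp]: "size_torus a \<ge> 0"
  by (simp add: size_torus_def)

lemma size_torus_minus [simp]: "size_torus (- a) = size_torus a"
  using dist_commute[of 0 a] unfolding dist_torus_eq_size by simp

lemma size_torus_add: "size_torus (a + b) \<le> size_torus a + size_torus b"
  using dist_triangle[of "a + b" 0 b] unfolding dist_torus_eq_size by simp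

lemma size_torus_diff: "size_torus (a - b) \<le> size_torus a + size_torus b"
  using size_torus_add[of a "- b"] by simp

lemma size_torus_add_le: "size_torus a \<le> r \<Longrightarrow> size_torus b \<le> s \<Longrightarrow> size_torus (a + b) \<le> r + s"
  using size_torus_add[of a b] by linarith

lemma size_torus_diff_le: "size_torus a \<le> r \<Longrightarrow> size_torus b \<le> s \<Longrightarrow> size_torus (a - b) \<le> r + s"
  using size_torus_diff[of a b] by linarith

lemma size_torus_sum: "size_torus (sum f A) \<le> (\<Sum>x\<in>A. size_torus (f x))"
  by (induction A rule: infinite_finite_induct) (auto intro: order_trans[OF size_torus_add])

lemma tendsto_torus_0_iff: "(f \<longlongrightarrow> 0) F \<longleftrightarrow> ((\<lambda>n. size_torus (f n)) \<longlongrightarrow> 0) F"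
  by (simp add: tendsto_dist_iff[of f] size_torus_def)

lemma coord_sum: "coord (sum f A) j = (\<Prod>x\<in>A. coord (f x) j)"
  by (induction A rule: infinite_finite_induct) simp_all

lemma coord_near_1:
  assumes "e > 0"
  obtains d where "d > 0" "\<And>a. size_torus a < d \<Longrightarrow> norm (coord a j - 1) < e"
proof -
  have "continuous_on UNIV (\<lambda>h :: nat \<Rightarrow> complex. h j)"
    by simp
  then have "\<exists>d>0. \<forall>h\<in>UNIV. dist h (\<lambda>_. 1 :: complex) < d \<longrightarrow> dist (h j) ((\<lambda>_. 1) j) < e"
    using assms unfolding continuous_on_iff by blast
  then obtain d where d: "d > 0" "\<forall>h. dist h (\<lambda>_. 1 :: complex) < d \<longrightarrow> dist (h j) 1 < e"
    by auto
  have "coord 0 = (\<lambda>_. 1)"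
    by (simp add: fun_eq_iff)
  then show ?thesis
    using that[of d] d by (simp add: size_torus_def dist_torus_def dist_norm)
qed

definition orbit :: "(nat \<Rightarrow> nat) \<Rightarrow> rat \<Rightarrow> torus" where
  "orbit P t = Abs_torus (one_param P (of_rat t))"

lemma coord_orbit [simp]: "coord (orbit P t) = one_param P (of_rat t)"
  by (simp add: orbit_def coord_Abs_torus)

lemma orbit_0 [simp]: "orbit P 0 = 0"
  by (rule torus_eqI) simp

lemma orbit_add: "orbit P (s + t) = orbit P s + orbit P t"
  by (rule torus_eqI) (simp add: one_param_add of_rat_add)

lemma orbit_sum: "orbit P (sum f A) = (\<Sum>x\<in>A. orbit P (f x))"
  by (induction A rule: infinite_finite_induct) (simp_all add: orbit_add)

lemma size_orbit: "size_torus (orbit P t) = dist (one_param P (of_rat t)) (\<lambda>_. 1)"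
proof -
  have "coord 0 = (\<lambda>_. 1)"
    by (simp add: fun_eq_iff)
  then show ?thesis
    by (simp add: size_torus_def dist_torus_def)
qed

lemma convergent_partial_sums_torus:
  fixes f :: "nat \<Rightarrow> torus"
  assumes "summable (\<lambda>m. size_torus (f m))"
  shows "convergent (\<lambda>n. \<Sum>m<n. f m)"
proof -
  have "Cauchy (\<lambda>n. \<Sum>m<n. f m)"
    unfolding Cauchy_altdef2
  proof (intro allI impI)
    fix e :: real assume "e > 0"
    then obtain N where N: "\<And>m n. m \<ge> N \<Longrightarrow> norm (\<Sum>k=m..<n. size_torus (f k)) < e"
      using assms unfolding summable_Cauchy by blast
    have "dist (\<Sum>m<n. f m) (\<Sum>m<N. f m) < e" if "n \<ge> N" for n
    proof -
      have "(\<Sum>m<n. f m) - (\<Sum>m<N. f m) = (\<Sum>m=N..<n. f m)"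
        using that sum_diff_nat_ivl[of 0 N n f] by (simp add: atLeast0LessThan)
      then have "dist (\<Sum>m<n. f m) (\<Sum>m<N. f m) \<le> (\<Sum>m=N..<n. size_torus (f m))"
        by (simp add: dist_torus_eq_size size_torus_sum)
      also have "\<dots> < e"
        using N[of N n] by simp
      finally show ?thesis .
    qed
    then show "\<exists>N. \<forall>n\<ge>N. dist (\<Sum>m<n. f m) (\<Sum>m<N. f m) < e"
      by blast
  qed
  then show ?thesis
    by (simp add: Cauchy_convergent_iff)
qed

subsection \<open>Block reductions\<close>

text \<open>
  Along a subsequence \<open>e m\<close> tends to some \<open>z \<noteq> 1\<close>, so products of \<open>n\<close> of its terms approximate
  \<open>z ^ n\<close>; these powers cannot all be close to \<open>1\<close>.
\<close>

lemma unit_circle_large_products: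
  fixes e :: "nat \<Rightarrow> complex"
  assumes unit: "\<And>m. norm (e m) = 1" and not: "\<not> e \<longlonglongrightarrow> 1"
  shows "\<exists>A. finite A \<and> A \<subseteq> {M..} \<and> (\<forall>m\<in>A. Suc m \<notin> A) \<and> norm ((\<Prod>m\<in>A. e m) - 1) \<ge> 1 / 2"
proof (rule ccontr)
  assume contr: "\<not> ?thesis"
  obtain d where d: "d > 0" "\<not> (\<forall>\<^sub>F m in sequentially. dist (e m) 1 < d)"
    using not unfolding tendsto_iff by blast
  then have "infinite {m. \<not> dist (e m) 1 < d}"
    by (simp add: cofinite_eq_sequentially[symmetric] eventually_cofinite)
  then obtain f :: "nat \<Rightarrow> nat" where f: "strict_mono f" "\<And>n. \<not> dist (e (f n)) 1 < d"
    using infinite_enumerate[of "{m. \<not> dist (e m) 1 < d}"] by auto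
  have "seq_compact (sphere (0::complex) 1)"
    by (simp add: compact_imp_seq_compact)
  then obtain z g where g: "strict_mono (g :: nat \<Rightarrow> nat)" "((e \<circ> f) \<circ> g) \<longlonglongrightarrow> z" and "z \<in> sphere 0 1"
    by (rule seq_compactE[of _ "e \<circ> f"]) (use unit in auto)
  define r where "r = f \<circ> g"
  have r: "strict_mono r"
    unfolding r_def using f(1) g(1) by (rule strict_mono_o)
  have lim: "(\<lambda>n. e (r n)) \<longlonglongrightarrow> z"
    using g(2) by (simp add: r_def o_def)
  have "norm (z ^ n - 1) \<le> 1 / 2" for n
  proof (rule tendsto_upperbound)
    \<comment> \<open>The factor 2 skips a term of the subsequence, so the chosen indices are at
      least 2 apart and none is the successor of another; \<open>i\<close> pushes all of them to
      infinity.\<close>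
    define s where "s i q = r (M + 2 * (i + q))" for i q
    have s_lim: "(\<lambda>i. e (s i q)) \<longlonglongrightarrow> z" for q
      unfolding s_def using lim
      by (rule filterlim_compose) (auto intro!: filterlim_subseq strict_monoI r[THEN strict_monoD])
    have "(\<lambda>i. norm ((\<Prod>q<n. e (s i q)) - 1)) \<longlonglongrightarrow> norm ((\<Prod>q<n. z) - 1)"
      by (intro tendsto_intros s_lim)
    then show "(\<lambda>i. norm ((\<Prod>q<n. e (s i q)) - 1)) \<longlonglongrightarrow> norm (z ^ n - 1)"
      by simp
    have "norm ((\<Prod>q<n. e (s i q)) - 1) \<le> 1 / 2" for i
    proof -
      have mono: "s i q + 2 \<le> s i q'" if "q < q'" for q q'
      proof -
        have "r (M + 2 * (i + q)) < r (M + 2 * (i + q) + 1)" "r (M + 2 * (i + q) + 1) < r (M + 2 * (i + q'))"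
          using that by (auto intro!: r[THEN strict_monoD])
        then show ?thesis
          unfolding s_def by simp
      qed
      have inj: "inj_on (s i) {..<n}"
      proof (rule inj_onI)
        fix q q' assume "s i q = s i q'"
        then show "q = q'"
          using mono[of q q'] mono[of q' q] by (cases q q' rule: linorder_cases) auto
      qed
      have "M \<le> s i q" for q
        unfolding s_def using strict_mono_imp_increasing[OF r, of "M + 2 * (i + q)"] by simp
      then have "s i ` {..<n} \<subseteq> {M..}"
        by auto
      moreover have "Suc m \<notin> s i ` {..<n}" if m: "m \<in> s i ` {..<n}" for m
      proof
        assume "Suc m \<in> s i ` {..<n}"
        then obtain q q' where "m = s i q" "Suc m = s i q'"
          using m by auto
        then show False
          using mono[of q q'] mono[of q' q] by (cases q q' rule: linorder_cases) auto
      qed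
      ultimately have "\<not> norm ((\<Prod>m\<in>s i ` {..<n}. e m) - 1) \<ge> 1 / 2"
        using contr by (metis finite_imageI finite_lessThan)
      then show ?thesis
        using prod.reindex[OF inj, of e] by (simp add: o_def)
    qed
    then show "\<forall>\<^sub>F i in sequentially. norm ((\<Prod>q<n. e (s i q)) - 1) \<le> 1 / 2"
      by (rule always_eventually[OF allI])
  qed simp
  then have "norm (z ^ n - 1) < 1" for n
    by (rule le_less_trans) simp
  then have "z = 1"
    using \<open>z \<in> sphere 0 1\<close> by (intro unit_circle_no_small_subgroups) auto
  then have "\<forall>\<^sub>F n in sequentially. dist (e (r n)) 1 < d"
    using tendstoD[OF lim d(1)] by simp
  then show False
    using f(2) by (simp add: r_def)
qed

text \<open>What is kept of a Borel reduction. By \<open>determined\<close> late entries hardly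
  affect early outputs; by \<open>stable\<close> early entries shift late outputs by a nearly
  constant amount. Hence entry \<open>n\<close> acts mainly between the outputs \<open>l n\<close>
  and \<open>l (Suc n)\<close>.\<close>

locale block_reduction =
  fixes P :: "nat \<Rightarrow> nat" and F :: "nat \<Rightarrow> rat set" and l :: "nat \<Rightarrow> nat"
    and \<Theta> :: "(nat \<Rightarrow> rat) \<Rightarrow> nat \<Rightarrow> torus"
  assumes F_zero: "\<And>n. 0 \<in> F n" and F_mono: "\<And>m n. m \<le> n \<Longrightarrow> F m \<subseteq> F n" and F_UNIV: "(\<Union>n. F n) = UNIV"
    and l_mono: "strict_mono l"
    and determined: "\<And>y y' n i. \<forall>n. y n \<in> F n \<Longrightarrow> \<forall>n. y' n \<in> F n \<Longrightarrow> \<forall>m<n. y m = y' m \<Longrightarrow> i \<le> l n \<Longrightarrow>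
      size_torus (\<Theta> y i - \<Theta> y' i) \<le> (1 / 2) ^ n"
    and stable: "\<And>y y' n i i'. \<forall>n. y n \<in> F n \<Longrightarrow> \<forall>n. y' n \<in> F n \<Longrightarrow> \<forall>m\<ge>n. y m = y' m \<Longrightarrow> l n \<le> i \<Longrightarrow> l n \<le> i' \<Longrightarrow>
      size_torus ((\<Theta> y i - \<Theta> y' i) - (\<Theta> y i' - \<Theta> y' i')) \<le> (1 / 2) ^ n"
    and equiv: "\<And>y y'. \<forall>n. y n \<in> F n \<Longrightarrow> \<forall>n. y' n \<in> F n \<Longrightarrow>
      convergent (\<lambda>i. \<Theta> y i - \<Theta> y' i) \<longleftrightarrow> convergent (\<lambda>n. orbit P (\<Sum>m<n. y m - y' m))"
begin

definition adm :: "(nat \<Rightarrow> rat) \<Rightarrow> bool" where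
  "adm y \<longleftrightarrow> (\<forall>n. y n \<in> F n)"

definition T :: "nat \<Rightarrow> rat \<Rightarrow> nat \<Rightarrow> torus" where
  "T n g i = \<Theta> (\<lambda>m. if m = n then g else 0) i - \<Theta> (\<lambda>_. 0) i"

definition S :: "nat \<Rightarrow> rat \<Rightarrow> torus" where
  "S n g = T n g (l (Suc n))"

text \<open>
  Up to summable errors, the entry \<open>y n\<close> contributes \<open>T n (y n) i\<close> to the outputs with indices
  \<open>i\<close> between \<open>l n\<close> and \<open>l (Suc n)\<close>, and \<open>S n (y n)\<close> to all later ones.
\<close>

lemma T_0 [simp]: "T n 0 i = 0"
proof -
  have "(\<lambda>m. if m = n then 0 else 0) = (\<lambda>_. 0 :: rat)"
    by auto
  then show ?thesis
    by (simp add: T_def)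
qed

lemma S_0 [simp]: "S n 0 = 0"
  by (simp add: S_def)

lemma l_le: "m \<le> n \<Longrightarrow> l m \<le> l n"
  using l_mono by (simp add: strict_mono_less_eq)

lemma eventually_in_F: "\<exists>N. \<forall>n\<ge>N. g \<in> F n"
  using F_UNIV F_mono by (metis UNIV_I UN_iff subsetD)

lemma adm_zero [simp]: "adm (\<lambda>_. 0)"
  using F_zero by (simp add: adm_def)

lemma T_approx:
  assumes y: "adm y" and i: "l n \<le> i" "i \<le> l (Suc n)"
  shows "size_torus (\<Theta> y i - \<Theta> y (l n) - (\<Theta> (\<lambda>_. 0) i - \<Theta> (\<lambda>_. 0) (l n)) - T n (y n) i) \<le> 3 * (1 / 2) ^ n"
proof -
  \<comment> \<open>Later entries are erased first (\<open>determined\<close> at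
    \<open>Suc n\<close>), then earlier ones (\<open>stable\<close> at \<open>n\<close>); the value
    left at \<open>l n\<close> is negligible by \<open>determined\<close> at \<open>n\<close>. The
    four errors add up to \<open>3 * (1 / 2) ^ n\<close>.\<close>
  define y1 where "y1 m = (if m \<le> n then y m else 0)" for m
  define y2 where "y2 m = (if m = n then y n else 0)" for m
  let ?z = "\<lambda>_ :: nat. 0 :: rat"
  have F: "\<forall>n. y n \<in> F n" "\<forall>n. y1 n \<in> F n" "\<forall>n. y2 n \<in> F n" "\<forall>n. ?z n \<in> F n"
    using y F_zero by (auto simp: adm_def y1_def y2_def)
  have a: "size_torus (\<Theta> y k - \<Theta> y1 k) \<le> (1 / 2) ^ Suc n" if "k \<le> l (Suc n)" for k
    using that by (intro determined F) (auto simp: y1_def)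
  have b: "size_torus ((\<Theta> y1 i - \<Theta> y2 i) - (\<Theta> y1 (l n) - \<Theta> y2 (l n))) \<le> (1 / 2) ^ n"
    using i by (intro stable F) (auto simp: y1_def y2_def)
  have c: "size_torus (\<Theta> y2 (l n) - \<Theta> ?z (l n)) \<le> (1 / 2) ^ n"
    by (intro determined F) (auto simp: y2_def)
  have T: "T n (y n) i = \<Theta> y2 i - \<Theta> ?z i"
    unfolding T_def y2_def ..
  have "\<Theta> y i - \<Theta> y (l n) - (\<Theta> ?z i - \<Theta> ?z (l n)) - T n (y n) i
      = (\<Theta> y i - \<Theta> y1 i) - (\<Theta> y (l n) - \<Theta> y1 (l n))
        + ((\<Theta> y1 i - \<Theta> y2 i) - (\<Theta> y1 (l n) - \<Theta> y2 (l n))) - (\<Theta> y2 (l n) - \<Theta> ?z (l n))"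
    by (simp add: T)
  also have "size_torus \<dots> \<le> (1 / 2) ^ Suc n + (1 / 2) ^ Suc n + (1 / 2) ^ n + (1 / 2) ^ n"
    using i l_le[of n "Suc n"]
    by (intro size_torus_diff_le[OF size_torus_add_le[OF size_torus_diff_le b] c] a) auto
  finally show ?thesis
    by simp
qed

lemma quotient_approx:
  assumes y: "adm y" and y': "adm y'" and i: "l n \<le> i" "i \<le> l (Suc n)"
  shows "size_torus ((\<Theta> y i - \<Theta> y' i) - (\<Theta> y (l n) - \<Theta> y' (l n)) - (T n (y n) i - T n (y' n) i)) \<le> 6 * (1 / 2) ^ n"
proof -
  have "(\<Theta> y i - \<Theta> y' i) - (\<Theta> y (l n) - \<Theta> y' (l n)) - (T n (y n) i - T n (y' n) i)
     = (\<Theta> y i - \<Theta> y (l n) - (\<Theta> (\<lambda>_. 0) i - \<Theta> (\<lambda>_. 0) (l n)) - T n (y n) i)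
       - (\<Theta> y' i - \<Theta> y' (l n) - (\<Theta> (\<lambda>_. 0) i - \<Theta> (\<lambda>_. 0) (l n)) - T n (y' n) i)"
    by simp
  also have "size_torus \<dots> \<le> 3 * (1 / 2) ^ n + 3 * (1 / 2) ^ n"
    by (intro size_torus_diff_le T_approx y y' i)
  finally show ?thesis
    by simp
qed

text \<open>Telescoping over the blocks; the geometric tail doubles the constant 6.\<close>

lemma sum_approx:
  assumes y: "adm y" and y': "adm y'" and "n \<le> n'"
  shows "size_torus ((\<Theta> y (l n') - \<Theta> y' (l n')) - (\<Theta> y (l n) - \<Theta> y' (l n))
     - (\<Sum>m=n..<n'. S m (y m) - S m (y' m))) \<le> 12 * (1 / 2) ^ n"
proof -
  define R where "R i = \<Theta> y i - \<Theta> y' i" for i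
  have "(R (l n') - R (l n)) - (\<Sum>m=n..<n'. S m (y m) - S m (y' m))
      = (\<Sum>m=n..<n'. R (l (Suc m)) - R (l m) - (S m (y m) - S m (y' m)))"
    using sum_Suc_diff'[OF \<open>n \<le> n'\<close>, of "\<lambda>m. R (l m)"] by (simp add: sum_subtractf)
  also have "size_torus \<dots> \<le> (\<Sum>m=n..<n'. 6 * (1 / 2) ^ m)"
    unfolding R_def S_def
    by (intro order_trans[OF size_torus_sum] sum_mono quotient_approx y y' l_le) auto
  also have "\<dots> = 6 * (\<Sum>m=n..<n'. (1 / 2) ^ m)"
    by (simp add: sum_distrib_left)
  also have "(\<Sum>m=n..<n'. (1 / 2 :: real) ^ m) \<le> 2 * (1 / 2) ^ n"
  proof -
    have "(\<Sum>m=n..<n'. (1 / 2 :: real) ^ m) = 2 * (1 / 2) ^ n - 2 * (1 / 2) ^ n'"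
      using \<open>n \<le> n'\<close> by (induction n' rule: dec_induct) auto
    then show ?thesis by simp
  qed
  finally show ?thesis
    by (simp add: R_def)
qed

lemma half_power_tendsto_0: "(\<lambda>n. c * (1 / 2 :: real) ^ n) \<longlonglongrightarrow> 0"
  by (intro tendsto_mult_right_zero LIMSEQ_realpow_zero) auto

lemma half_power_small:
  assumes "e > 0"
  obtains N where "\<And>n. n \<ge> N \<Longrightarrow> c * (1 / 2 :: real) ^ n < e"
  using order_tendstoD(2)[OF half_power_tendsto_0[of c] assms] unfolding eventually_sequentially by blast

lemma equiv_imp_small:
  assumes y: "adm y" and y': "adm y'" and conv: "convergent (\<lambda>n. orbit P (\<Sum>m<n. y m - y' m))" and "e > 0"
  shows "\<exists>N. (\<forall>n\<ge>N. \<forall>i. l n \<le> i \<longrightarrow> i \<le> l (Suc n) \<longrightarrow> size_torus (T n (y n) i - T n (y' n) i) < e) \<and>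
    (\<forall>n\<ge>N. \<forall>n'\<ge>n. size_torus (\<Sum>m=n..<n'. S m (y m) - S m (y' m)) < e)"
proof -
  define R where "R i = \<Theta> y i - \<Theta> y' i" for i
  have "convergent R"
    unfolding R_def using equiv conv y y' by (simp add: adm_def)
  then have "Cauchy R"
    by (simp add: Cauchy_convergent_iff)
  then obtain N1 where N1: "\<And>i i'. i \<ge> N1 \<Longrightarrow> i' \<ge> N1 \<Longrightarrow> size_torus (R i - R i') < e / 2"
    using \<open>e > 0\<close> unfolding Cauchy_def dist_torus_eq_size by (meson half_gt_zero)
  obtain N2 where N2: "\<And>n. n \<ge> N2 \<Longrightarrow> 12 * (1 / 2 :: real) ^ n < e / 2"
    using half_power_small[of "e / 2" 12] \<open>e > 0\<close> by auto
  have large: "l n \<ge> N1" if "n \<ge> max N1 N2" for n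
    using that strict_mono_imp_increasing[OF l_mono, of n] by simp
  show ?thesis
  proof (intro exI[of _ "max N1 N2"] conjI allI impI)
    fix n i assume n: "n \<ge> max N1 N2" and i: "l n \<le> i" "i \<le> l (Suc n)"
    have "T n (y n) i - T n (y' n) i = (R i - R (l n)) - (R i - R (l n) - (T n (y n) i - T n (y' n) i))"
      by simp
    also have "size_torus \<dots> \<le> size_torus (R i - R (l n)) + 6 * (1 / 2) ^ n"
      unfolding R_def by (rule size_torus_diff_le[OF order_refl quotient_approx[OF y y' i]])
    also have "\<dots> < e"
    proof -
      have "(1 / 2 :: real) ^ n \<ge> 0"
        by simp
      moreover have "size_torus (R i - R (l n)) < e / 2" "12 * (1 / 2 :: real) ^ n < e / 2"
        using N1[of i "l n"] N2[of n] large[OF n] n i by auto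
      ultimately show ?thesis
        by linarith
    qed
    finally show "size_torus (T n (y n) i - T n (y' n) i) < e" .
  next
    fix n n' assume n: "n \<ge> max N1 N2" and "n \<le> n'"
    let ?s = "\<Sum>m=n..<n'. S m (y m) - S m (y' m)"
    have "?s = (R (l n') - R (l n)) - (R (l n') - R (l n) - ?s)"
      by simp
    also have "size_torus \<dots> \<le> size_torus (R (l n') - R (l n)) + 12 * (1 / 2) ^ n"
      unfolding R_def by (rule size_torus_diff_le[OF order_refl sum_approx[OF y y' \<open>n \<le> n'\<close>]])
    also have "\<dots> < e"
      using N1[of "l n'" "l n"] N2[of n] large[of n] large[of n'] n \<open>n \<le> n'\<close> by auto
    finally show "size_torus ?s < e" .
  qed
qed

text \<open>Convergence of the sums of \<open>S\<close> controls the outputs only at the indices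
  \<open>l n\<close>; smallness of \<open>T\<close> is needed for the indices in between.\<close>

lemma small_imp_equiv:
  assumes y: "adm y" and y': "adm y'" and sums: "convergent (\<lambda>n. \<Sum>m<n. S m (y m) - S m (y' m))"
    and small: "\<And>e. e > 0 \<Longrightarrow> \<exists>N. \<forall>n\<ge>N. \<forall>i. l n \<le> i \<longrightarrow> i \<le> l (Suc n) \<longrightarrow> size_torus (T n (y n) i - T n (y' n) i) < e"
  shows "convergent (\<lambda>n. orbit P (\<Sum>m<n. y m - y' m))"
proof -
  define R where "R i = \<Theta> y i - \<Theta> y' i" for i
  have "Cauchy R"
    unfolding Cauchy_altdef2
  proof (intro allI impI)
    fix e :: real assume "e > 0"
    obtain N1 where N1: "\<And>n. n \<ge> N1 \<Longrightarrow> dist (\<Sum>m<n. S m (y m) - S m (y' m)) (\<Sum>m<N1. S m (y m) - S m (y' m)) < e / 8"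
      using convergent_Cauchy[OF sums] \<open>e > 0\<close> unfolding Cauchy_altdef2 by (metis zero_less_divide_iff zero_less_numeral)
    obtain N2 where N2: "\<And>n i. n \<ge> N2 \<Longrightarrow> l n \<le> i \<Longrightarrow> i \<le> l (Suc n) \<Longrightarrow> size_torus (T n (y n) i - T n (y' n) i) < e / 4"
      using small[of "e / 4"] \<open>e > 0\<close> by auto
    obtain N3 where N3: "\<And>n. n \<ge> N3 \<Longrightarrow> 12 * (1 / 2 :: real) ^ n < e / 8"
      using half_power_small[of "e / 8" 12] \<open>e > 0\<close> by auto
    define N where "N = max N1 (max N2 N3)"
    have "dist (R i) (R (l N)) < e" if i: "i \<ge> l N" for i
    proof -
      \<comment> \<open>The block containing \<open>i\<close>: one less than the first
        \<open>k\<close> with \<open>i < l k\<close>.\<close>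
      obtain n where n: "n \<ge> N" "l n \<le> i" "i \<le> l (Suc n)"
      proof -
        have "\<exists>n. i < l n"
          using strict_mono_imp_increasing[OF l_mono] by (meson less_eq_Suc_le)
        define k where "k = (LEAST n. i < l n)"
        have k: "i < l k"
          unfolding k_def using \<open>\<exists>n. i < l n\<close> by (rule LeastI_ex)
        have "N < k"
          using k i l_le[of k N] by (cases "N < k") auto
        then have "\<not> i < l (k - 1)"
          unfolding k_def by (intro not_less_Least) (simp add: k_def)
        then show thesis
          using that[of "k - 1"] k \<open>N < k\<close> by simp
      qed
      let ?s = "\<Sum>m=N..<n. S m (y m) - S m (y' m)"
      have s_eq: "?s = (\<Sum>m<n. S m (y m) - S m (y' m)) - (\<Sum>m<N. S m (y m) - S m (y' m))"
        using sum_diff_nat_ivl[of 0 N n "\<lambda>m. S m (y m) - S m (y' m)"] n(1) by (simp add: atLeast0LessThan)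
      have s: "size_torus ?s < e / 4"
        unfolding s_eq dist_torus_eq_size[symmetric]
        using N1[of n] N1[of N] n(1) dist_triangle2[of "\<Sum>m<n. S m (y m) - S m (y' m)" "\<Sum>m<N. S m (y m) - S m (y' m)" "\<Sum>m<N1. S m (y m) - S m (y' m)"]
        unfolding N_def by simp
      have "R i - R (l N) = (R i - R (l n) - (T n (y n) i - T n (y' n) i)) + (T n (y n) i - T n (y' n) i)
          + (R (l n) - R (l N) - ?s) + ?s"
        by simp
      also have "size_torus \<dots> \<le> 6 * (1 / 2) ^ n + e / 4 + 12 * (1 / 2) ^ N + e / 4"
        unfolding R_def
        using s N2[of n i] n
        by (intro size_torus_add_le[OF size_torus_add_le[OF size_torus_add_le[OF quotient_approx[OF y y']]] _] sum_approx y y')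
          (auto simp: N_def)
      also have "\<dots> < e"
      proof -
        have "(1 / 2 :: real) ^ n \<ge> 0"
          by simp
        moreover have "12 * (1 / 2 :: real) ^ n < e / 8" "12 * (1 / 2 :: real) ^ N < e / 8"
          using N3[of n] N3[of N] n(1) by (auto simp: N_def)
        ultimately show ?thesis
          using \<open>e > 0\<close> by linarith
      qed
      finally show ?thesis
        by (simp add: dist_torus_eq_size)
    qed
    then show "\<exists>N. \<forall>n\<ge>N. dist (R n) (R N) < e"
      by blast
  qed
  then show ?thesis
    unfolding R_def using equiv y y' by (simp add: adm_def Cauchy_convergent_iff)
qed

end

section \<open>Sparse test sequences and the near additivity of \<open>S\<close>\<close>

lemma sum_lessThan_subseq:
  fixes y :: "nat \<Rightarrow> 'a::comm_monoid_add" and r :: "nat \<Rightarrow> nat"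
  assumes r: "strict_mono r" and zero: "\<And>m. m \<notin> range r \<Longrightarrow> y m = 0"
  shows "(\<Sum>m<r K. y m) = (\<Sum>k<K. y (r k))"
proof -
  have "r ` {..<K} \<subseteq> {..<r K}"
    using r by (auto simp: strict_mono_less)
  moreover have "y m = 0" if "m \<in> {..<r K} - r ` {..<K}" for m
  proof (rule zero)
    show "m \<notin> range r"
      using that strict_mono_less[OF r] by auto
  qed
  ultimately have "(\<Sum>m<r K. y m) = (\<Sum>m\<in>r ` {..<K}. y m)"
    by (intro sum.mono_neutral_right) auto
  also have "\<dots> = (\<Sum>k<K. y (r k))"
    using strict_mono_imp_inj_on[OF r] by (subst sum.reindex) (auto intro: inj_on_subset)
  finally show ?thesis .
qed

text \<open>By the limit defining the Euler-Mascheroni constant, the sums from \<open>K\<close> to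
  \<open>2 * K\<close> tend to \<open>ln 2\<close>. As \<open>0 < ln 2 < 1\<close> and coordinate 0
  has period 1, this coordinate cannot converge.\<close>

lemma harmonic_orbit_not_convergent:
  "\<not> convergent (\<lambda>K. orbit P (\<Sum>k<K. 1 / of_nat (Suc k)))"
proof
  define H where "H K = real_of_rat (\<Sum>k<K. 1 / of_nat (Suc k))" for K
  have H: "H K = harm K" for K
    unfolding H_def harm_def
    by (simp add: of_rat_sum of_rat_divide sum.atLeast1_atMost_eq inverse_eq_divide)
      (simp add: of_rat_add)
  assume "convergent (\<lambda>K. orbit P (\<Sum>k<K. 1 / of_nat (Suc k)))"
  then have "convergent (\<lambda>K. one_param P (H K) 0)"
    unfolding convergent_torus_iff coord_orbit convergent_fun_iff H_def by blast
  then obtain z where z: "(\<lambda>K. cis (2 * pi * H K)) \<longlonglongrightarrow> z"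
    by (auto simp: convergent_def one_param_def)
  have "norm z = 1"
    using tendsto_norm[OF z] by (simp add: LIMSEQ_const_iff)
  then have "z \<noteq> 0" by auto
  have sub: "filterlim (\<lambda>K::nat. 2 * K) sequentially sequentially"
    by (auto intro!: filterlim_subseq strict_monoI)
  have "(\<lambda>K. cis (2 * pi * H (2 * K)) / cis (2 * pi * H K)) \<longlonglongrightarrow> z / z"
    using \<open>z \<noteq> 0\<close> by (intro tendsto_divide z filterlim_compose[OF z sub])
  then have one: "(\<lambda>K. cis (2 * pi * (H (2 * K) - H K))) \<longlonglongrightarrow> 1"
    using \<open>z \<noteq> 0\<close> by (simp add: cis_divide right_diff_distrib)
  have gamma: "(\<lambda>n. harm n - ln (of_nat n) :: real) \<longlonglongrightarrow> euler_mascheroni"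
    by (rule euler_mascheroni_LIMSEQ)
  have "(\<lambda>K. (harm (2 * K) - ln (real (2 * K))) - (harm K - ln (real K)) + ln 2) \<longlonglongrightarrow>
      (euler_mascheroni - euler_mascheroni + ln 2 :: real)"
    by (intro tendsto_add tendsto_diff gamma filterlim_compose[OF gamma sub] tendsto_const)
  moreover have "\<forall>\<^sub>F K in sequentially.
      (harm (2 * K) - ln (real (2 * K))) - (harm K - ln (real K)) + ln 2 = H (2 * K) - H K"
    using eventually_gt_at_top[of "0::nat"] by eventually_elim (simp add: H ln_mult)
  ultimately have "(\<lambda>K. H (2 * K) - H K) \<longlonglongrightarrow> ln 2"
    using Lim_transform_eventually by fastforce
  then have "(\<lambda>K. cis (2 * pi * (H (2 * K) - H K))) \<longlonglongrightarrow> cis (2 * pi * ln 2)"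
    by (intro tendsto_cis tendsto_mult_left)
  then have "cis (2 * pi * ln 2) = 1"
    using one LIMSEQ_unique by blast
  then have "cos (2 * pi * ln 2) = 1"
    by (metis cis.simps(1) one_complex.sel(1))
  then obtain n :: int where "2 * pi * ln 2 = of_int n * 2 * pi"
    using cos_one_2pi_int by blast
  then have "ln 2 = real_of_int n"
    by simp
  moreover have "0 < ln (2 :: real)" "ln (2 :: real) < 1"
    using ln_2_less_1 by auto
  ultimately show False
    by simp
qed

context block_reduction
begin

text \<open>Counterexamples with summable orbit sizes, placed sparsely, would give a sequence
  equivalent to zero whose outputs keep moving inside blocks, against
  \<open>equiv_imp_small\<close>.\<close>

lemma T_small:
  assumes "e > 0"
  shows "\<exists>d>0. \<exists>N. \<forall>n\<ge>N. \<forall>h\<in>F n. size_torus (orbit P h) < d \<longrightarrow>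
    (\<forall>i. l n \<le> i \<longrightarrow> i \<le> l (Suc n) \<longrightarrow> size_torus (T n h i) < e)"
proof (rule ccontr)
  assume contr: "\<not> ?thesis"
  have "\<exists>n h i. N \<le> n \<and> h \<in> F n \<and> size_torus (orbit P h) < (1 / 2) ^ k \<and>
      l n \<le> i \<and> i \<le> l (Suc n) \<and> \<not> size_torus (T n h i) < e" for N k :: nat
  proof -
    have "(1 / 2 :: real) ^ k > 0" by simp
    then show ?thesis
      using contr by metis
  qed
  then obtain n h i where nhi: "\<And>N k. N \<le> n N k" "\<And>N k. h N k \<in> F (n N k)"
    "\<And>N k. size_torus (orbit P (h N k)) < (1 / 2) ^ k"
    "\<And>N k. l (n N k) \<le> i N k" "\<And>N k. i N k \<le> l (Suc (n N k))"
    "\<And>N k. \<not> size_torus (T (n N k) (h N k) (i N k)) < e"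
    by metis
  \<comment> \<open>Each search starts just beyond the place used before, so the places
    \<open>r k\<close> increase strictly.\<close>
  define b where "b = rec_nat 0 (\<lambda>k N. Suc (n N k))"
  have b: "b (Suc k) = Suc (n (b k) k)" for k
    by (simp add: b_def)
  define r where "r k = n (b k) k" for k
  have r: "strict_mono r"
    unfolding strict_mono_Suc_iff r_def using nhi(1)[of "b (Suc _)" "Suc _"] b by (metis Suc_le_lessD)
  define y where "y m = (if m \<in> range r then h (b (inv_into UNIV r m)) (inv_into UNIV r m) else 0)" for m
  have y_r: "y (r k) = h (b k) k" for k
    unfolding y_def using strict_mono_imp_inj_on[OF r] by simp
  have y_zero: "y m = 0" if "m \<notin> range r" for m
    using that by (simp add: y_def)
  have y: "adm y"
    unfolding adm_def
  proof
    fix m show "y m \<in> F m"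
    proof (cases "m \<in> range r")
      case True
      then obtain k where "m = r k" by blast
      then show ?thesis
        using nhi(2)[of "b k" k] y_r[of k] by (simp add: r_def)
    qed (use y_zero F_zero in simp)
  qed
  have "summable (\<lambda>k. size_torus (orbit P (y (r k))))"
  proof (rule summable_comparison_test')
    show "summable (\<lambda>k. (1 / 2 :: real) ^ k)"
      by (intro summable_geometric) simp
    show "norm (size_torus (orbit P (y (r k)))) \<le> (1 / 2) ^ k" for k
      using nhi(3)[of "b k" k] by (simp add: y_r)
  qed
  then have "summable (\<lambda>m. size_torus (orbit P (y m)))"
    using summable_mono_reindex[of r "\<lambda>m. size_torus (orbit P (y m))"] r y_zero by simp
  then have "convergent (\<lambda>n. orbit P (\<Sum>m<n. y m - (\<lambda>_. 0) m))"
    using convergent_partial_sums_torus by (simp add: orbit_sum)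
  then obtain N where N: "\<And>n i. n \<ge> N \<Longrightarrow> l n \<le> i \<Longrightarrow> i \<le> l (Suc n) \<Longrightarrow> size_torus (T n (y n) i - T n 0 i) < e"
    using equiv_imp_small[OF y adm_zero _ assms] by blast
  have "r N \<ge> N"
    using strict_mono_imp_increasing[OF r] by simp
  then have "size_torus (T (r N) (h (b N) N) (i (b N) N)) < e"
    using N[of "r N" "i (b N) N"] nhi(4,5)[of "b N" N] by (simp add: y_r) (simp add: r_def)
  then show False
    using nhi(6)[of "b N" N] by (simp add: r_def)
qed

text \<open>
  Otherwise there are counterexamples \<open>(g k, h k)\<close> with \<open>h k\<close> tending to zero. At finitely many
  places of the \<open>k\<close>-th block put \<open>g k + h k\<close> into \<open>y\<close>, and \<open>g k\<close> followed by \<open>h k\<close> into \<open>y'\<close>. Then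
  \<open>y\<close> and \<open>y'\<close> are equivalent, but coordinate \<open>j\<close> of the difference of the outputs changes by
  at least \<open>1 / 2\<close> across every block.
\<close>

lemma S_quasi_additive:
  "\<exists>d>0. \<forall>g h. size_torus (orbit P h) < d \<longrightarrow> (\<lambda>m. coord (S m (g + h) - S m g - S (Suc m) h) j) \<longlonglongrightarrow> 1"
proof (rule ccontr)
  assume contr: "\<not> ?thesis"
  define bad where "bad g h \<longleftrightarrow> \<not> (\<lambda>m. coord (S m (g + h) - S m g - S (Suc m) h) j) \<longlonglongrightarrow> 1" for g h
  have "\<exists>g h. size_torus (orbit P h) < (1 / 2) ^ k \<and> bad g h" for k :: nat
  proof -
    have "(1 / 2 :: real) ^ k > 0" by simp
    then show ?thesis
      using contr unfolding bad_def by blast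
  qed
  then obtain g h where gh: "\<And>k. size_torus (orbit P (h k)) < (1 / 2) ^ k" "\<And>k. bad (g k) (h k)"
    by metis
  \<comment> \<open>The condition \<open>Suc m < M'\<close> leaves room for the second half of the
    split increment before the next block starts.\<close>
  define good where "good k M A M' \<longleftrightarrow> finite A \<and> A \<subseteq> {M..} \<and>
      (\<forall>m\<in>A. Suc m \<notin> A \<and> Suc m < M' \<and> g k \<in> F m \<and> h k \<in> F m \<and> g k + h k \<in> F m) \<and>
      M < M' \<and> norm ((\<Prod>m\<in>A. coord (S m (g k + h k) - S m (g k) - S (Suc m) (h k)) j) - 1) \<ge> 1 / 2" for k M A M'
  have "\<exists>A M'. good k M A M'" for k M
  proof -
    obtain N1 N2 N3 where N: "\<forall>n\<ge>N1. g k \<in> F n" "\<forall>n\<ge>N2. h k \<in> F n" "\<forall>n\<ge>N3. g k + h k \<in> F n"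
      using eventually_in_F by metis
    define e where "e m = coord (S m (g k + h k) - S m (g k) - S (Suc m) (h k)) j" for m
    have "\<not> e \<longlonglongrightarrow> 1"
      using gh(2)[of k] unfolding bad_def e_def .
    moreover have "norm (e m) = 1" for m
      unfolding e_def by (rule norm_coord)
    ultimately have "\<exists>A. finite A \<and> A \<subseteq> {M + N1 + N2 + N3..} \<and> (\<forall>m\<in>A. Suc m \<notin> A) \<and> norm ((\<Prod>m\<in>A. e m) - 1) \<ge> 1 / 2"
      by (intro unit_circle_large_products)
    then obtain A where A: "finite A" "A \<subseteq> {M + N1 + N2 + N3..}" "\<forall>m\<in>A. Suc m \<notin> A"
      "norm ((\<Prod>m\<in>A. e m) - 1) \<ge> 1 / 2"
      by blast
    obtain M0 where "A \<subseteq> {..<M0}"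
      using A(1) finite_nat_iff_bounded by blast
    then have "\<forall>m\<in>A. Suc m < M + M0 + 2"
      by auto
    moreover have "\<forall>m\<in>A. g k \<in> F m \<and> h k \<in> F m \<and> g k + h k \<in> F m" "A \<subseteq> {M..}"
      using A(2) N by auto
    ultimately show ?thesis
      using A unfolding e_def good_def by (intro exI[of _ A] exI[of _ "M + M0 + 2"]) auto
  qed
  then obtain A0 M' where good: "\<And>k M. good k M (A0 k M) (M' k M)"
    by metis
  have A0: "\<And>k M. finite (A0 k M)" "\<And>k M. A0 k M \<subseteq> {M..}"
    "\<And>k M m. m \<in> A0 k M \<Longrightarrow> Suc m \<notin> A0 k M \<and> Suc m < M' k M \<and> g k \<in> F m \<and> h k \<in> F m \<and> g k + h k \<in> F m"
    "\<And>k M. M < M' k M"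
    "\<And>k M. norm ((\<Prod>m\<in>A0 k M. coord (S m (g k + h k) - S m (g k) - S (Suc m) (h k)) j) - 1) \<ge> 1 / 2"
    using good unfolding good_def by blast+
  define b where "b = rec_nat 0 M'"
  define A where "A k = A0 k (b k)" for k
  have b_Suc: "b (Suc k) = M' k (b k)" for k
    by (simp add: b_def)
  have b: "strict_mono b"
    unfolding strict_mono_Suc_iff b_Suc using A0(4) by blast
  have finA: "finite (A k)" for k
    unfolding A_def by (rule A0(1))
  have A_ge: "b k \<le> m" and A_less: "Suc m < b (Suc k)" and A_Suc: "Suc m \<notin> A k"
    and A_F: "g k \<in> F m" "h k \<in> F m" "g k + h k \<in> F m" if "m \<in> A k" for k m
    using A0(2)[of k "b k"] A0(3)[of m k "b k"] that unfolding A_def b_Suc by auto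
  have unique: "k = k'" if "b k \<le> m" "m < b (Suc k)" "b k' \<le> m" "m < b (Suc k')" for k k' m
  proof (rule ccontr)
    assume "k \<noteq> k'"
    then have "Suc k \<le> k' \<or> Suc k' \<le> k" by auto
    then have "b (Suc k) \<le> b k' \<or> b (Suc k') \<le> b k"
      using b by (simp add: strict_mono_less_eq)
    then show False using that by auto
  qed
  define top where "top m k \<longleftrightarrow> m \<in> A k" for m k
  define snd_of where "snd_of m k \<longleftrightarrow> (\<exists>m'. m = Suc m' \<and> m' \<in> A k)" for m k
  have top_unique: "k = k'" if "top m k" "top m k'" for m k k'
    using that unique A_ge A_less unfolding top_def by (meson Suc_lessD)
  have snd_unique: "k = k'" if "snd_of m k" "snd_of m k'" for m k k'
    using that top_unique unfolding snd_of_def top_def by blast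
  have disj: "\<not> (top m k \<and> snd_of m k')" for m k k'
  proof
    assume "top m k \<and> snd_of m k'"
    then obtain m' where m': "m = Suc m'" "m' \<in> A k'" "m \<in> A k"
      unfolding top_def snd_of_def by blast
    then have "k = k'"
      using unique[of k m k'] A_ge[of m k] A_less[of m k] A_ge[of m' k'] A_less[of m' k'] by simp
    then show False
      using m' A_Suc by blast
  qed
  define y where "y m = (if \<exists>k. top m k then g (THE k. top m k) + h (THE k. top m k) else 0)" for m
  define y' where "y' m = (if \<exists>k. top m k then g (THE k. top m k)
    else if \<exists>k. snd_of m k then h (THE k. snd_of m k) else 0)" for m
  have the_top: "(THE k. top m k) = k" if "top m k" for m k
    using that top_unique by (intro the_equality) auto
  have the_snd: "(THE k. snd_of m k) = k" if "snd_of m k" for m k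
    using that snd_unique by (intro the_equality) auto
  have y_top: "y m = g k + h k" "y' m = g k" if "m \<in> A k" for m k
    using that the_top[of m k] unfolding y_def y'_def top_def by auto
  have y_snd: "y (Suc m) = 0" "y' (Suc m) = h k" if "m \<in> A k" for m k
  proof -
    have s: "snd_of (Suc m) k"
      using that unfolding snd_of_def by blast
    then have n: "\<not> (\<exists>k. top (Suc m) k)"
      using disj by blast
    show "y (Suc m) = 0"
      unfolding y_def by (rule if_not_P) (rule n)
    show "y' (Suc m) = h k"
      unfolding y'_def using n s the_snd[OF s] by auto
  qed
  have y_other: "y m = 0" "y' m = 0" if "\<And>k. m \<notin> A k" "\<And>k. m \<notin> Suc ` A k" for m
    using that unfolding y_def y'_def top_def snd_of_def by auto
  have cases: thesis if "\<And>k. m \<in> A k \<Longrightarrow> thesis" "\<And>k m'. m = Suc m' \<Longrightarrow> m' \<in> A k \<Longrightarrow> thesis"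
    "(\<And>k. m \<notin> A k) \<Longrightarrow> (\<And>k. m \<notin> Suc ` A k) \<Longrightarrow> thesis" for m thesis
    using that by blast
  have "y m \<in> F m \<and> y' m \<in> F m" for m
  proof (rule cases[of m])
    fix k assume "m \<in> A k"
    then show ?thesis using y_top A_F by simp
  next
    fix k m' assume m': "m = Suc m'" "m' \<in> A k"
    then show ?thesis
      using y_snd A_F(2)[of m' k] F_zero F_mono[of m' m] by auto
  qed (use y_other F_zero in simp)
  then have y: "adm y" and y': "adm y'"
    unfolding adm_def by auto
  \<comment> \<open>The sums differ only between the two halves of a split increment, and there by
    \<open>h k\<close>, whose orbit tends to zero with \<open>k\<close>.\<close>
  have partial: "(\<Sum>m<n. y m - y' m) = 0 \<and> (\<forall>m k. n = Suc m \<longrightarrow> m \<notin> A k) \<or>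
      (\<exists>m k. n = Suc m \<and> m \<in> A k \<and> (\<Sum>m<n. y m - y' m) = h k)" for n
  proof (induction n)
    case (Suc n)
    show ?case
    proof (rule cases[of n])
      fix k assume n: "n \<in> A k"
      have "n \<noteq> Suc m \<or> m \<notin> A k'" for m k'
        using disj[of n k k'] n unfolding top_def snd_of_def by blast
      then have "(\<Sum>m<n. y m - y' m) = 0"
        using Suc by blast
      then have "(\<Sum>m<Suc n. y m - y' m) = h k"
        using y_top[OF n] by simp
      then show ?thesis
        using n by blast
    next
      fix k m assume m: "n = Suc m" "m \<in> A k"
      then obtain k' where k': "m \<in> A k'" "(\<Sum>m<n. y m - y' m) = h k'"
        using Suc by auto
      then have "k' = k"
        using m(2) top_unique unfolding top_def by blast
      then have "(\<Sum>m<Suc n. y m - y' m) = 0"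
        using k' m y_snd[OF m(2)] by simp
      moreover have "n \<notin> A k''" for k''
        using disj[of n k'' k] m unfolding top_def snd_of_def by blast
      ultimately show ?thesis by blast
    next
      assume n: "\<And>k. n \<notin> A k" "\<And>k. n \<notin> Suc ` A k"
      then have "(\<Sum>m<n. y m - y' m) = 0"
        using Suc by blast
      then show ?thesis
        using n y_other[OF n] by simp
    qed
  qed simp
  have "(\<lambda>n. orbit P (\<Sum>m<n. y m - y' m)) \<longlonglongrightarrow> 0"
    unfolding tendsto_torus_0_iff
  proof (rule tendstoI)
    fix e :: real assume "e > 0"
    then obtain K where K: "\<And>k. k \<ge> K \<Longrightarrow> (1 / 2 :: real) ^ k < e"
      using half_power_small[of e 1] by auto
    have "size_torus (orbit P (\<Sum>m<n. y m - y' m)) < e" if n: "n > b K" for n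
    proof (cases "(\<Sum>m<n. y m - y' m) = 0")
      case False
      then obtain m k where mk: "n = Suc m" "m \<in> A k" "(\<Sum>m<n. y m - y' m) = h k"
        using partial[of n] by auto
      have "b K < b (Suc k)"
        using n mk A_less[of m k] by simp
      then have "K \<le> k"
        using b by (simp add: strict_mono_less)
      then show ?thesis
        using gh(1)[of k] K[of k] mk(3) by simp
    qed (use \<open>e > 0\<close> in simp)
    then show "\<forall>\<^sub>F n in sequentially. dist (size_torus (orbit P (\<Sum>m<n. y m - y' m))) 0 < e"
      unfolding eventually_sequentially by (intro exI[of _ "Suc (b K)"]) auto
  qed
  then have conv: "convergent (\<lambda>n. orbit P (\<Sum>m<n. y m - y' m))"
    unfolding convergent_def by blast
  obtain d where d: "d > 0" "\<And>a. size_torus a < d \<Longrightarrow> norm (coord a j - 1) < 1 / 2"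
    using coord_near_1[of "1 / 2" j] by auto
  obtain N where N: "\<And>n n'. n \<ge> N \<Longrightarrow> n \<le> n' \<Longrightarrow> size_torus (\<Sum>m=n..<n'. S m (y m) - S m (y' m)) < d"
    using equiv_imp_small[OF y y' conv d(1)] by blast
  define f where "f m = S m (y m) - S m (y' m)" for m
  \<comment> \<open>Only the places of block \<open>N\<close> and their successors contribute;
    pairing each place with its successor turns the block sum into the sum of additivity defects,
    which is not small.\<close>
  have "(\<Sum>m=b N..<b (Suc N). f m) = (\<Sum>m\<in>A N \<union> Suc ` A N. f m)"
  proof (rule sum.mono_neutral_right)
    show "A N \<union> Suc ` A N \<subseteq> {b N..<b (Suc N)}"
      using A_ge[of _ N] A_less[of _ N] by (fastforce simp: le_Suc_eq)
    show "\<forall>m\<in>{b N..<b (Suc N)} - (A N \<union> Suc ` A N). f m = 0"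
    proof
      fix m assume m: "m \<in> {b N..<b (Suc N)} - (A N \<union> Suc ` A N)"
      have "m \<notin> A k" for k
        using m unique[of k m N] A_ge[of m k] A_less[of m k] by auto
      moreover have "m \<notin> Suc ` A k" for k
      proof
        assume "m \<in> Suc ` A k"
        then obtain m' where m': "m = Suc m'" "m' \<in> A k" by blast
        then have "k = N"
          using m unique[of k m N] A_ge[of m' k] A_less[of m' k] by auto
        then show False using m m' by blast
      qed
      ultimately show "f m = 0"
        unfolding f_def using y_other by simp
    qed
  qed simp
  also have "\<dots> = (\<Sum>m\<in>A N. f m) + (\<Sum>m\<in>Suc ` A N. f m)"
    using finA A_Suc by (intro sum.union_disjoint) auto
  also have "(\<Sum>m\<in>Suc ` A N. f m) = (\<Sum>m\<in>A N. f (Suc m))"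
    by (subst sum.reindex) auto
  also have "(\<Sum>m\<in>A N. f m) + (\<Sum>m\<in>A N. f (Suc m)) = (\<Sum>m\<in>A N. S m (g N + h N) - S m (g N) - S (Suc m) (h N))"
    unfolding sum.distrib[symmetric] f_def using y_top y_snd by (intro sum.cong) auto
  finally have "size_torus (\<Sum>m\<in>A N. S m (g N + h N) - S m (g N) - S (Suc m) (h N)) < d"
    using N[of "b N" "b (Suc N)"] strict_mono_imp_increasing[OF b, of N] b
    unfolding f_def by (simp add: strict_mono_less_eq)
  then have "norm ((\<Prod>m\<in>A N. coord (S m (g N + h N) - S m (g N) - S (Suc m) (h N)) j) - 1) < 1 / 2"
    using d(2) unfolding coord_sum[symmetric] by blast
  then show False
    using A0(5)[where k = N and M = "b N"] unfolding A_def by linarith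
qed

end

text \<open>Tychonoff gives compactness; the countable index type makes the product metrizable, so
  that subsequences can be extracted.\<close>

lemma seq_compact_unit_functions:
  "seq_compact {f :: 'i::countable \<Rightarrow> complex. \<forall>i. norm (f i) = 1}"
proof -
  have "compactin (product_topology (\<lambda>_. euclidean) UNIV) (PiE UNIV (\<lambda>_ :: 'i. sphere (0::complex) 1))"
    by (simp add: compactin_PiE)
  then have "compact (PiE UNIV (\<lambda>_ :: 'i. sphere (0::complex) 1))"
    by (simp add: euclidean_product_topology)
  moreover have "PiE UNIV (\<lambda>_ :: 'i. sphere (0::complex) 1) = {f. \<forall>i. norm (f i) = 1}"
    by (auto simp: PiE_def Pi_def)
  ultimately show ?thesis
    by (simp add: compact_imp_seq_compact)
qed

section \<open>Extraction of a limiting homomorphism\<close>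

context block_reduction
begin

text \<open>For small \<open>h\<close> the move to place \<open>Suc m\<close> is undone by comparing
  with the case \<open>g = 0\<close>. An arbitrary \<open>h\<close> is a sum of \<open>n\<close>
  copies of the small \<open>h / n\<close>, and the defects add up.\<close>

lemma S_asymptotically_additive:
  "(\<lambda>m. coord (S m (g + h) - S m g - S m h) j) \<longlonglongrightarrow> 1"
proof -
  define asym where "asym u \<longleftrightarrow> (\<lambda>m. coord (u m) j) \<longlonglongrightarrow> 1" for u :: "nat \<Rightarrow> torus"
  have asym_add: "asym (\<lambda>m. u m + v m)" if "asym u" "asym v" for u v
    using tendsto_mult[OF that[unfolded asym_def]] by (simp add: asym_def)
  have asym_diff: "asym (\<lambda>m. u m - v m)" if "asym u" "asym v" for u v
    using tendsto_divide[OF that[unfolded asym_def]] by (simp add: asym_def)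
  obtain d where d: "d > 0" "\<And>g h. size_torus (orbit P h) < d \<Longrightarrow> asym (\<lambda>m. S m (g + h) - S m g - S (Suc m) h)"
    using S_quasi_additive[of j] unfolding asym_def by blast
  have small: "asym (\<lambda>m. S m (g + h) - S m g - S m h)" if "size_torus (orbit P h) < d" for g h
    using asym_diff[OF d(2)[OF that, of g] d(2)[OF that, of 0]] by (simp add: algebra_simps)
  have multiple: "asym (\<lambda>m. S m (g + of_nat n * h) - S m g - S m (of_nat n * h))"
    if h: "size_torus (orbit P h) < d" for g h n
  proof (induction n)
    case 0
    then show ?case by (simp add: asym_def)
  next
    case (Suc n)
    have "asym (\<lambda>m. (S m ((g + of_nat n * h) + h) - S m (g + of_nat n * h) - S m h)
        + (S m (g + of_nat n * h) - S m g - S m (of_nat n * h))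
        - (S m (of_nat n * h + h) - S m (of_nat n * h) - S m h))"
      by (intro asym_diff asym_add small h Suc)
    then show ?case
      by (simp add: algebra_simps)
  qed
  obtain e where e: "e > 0" "\<And>s. \<bar>s\<bar> < e \<Longrightarrow> dist (one_param P s) (\<lambda>_. 1) < d"
    using dist_one_param_less[OF d(1), of 0 P] by auto
  obtain n :: nat where n: "n > 0" "\<bar>of_rat h :: real\<bar> / real n < e"
  proof -
    obtain n :: nat where "\<bar>of_rat h :: real\<bar> / e < real n"
      using reals_Archimedean2 by blast
    moreover have "\<bar>of_rat h :: real\<bar> / e \<ge> 0"
      using e(1) by simp
    ultimately show thesis
      using that[of n] e(1) by (cases "n = 0") (auto simp: field_simps)
  qed
  have "size_torus (orbit P (h / of_nat n)) < d"
    unfolding size_orbit using n by (intro e(2)) (simp add: of_rat_divide)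
  from multiple[OF this, of g n] show ?thesis
    using n(1) by (simp add: asym_def)
qed

text \<open>The limit is taken along one subsequence for all rationals and coordinates together.
  Since \<open>S n g\<close> is the value of \<open>T n g\<close> at the end of its block,
  \<open>T_small\<close> passes to the limit as continuity at 0 in the solenoid topology.\<close>

lemma limit_hom:
  assumes closed: "\<And>n g. g \<in> F n \<Longrightarrow> coord (S n g) \<in> carrier (solenoid Q)"
  obtains H :: "rat \<Rightarrow> nat \<Rightarrow> complex" where "\<And>t. H t \<in> carrier (solenoid Q)"
    "\<And>s t j. H (s + t) j = H s j * H t j"
    "\<And>j. \<exists>d>0. \<forall>t. dist (one_param P (of_rat t)) (\<lambda>_. 1) < d \<longrightarrow> norm (H t j - 1) < 1"
    "\<exists>t. H t \<noteq> (\<lambda>_. 1)"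
proof -
  obtain L r where r: "strict_mono (r :: nat \<Rightarrow> nat)" and L: "((\<lambda>m (g, j). coord (S m g) j) \<circ> r) \<longlonglongrightarrow> L"
    by (rule seq_compactE[OF seq_compact_unit_functions, of "\<lambda>m (g :: rat, j). coord (S m g) j"]) auto
  define H where "H g j = L (g, j)" for g j
  have lim: "(\<lambda>m. coord (S (r m) g) j) \<longlonglongrightarrow> H g j" for g j
    using L[unfolded tendsto_fun_iff, rule_format, of "(g, j)"] by (simp add: H_def)
  have r_ge: "r m \<ge> m" for m
    using strict_mono_imp_increasing[OF r] by simp
  have unit: "norm (H g j) = 1" for g j
    using tendsto_norm[OF lim[of g j]] by (simp add: LIMSEQ_const_iff)
  then have nz: "H g j \<noteq> 0" for g j
    by (metis norm_zero zero_neq_one)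
  have sol: "H t \<in> carrier (solenoid Q)" for t
  proof -
    obtain N where N: "\<forall>n\<ge>N. t \<in> F n"
      using eventually_in_F by blast
    \<comment> \<open>The shift by \<open>N\<close> makes \<open>t\<close> admissible at every place
      used, as \<open>closed\<close> demands.\<close>
    have "(\<lambda>m. coord (S (r (m + N)) t)) \<longlonglongrightarrow> H t"
      using lim[THEN LIMSEQ_ignore_initial_segment] by (simp add: tendsto_fun_iff)
    moreover have "coord (S (r (m + N)) t) \<in> carrier (solenoid Q)" for m
      using closed N r_ge[of "m + N"] by (meson le_add2 order_trans)
    ultimately show ?thesis
      by (rule solenoid_limit[rotated])
  qed
  have add: "H (s + t) j = H s j * H t j" for s t j
  proof -
    have "(\<lambda>m. coord (S (r m) (s + t) - S (r m) s - S (r m) t) j) \<longlonglongrightarrow> 1"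
      using LIMSEQ_subseq_LIMSEQ[OF S_asymptotically_additive r] by (simp add: o_def)
    moreover have "(\<lambda>m. coord (S (r m) (s + t) - S (r m) s - S (r m) t) j) \<longlonglongrightarrow> H (s + t) j / H s j / H t j"
      by (simp only: coord_arith) (intro tendsto_divide lim nz)
    ultimately have "H (s + t) j / H s j / H t j = 1"
      using LIMSEQ_unique by blast
    then show ?thesis
      using nz by (simp add: field_simps)
  qed
  have cont: "\<exists>d>0. \<forall>t. dist (one_param P (of_rat t)) (\<lambda>_. 1) < d \<longrightarrow> norm (H t j - 1) < 1" for j
  proof -
    obtain e where e: "e > 0" "\<And>a. size_torus a < e \<Longrightarrow> norm (coord a j - 1) < 1 / 2"
      using coord_near_1[of "1 / 2" j] by auto
    obtain d N where d: "d > 0" and N: "\<And>n h i. n \<ge> N \<Longrightarrow> h \<in> F n \<Longrightarrow> size_torus (orbit P h) < d \<Longrightarrow>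
        l n \<le> i \<Longrightarrow> i \<le> l (Suc n) \<Longrightarrow> size_torus (T n h i) < e"
      using T_small[OF e(1)] by blast
    have "norm (H t j - 1) < 1" if t: "size_torus (orbit P t) < d" for t
    proof -
      obtain N' where N': "\<forall>n\<ge>N'. t \<in> F n"
        using eventually_in_F by blast
      have "norm (H t j - 1) \<le> 1 / 2"
      proof (rule tendsto_upperbound)
        show "(\<lambda>m. norm (coord (S (r m) t) j - 1)) \<longlonglongrightarrow> norm (H t j - 1)"
          by (intro tendsto_intros lim)
        have "norm (coord (S (r m) t) j - 1) \<le> 1 / 2" if "m \<ge> max N N'" for m
        proof -
          have "size_torus (S (r m) t) < e"
            unfolding S_def using that r_ge[of m] N' t by (intro N) (auto intro: l_le)
          then show ?thesis
            using e(2) less_imp_le by blast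
        qed
        then show "\<forall>\<^sub>F m in sequentially. norm (coord (S (r m) t) j - 1) \<le> 1 / 2"
          unfolding eventually_sequentially by blast
      qed simp
      then show ?thesis
        by simp
    qed
    then show ?thesis
      using d by (auto simp: size_orbit)
  qed
  have "\<exists>t. H t \<noteq> (\<lambda>_. 1)"
  proof (rule ccontr)
    assume "\<nexists>t. H t \<noteq> (\<lambda>_. 1)"
    then have "(\<lambda>m. S (r m) g) \<longlonglongrightarrow> 0" for g
      using lim[of g] by (simp add: tendsto_torus_iff)
    then have S_small: "\<forall>\<^sub>F m in sequentially. size_torus (S (r m) g) < (1 / 2) ^ k" for g and k :: nat
      unfolding tendsto_torus_0_iff by (intro order_tendstoD(2)) auto
    define t :: "nat \<Rightarrow> rat" where "t k = 1 / of_nat (Suc k)" for k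
    have "\<exists>n\<ge>M. t k \<in> F n \<and> size_torus (S n (t k)) < (1 / 2) ^ k" for M k
    proof -
      obtain N where N: "\<forall>n\<ge>N. t k \<in> F n"
        using eventually_in_F by blast
      obtain m where m: "m \<ge> max M N" "size_torus (S (r m) (t k)) < (1 / 2) ^ k"
        using S_small[of "t k" k] unfolding eventually_sequentially by (meson max.cobounded1 max.cobounded2 order_refl)
      then show ?thesis
        using N r_ge[of m] by (intro exI[of _ "r m"]) auto
    qed
    then obtain n where n: "\<And>M k. n M k \<ge> M" "\<And>M k. t k \<in> F (n M k)"
      "\<And>M k. size_torus (S (n M k) (t k)) < (1 / 2) ^ k"
      by metis
    define b where "b = rec_nat 0 (\<lambda>k M. Suc (n M k))"
    have b: "b (Suc k) = Suc (n (b k) k)" for k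
      by (simp add: b_def)
    define q where "q k = n (b k) k" for k
    have q: "strict_mono q"
      unfolding strict_mono_Suc_iff q_def using n(1)[of "b (Suc _)" "Suc _"] b by (metis Suc_le_lessD)
    define y where "y m = (if m \<in> range q then t (inv_into UNIV q m) else 0)" for m
    have y_q: "y (q k) = t k" for k
      unfolding y_def using strict_mono_imp_inj_on[OF q] by simp
    have y_zero: "y m = 0" if "m \<notin> range q" for m
      using that by (simp add: y_def)
    have y: "adm y"
      unfolding adm_def
    proof
      fix m show "y m \<in> F m"
      proof (cases "m \<in> range q")
        case True
        then obtain k where "m = q k" by blast
        then show ?thesis
          using n(2)[of k "b k"] y_q[of k] by (simp add: q_def)
      qed (use y_zero F_zero in simp)
    qed
    have "summable (\<lambda>k. size_torus (S (q k) (y (q k))))"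
    proof (rule summable_comparison_test')
      show "summable (\<lambda>k. (1 / 2 :: real) ^ k)"
        by (intro summable_geometric) simp
      show "norm (size_torus (S (q k) (y (q k)))) \<le> (1 / 2) ^ k" for k
        unfolding y_q using n(3)[of "b k" k] by (simp add: q_def)
    qed
    then have "summable (\<lambda>m. size_torus (S m (y m)))"
      using summable_mono_reindex[of q "\<lambda>m. size_torus (S m (y m))"] q y_zero by simp
    then have sums: "convergent (\<lambda>n. \<Sum>m<n. S m (y m) - S m ((\<lambda>_. 0) m))"
      using convergent_partial_sums_torus by simp
    have "convergent (\<lambda>n. orbit P (\<Sum>m<n. y m - (\<lambda>_. 0) m))"
    \<comment> \<open>The places were chosen so that the final contributions \<open>S\<close> are
      summable; the intermediate contributions \<open>T\<close> are small because the increments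
      \<open>t k\<close> tend to zero.\<close>
    proof (rule small_imp_equiv[OF y adm_zero sums])
      fix e :: real assume "e > 0"
      then obtain d N where d: "d > 0" and N: "\<And>n h i. n \<ge> N \<Longrightarrow> h \<in> F n \<Longrightarrow> size_torus (orbit P h) < d \<Longrightarrow>
          l n \<le> i \<Longrightarrow> i \<le> l (Suc n) \<Longrightarrow> size_torus (T n h i) < e"
        using T_small[of e] by blast
      obtain c where c: "c > 0" "\<And>s. \<bar>s\<bar> < c \<Longrightarrow> dist (one_param P s) (\<lambda>_. 1) < d"
        using dist_one_param_less[OF d, of 0 P] by auto
      obtain K where K: "1 / real (Suc K) < c"
        using c(1) nat_approx_posE by blast
      have t_small: "size_torus (orbit P (t k)) < d" if "k \<ge> K" for k
      proof -
        have "\<bar>of_rat (t k) :: real\<bar> = 1 / real (Suc k)"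
          by (simp add: t_def of_rat_divide of_rat_add)
        also have "\<dots> \<le> 1 / real (Suc K)"
          using that by (simp add: frac_le)
        finally show ?thesis
          unfolding size_orbit using K by (intro c(2)) simp
      qed
      have "size_torus (T m (y m) i - T m 0 i) < e" if m: "m \<ge> max N (q K)" and i: "l m \<le> i" "i \<le> l (Suc m)" for m i
      proof (cases "m \<in> range q")
        case True
        then obtain k where k: "m = q k" by blast
        then have "k \<ge> K"
          using m q by (simp add: strict_mono_less_eq)
        moreover have "t k \<in> F m"
          using y y_q[of k] k unfolding adm_def by metis
        ultimately show ?thesis
          using N[of m "t k" i] m i t_small[of k] y_q[of k] k by simp
      qed (use y_zero \<open>e > 0\<close> in simp)
      then show "\<exists>N. \<forall>m\<ge>N. \<forall>i. l m \<le> i \<longrightarrow> i \<le> l (Suc m) \<longrightarrow> size_torus (T m (y m) i - T m ((\<lambda>_. 0) m) i) < e"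
        by blast
    qed
    then obtain z where "(\<lambda>n. orbit P (\<Sum>m<n. y m)) \<longlonglongrightarrow> z"
      by (auto simp: convergent_def)
    from LIMSEQ_subseq_LIMSEQ[OF this q] have "(\<lambda>k. orbit P (\<Sum>k<k. t k)) \<longlonglongrightarrow> z"
      by (simp add: o_def sum_lessThan_subseq[OF q y_zero] y_q)
    then show False
      using harmonic_orbit_not_convergent[of P] unfolding t_def convergent_def by blast
  qed
  then show thesis
    using that sol add cont by blast
qed

end

subsection \<open>Generic sequences\<close>

definition extends :: "(nat \<Rightarrow> 'a) \<Rightarrow> 'a list \<Rightarrow> bool" where
  "extends x s \<longleftrightarrow> (\<forall>i<length s. x i = s ! i)"

text \<open>A set of words codes the open set of sequences that have a prefix in it.\<close>

definition dense_open :: "'a list set \<Rightarrow> bool" where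
  "dense_open E \<longleftrightarrow> (\<forall>s. \<exists>t. s @ t \<in> E) \<and> (\<forall>s t. s \<in> E \<longrightarrow> s @ t \<in> E)"

text \<open>Membership in the intersection of countably many open sets; for dense ones, in a
  comeagre set.\<close>

definition generic :: "(nat \<Rightarrow> 'a list set) \<Rightarrow> (nat \<Rightarrow> 'a) \<Rightarrow> bool" where
  "generic D x \<longleftrightarrow> (\<forall>k. \<exists>s\<in>D k. extends x s)"

lemma extends_map [simp]: "extends x (map x [0..<n])"
  by (simp add: extends_def)

lemma extends_appendD: "extends x (s @ t) \<Longrightarrow> extends x s"
  by (auto simp: extends_def nth_append)

lemma extends_append_iff: "extends x (s @ t) \<longleftrightarrow> extends x s \<and> extends (\<lambda>i. x (length s + i)) t"
proof
  assume x: "extends x (s @ t)"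
  have "x (length s + i) = t ! i" if "i < length t" for i
    using x that unfolding extends_def by (simp add: nth_append)
  then show "extends x s \<and> extends (\<lambda>i. x (length s + i)) t"
    using extends_appendD[OF x] by (simp add: extends_def)
next
  assume x: "extends x s \<and> extends (\<lambda>i. x (length s + i)) t"
  show "extends x (s @ t)"
    unfolding extends_def
  proof (intro allI impI)
    fix i assume i: "i < length (s @ t)"
    show "x i = (s @ t) ! i"
    proof (cases "i < length s")
      case False
      then obtain j where j: "i = length s + j"
        by (metis le_add_diff_inverse not_less)
      then show ?thesis
        using x i by (simp add: extends_def nth_append)
    qed (use x in \<open>simp add: extends_def nth_append\<close>)
  qed
qed

lemma extends_longer:
  assumes "extends x s"
  obtains t where "extends x (s @ t)" "length (s @ t) \<ge> n"
proof
  show "extends x (s @ map (\<lambda>i. x (length s + i)) [0..<n])"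
    using assms by (simp add: extends_append_iff)
qed simp

lemma extends_comparable:
  assumes "extends x s" "extends x s'" "length s \<le> length s'"
  shows "\<exists>t. s' = s @ t"
proof -
  have "take (length s) s' = s"
    using assms by (intro nth_equalityI) (auto simp: extends_def)
  then have "s' = s @ drop (length s) s'"
    using append_take_drop_id[of "length s" s'] by simp
  then show ?thesis ..
qed

lemma dense_openD:
  assumes "dense_open E"
  shows "\<exists>t. s @ t \<in> E" and "s \<in> E \<Longrightarrow> s @ t \<in> E"
  using assms by (auto simp: dense_open_def)

lemma chain_limit:
  fixes w :: "nat \<Rightarrow> 'a list"
  assumes chain: "\<And>k. \<exists>t. w (Suc k) = w k @ t" and len: "\<And>k. length (w k) \<ge> k"
  obtains x where "\<And>k. extends x (w k)"
proof -
  have nth_stable: "i < length (w (k + n)) \<and> w (k + n) ! i = w k ! i" if "i < length (w k)" for k n i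
  proof (induction n)
    case (Suc n)
    then show ?case
      using chain[of "k + n"] by (auto simp: nth_append)
  qed (use that in simp)
  define x where "x i = w (Suc i) ! i" for i
  have "extends x (w k)" for k
    unfolding extends_def
  proof (intro allI impI)
    fix i assume i: "i < length (w k)"
    have "i < length (w (Suc i))"
      using len[of "Suc i"] by simp
    then show "x i = w k ! i"
      using nth_stable[OF i, of "Suc i"] nth_stable[of i "Suc i" k] unfolding x_def by (simp add: add.commute)
  qed
  then show ?thesis
    using that by blast
qed

lemma generic_exists:
  fixes D :: "nat \<Rightarrow> 'a list set"
  assumes D: "\<And>k. dense_open (D k)"
  obtains x where "extends x s" "generic D x"
proof -
  have "\<exists>t. s @ t \<in> D k \<and> length t \<ge> 1" for s k
  proof -
    \<comment> \<open>An arbitrary letter forces proper growth, so the words determine an infinite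
      sequence in the limit.\<close>
    obtain t where "(s @ [undefined]) @ t \<in> D k"
      using dense_openD(1)[OF D] by blast
    then show ?thesis
      by (intro exI[of _ "[undefined] @ t"]) simp
  qed
  then obtain f where f: "\<And>s k. s @ f s k \<in> D k" "\<And>s k. length (f s k) \<ge> 1"
    by metis
  define w where "w = rec_nat s (\<lambda>k u. u @ f u k)"
  have w: "w 0 = s" "w (Suc k) = w k @ f (w k) k" for k
    by (simp_all add: w_def)
  have "length (w k) \<ge> k" for k
  proof (induction k)
    case (Suc k)
    then show ?case
      using f(2)[of "w k" k] by (simp add: w)
  qed simp
  then obtain x where "\<And>k. extends x (w k)"
    using chain_limit[of w] w(2) by blast
  moreover have "w (Suc k) \<in> D k" for k
    using f(1) by (simp add: w)
  ultimately show ?thesis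
    using that[of x] w(1) unfolding generic_def by metis
qed

text \<open>\<open>B\<close> is relatively clopen in the set of generic sequences.\<close>

definition decided :: "(nat \<Rightarrow> 'a list set) \<Rightarrow> (nat \<Rightarrow> 'a) set \<Rightarrow> bool" where
  "decided D B \<longleftrightarrow> (\<forall>x. generic D x \<longrightarrow>
     (\<exists>s. extends x s \<and> (\<forall>y. generic D y \<longrightarrow> extends y s \<longrightarrow> (y \<in> B \<longleftrightarrow> x \<in> B))))"

lemma decided_mono:
  assumes "decided D B" and "\<And>x. generic D' x \<Longrightarrow> generic D x"
  shows "decided D' B"
  using assms unfolding decided_def by meson

lemma generic_prod_decode:
  "generic (\<lambda>m. case prod_decode m of (n, k) \<Rightarrow> D n k) x \<longleftrightarrow> (\<forall>n. generic (D n) x)"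
proof
  assume x: "generic (\<lambda>m. case prod_decode m of (n, k) \<Rightarrow> D n k) x"
  have "\<exists>s\<in>D n k. extends x s" for n k
    using x[unfolded generic_def, rule_format, of "prod_encode (n, k)"] by simp
  then show "\<forall>n. generic (D n) x"
    by (simp add: generic_def)
qed (auto simp: generic_def split: prod.split)

lemma decided_simultaneously:
  fixes B :: "nat \<Rightarrow> (nat \<Rightarrow> 'a) set"
  assumes "\<And>n. \<exists>D. (\<forall>k. dense_open (D k)) \<and> decided D (B n)"
  shows "\<exists>D. (\<forall>k. dense_open (D k)) \<and> (\<forall>n. decided D (B n))"
proof -
  obtain D where D: "\<And>n k. dense_open (D n k)" "\<And>n. decided (D n) (B n)"
    using assms by metis
  let ?D = "\<lambda>m. case prod_decode m of (n, k) \<Rightarrow> D n k"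
  have "dense_open (?D m)" for m
    using D(1) by (simp split: prod.split)
  moreover have "decided ?D (B n)" for n
    using decided_mono[OF D(2)] generic_prod_decode[of D] by blast
  ultimately show ?thesis
    by (intro exI[of _ ?D]) blast
qed

text \<open>A forcing argument: the new dense open set \<open>E\<close> consists of the words that
  force membership in some \<open>B n\<close> or have no extension that does. In the latter case no
  generic extension lies in any \<open>B n\<close>, since by decidedness a prefix of it would force
  this.\<close>

lemma decided_Union:
  fixes B :: "nat \<Rightarrow> (nat \<Rightarrow> 'a) set"
  assumes "\<And>n. \<exists>D. (\<forall>k. dense_open (D k)) \<and> decided D (B n)"
  shows "\<exists>D. (\<forall>k. dense_open (D k)) \<and> decided D (\<Union>n. B n)"
proof -
  obtain D where D: "\<And>k. dense_open (D k)" "\<And>n. decided D (B n)"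
    using decided_simultaneously[of B, OF assms] by blast
  define forces where "forces s n \<longleftrightarrow> (\<forall>y. generic D y \<longrightarrow> extends y s \<longrightarrow> y \<in> B n)" for s n
  define E where "E = {s. (\<exists>n. forces s n) \<or> (\<forall>t n. \<not> forces (s @ t) n)}"
  have forces_append: "forces (s @ t) n" if "forces s n" for s t n
    using that extends_appendD unfolding forces_def by blast
  have "dense_open E"
    unfolding dense_open_def
  proof (intro conjI allI impI)
    fix s show "\<exists>t. s @ t \<in> E"
    proof (cases "\<exists>t n. forces (s @ t) n")
      case False
      then show ?thesis
        by (intro exI[of _ "[]"]) (simp add: E_def)
    qed (auto simp: E_def)
  next
    fix s t assume "s \<in> E"
    then show "s @ t \<in> E"
      unfolding E_def using forces_append by auto
  qed
  define D' where "D' k = (case k of 0 \<Rightarrow> E | Suc k \<Rightarrow> D k)" for k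
  have D': "dense_open (D' k)" for k
    using D(1) \<open>dense_open E\<close> by (simp add: D'_def split: nat.split)
  have gen: "generic D x \<and> (\<exists>s\<in>E. extends x s)" if "generic D' x" for x
  proof -
    have "\<exists>s\<in>D' (Suc k). extends x s" "\<exists>s\<in>D' 0. extends x s" for k
      using that unfolding generic_def by blast+
    then show ?thesis
      by (simp add: D'_def generic_def)
  qed
  have "decided D' (\<Union>n. B n)"
    unfolding decided_def
  proof (intro allI impI)
    fix x assume x: "generic D' x"
    then obtain s where s: "s \<in> E" "extends x s"
      using gen by blast
    have out: "y \<notin> B n" if y: "generic D y" "extends y s" and none: "\<forall>t n. \<not> forces (s @ t) n" for y n
    proof
      assume "y \<in> B n"
      then obtain u where u: "extends y u" "\<And>z. generic D z \<Longrightarrow> extends z u \<Longrightarrow> z \<in> B n"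
        using D(2)[of n] y(1) unfolding decided_def by blast
      obtain t where t: "extends y (s @ t)" "length (s @ t) \<ge> length u"
        using extends_longer[OF y(2)] by blast
      obtain v where "s @ t = u @ v"
        using extends_comparable[OF u(1) t(1) t(2)] by blast
      then have "forces (s @ t) n"
        unfolding forces_def using u(2) extends_appendD by metis
      then show False
        using none by blast
    qed
    have "\<forall>y. generic D' y \<longrightarrow> extends y s \<longrightarrow> (y \<in> (\<Union>n. B n) \<longleftrightarrow> x \<in> (\<Union>n. B n))"
    proof (cases "\<exists>n. forces s n")
      case True
      then show ?thesis
        using gen x s(2) unfolding forces_def by blast
    next
      case False
      then have "\<forall>t n. \<not> forces (s @ t) n"
        using s(1) by (auto simp: E_def)
      then show ?thesis
        using out gen x s(2) by blast
    qed
    then show "\<exists>s. extends x s \<and> (\<forall>y. generic D' y \<longrightarrow> extends y s \<longrightarrow> (y \<in> (\<Union>n. B n) \<longleftrightarrow> x \<in> (\<Union>n. B n)))"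
      using s(2) by blast
  qed
  then show ?thesis
    using D' by blast
qed

lemma decided_open:
  assumes B: "\<And>x. x \<in> B \<Longrightarrow> \<exists>s. extends x s \<and> (\<forall>y. extends y s \<longrightarrow> y \<in> B)"
  shows "\<exists>D. (\<forall>k. dense_open (D k)) \<and> decided D B"
proof -
  define E where "E = {s. (\<forall>y. extends y s \<longrightarrow> y \<in> B) \<or> (\<forall>y. extends y s \<longrightarrow> y \<notin> B)}"
  have "dense_open E"
    unfolding dense_open_def
  proof (intro conjI allI impI)
    fix s show "\<exists>t. s @ t \<in> E"
    proof (cases "\<exists>y. extends y s \<and> y \<in> B")
      case True
      then obtain y u where y: "extends y s" and u: "extends y u" "\<forall>z. extends z u \<longrightarrow> z \<in> B"
        using B by blast
      obtain t where t: "extends y (s @ t)" "length (s @ t) \<ge> length u"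
        using extends_longer[OF y] by blast
      obtain v where "s @ t = u @ v"
        using extends_comparable[OF u(1) t(1) t(2)] by blast
      then have "z \<in> B" if "extends z (s @ t)" for z
        using u(2) extends_appendD[of z u v] that by simp
      then show ?thesis
        unfolding E_def by blast
    next
      case False
      then show ?thesis
        by (intro exI[of _ "[]"]) (auto simp: E_def)
    qed
  next
    fix s t assume "s \<in> E"
    then show "s @ t \<in> E"
      unfolding E_def using extends_appendD by blast
  qed
  moreover have "decided (\<lambda>_. E) B"
    unfolding decided_def generic_def E_def by blast
  ultimately show ?thesis
    by (intro exI[of _ "\<lambda>_. E"]) simp
qed

text \<open>
  The Baire property of Borel sets in combinatorial form: dense sets of words take the place of
  dense open sets.
\<close>

lemma decided_borel:
  fixes X :: "(nat \<Rightarrow> 'a) \<Rightarrow> 'b::topological_space"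
  assumes X: "\<And>x W. open W \<Longrightarrow> X x \<in> W \<Longrightarrow> \<exists>s. extends x s \<and> (\<forall>y. extends y s \<longrightarrow> X y \<in> W)"
    and "W \<in> sets borel"
  shows "\<exists>D. (\<forall>k. dense_open (D k)) \<and> decided D (X -` W)"
proof -
  have "W \<in> sigma_sets UNIV {S. open S}"
    using assms(2) unfolding borel_def by (simp add: sets_measure_of)
  then show ?thesis
  proof (induction rule: sigma_sets.induct)
    case (Basic W)
    then show ?case
      using X by (intro decided_open) auto
  next
    case Empty
    show ?case
      by (intro decided_open) auto
  next
    case (Compl W)
    then show ?case
      unfolding decided_def by auto
  next
    case (Union W)
    then show ?case
      using decided_Union[of "\<lambda>n. X -` W n"] by (simp add: vimage_UN)
  qed
qed

text \<open>A measurable map into a second countable space becomes continuous once the preimages of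
  countably many basic open sets are decided.\<close>

lemma generic_continuity:
  fixes X :: "(nat \<Rightarrow> 'a) \<Rightarrow> 'b::topological_space" and \<phi> :: "nat \<Rightarrow> 'b \<Rightarrow> 'c::{metric_space, second_countable_topology}"
  assumes X: "\<And>x W. open W \<Longrightarrow> X x \<in> W \<Longrightarrow> \<exists>s. extends x s \<and> (\<forall>y. extends y s \<longrightarrow> X y \<in> W)"
    and X_in: "\<And>x. X x \<in> A" and meas: "\<And>i. \<phi> i \<in> restrict_space borel A \<rightarrow>\<^sub>M borel"
  obtains D where "\<And>k. dense_open (D k)"
    "\<And>x i e. generic D x \<Longrightarrow> e > 0 \<Longrightarrow>
      \<exists>s. extends x s \<and> (\<forall>y. generic D y \<longrightarrow> extends y s \<longrightarrow> dist (\<phi> i (X x)) (\<phi> i (X y)) < e)"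
proof -
  obtain \<B> :: "'c set set" where \<B>: "countable \<B>" "topological_basis \<B>"
    using ex_countable_basis by blast
  define V where "V = from_nat_into \<B>"
  have "\<B> \<noteq> {}"
    using \<B>(2) topological_basisE[OF \<B>(2) open_UNIV UNIV_I] by blast
  then have range_V: "range V = \<B>"
    unfolding V_def using \<B>(1) by (simp add: range_from_nat_into)
  define B where "B m = (case prod_decode m of (i, r) \<Rightarrow> {x. \<phi> i (X x) \<in> V r})" for m
  have "\<exists>D. (\<forall>k. dense_open (D k)) \<and> decided D (B m)" for m
  proof -
    obtain i r where m: "prod_decode m = (i, r)"
      by (metis surj_pair)
    have "open (V r)"
      using range_V \<B>(2) topological_basis_open by blast
    then have "\<phi> i -` V r \<inter> space (restrict_space borel A) \<in> sets (restrict_space borel A)"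
      by (intro measurable_sets[OF meas]) simp
    \<comment> \<open>Measurability on \<open>A\<close> provides only the trace of a Borel set of
      the whole space; \<open>X\<close> never leaves \<open>A\<close>, so the trace
      suffices.\<close>
    then obtain W where W: "W \<in> sets borel" "\<phi> i -` V r \<inter> A = A \<inter> W"
      by (auto simp: sets_restrict_space space_restrict_space)
    then have "B m = X -` W"
      using X_in m by (auto simp: B_def)
    then show ?thesis
      using decided_borel[OF X W(1)] by simp
  qed
  then obtain D where D: "\<And>k. dense_open (D k)" "\<And>m. decided D (B m)"
    using decided_simultaneously[of B] by blast
  show thesis
  proof (rule that[OF D(1)])
    fix x i and e :: real assume x: "generic D x" and "e > 0"
    obtain r where r: "\<phi> i (X x) \<in> V r" "V r \<subseteq> ball (\<phi> i (X x)) e"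
      using topological_basisE[OF \<B>(2), of "ball (\<phi> i (X x)) e" "\<phi> i (X x)"] \<open>e > 0\<close> range_V
      by (metis centre_in_ball open_ball rangeE)
    have Bi: "B (prod_encode (i, r)) = {x. \<phi> i (X x) \<in> V r}"
      by (simp add: B_def)
    obtain s where s: "extends x s" "\<forall>y. generic D y \<longrightarrow> extends y s \<longrightarrow> (y \<in> B (prod_encode (i, r)) \<longleftrightarrow> x \<in> B (prod_encode (i, r)))"
      using D(2) x unfolding decided_def by blast
    then show "\<exists>s. extends x s \<and> (\<forall>y. generic D y \<longrightarrow> extends y s \<longrightarrow> dist (\<phi> i (X x)) (\<phi> i (X y)) < e)"
      using r unfolding Bi by (intro exI[of _ s]) auto
  qed
qed

subsection \<open>Construction of block reductions\<close>

definition glue :: "'a list \<Rightarrow> (nat \<Rightarrow> 'a) \<Rightarrow> nat \<Rightarrow> 'a" where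
  "glue w z i = (if i < length w then w ! i else z (i - length w))"

lemma extends_glue [simp]: "extends (glue w z) w" "extends (glue w z) (w @ t) \<longleftrightarrow> extends z t"
  unfolding extends_append_iff by (simp_all add: extends_def glue_def)

lemma dense_open_append: "dense_open E \<Longrightarrow> dense_open {t. w @ t \<in> E}"
  unfolding dense_open_def by (auto simp flip: append_assoc)

lemma extends_le:
  assumes "extends x s" "extends x s'" "length s \<le> length s'" "extends y s'"
  shows "extends y s"
  using extends_comparable[OF assms(1-3)] assms(4) extends_appendD by blast

lemma finite_requirements:
  assumes "finite A" and hered: "\<And>a s t. a \<in> A \<Longrightarrow> R a s \<Longrightarrow> R a (s @ t)"
    and dense: "\<And>a s. a \<in> A \<Longrightarrow> \<exists>t. R a (s @ t)"
  shows "\<exists>t. \<forall>a\<in>A. R a (s @ t)"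
  using assms
proof (induction A rule: finite_induct)
  case (insert a A)
  then obtain t where t: "\<forall>b\<in>A. R b (s @ t)"
    by auto
  obtain u where "R a ((s @ t) @ u)"
    using insert.prems(2) by blast
  moreover have "\<forall>b\<in>A. R b ((s @ t) @ u)"
    using t insert.prems(1) by blast
  ultimately show ?case
    by (intro exI[of _ "t @ u"]) simp
qed simp

section \<open>Filling words that stabilise a generic map\<close>

locale generic_map =
  fixes D :: "nat \<Rightarrow> 'a list set" and \<Phi> :: "(nat \<Rightarrow> 'a) \<Rightarrow> nat \<Rightarrow> torus"
  assumes D: "\<And>k. dense_open (D k)"
    and cont: "\<And>x i e. generic D x \<Longrightarrow> e > 0 \<Longrightarrow>
      \<exists>s. extends x s \<and> (\<forall>y. generic D y \<longrightarrow> extends y s \<longrightarrow> dist (\<Phi> x i) (\<Phi> y i) < e)"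
    and tail: "\<And>x y n. \<forall>i\<ge>n. x i = y i \<Longrightarrow> convergent (\<lambda>i. \<Phi> x i - \<Phi> y i)"
begin

abbreviation osc :: "(nat \<Rightarrow> 'a) \<Rightarrow> (nat \<Rightarrow> 'a) \<Rightarrow> nat \<Rightarrow> nat \<Rightarrow> real" where
  "osc x x' i i' \<equiv> size_torus ((\<Phi> x i - \<Phi> x' i) - (\<Phi> x i' - \<Phi> x' i'))"

lemma osc_diff:
  "osc x x' i i' \<le> osc y y' i i' + dist (\<Phi> x i) (\<Phi> y i) + dist (\<Phi> x i') (\<Phi> y i')
     + dist (\<Phi> x' i) (\<Phi> y' i) + dist (\<Phi> x' i') (\<Phi> y' i')"
proof -
  have "(\<Phi> x i - \<Phi> x' i) - (\<Phi> x i' - \<Phi> x' i')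
      = ((\<Phi> y i - \<Phi> y' i) - (\<Phi> y i' - \<Phi> y' i')) + (\<Phi> x i - \<Phi> y i) - (\<Phi> x i' - \<Phi> y i')
        - (\<Phi> x' i - \<Phi> y' i) + (\<Phi> x' i' - \<Phi> y' i')"
    by simp
  then show ?thesis
    unfolding dist_torus_eq_size
    by (metis size_torus_add_le size_torus_diff_le order_refl)
qed

definition paired :: "'a list \<Rightarrow> 'a list \<Rightarrow> (nat \<Rightarrow> 'a) \<Rightarrow> (nat \<Rightarrow> 'a) \<Rightarrow> bool" where
  "paired w w' x x' \<longleftrightarrow> generic D x \<and> generic D x' \<and> extends x w \<and> extends x' w' \<and> (\<forall>i\<ge>length w. x i = x' i)"

lemma paired_appendD:
  assumes "paired (w @ t) (w' @ t) x x'" "length w = length w'"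
  shows "paired w w' x x'"
proof -
  have "x i = x' i" if i: "i \<ge> length w" for i
  proof (cases "i < length w + length t")
    case True
    then obtain j where j: "i = length w + j" "j < length t"
      using i by (metis le_add_diff_inverse nat_add_left_cancel_less)
    then show ?thesis
      using assms by (simp add: paired_def extends_append_iff) (simp add: extends_def)
  qed (use assms in \<open>simp add: paired_def\<close>)
  then show ?thesis
    using assms unfolding paired_def by (auto dest: extends_appendD)
qed

text \<open>Otherwise oscillation above \<open>e\<close> beyond any \<open>l\<close> occurs below
  every word and, by continuity, persists on a longer word. A generic continuation of both
  \<open>w\<close> and \<open>w'\<close> then oscillates arbitrarily late, although the two
  sequences share a tail.\<close>

lemma stabilize_pair:
  assumes len: "length w = length w'" and "e > 0"
  shows "\<exists>t l. \<forall>x x'. paired (w @ t) (w' @ t) x x' \<longrightarrow> (\<forall>i\<ge>l. \<forall>i'\<ge>l. osc x x' i i' \<le> e)"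
proof (rule ccontr)
  assume contr: "\<not> ?thesis"
  define E where "E l = {t. \<forall>x x'. paired (w @ t) (w' @ t) x x' \<longrightarrow> (\<exists>i\<ge>l. \<exists>i'\<ge>l. osc x x' i i' > e)}" for l
  have E: "dense_open (E l)" for l
    unfolding dense_open_def
  proof (intro conjI allI impI)
    fix t
    obtain x x' i i' where p: "paired (w @ t) (w' @ t) x x'" and i: "i \<ge> l" "i' \<ge> l" and osc: "osc x x' i i' > e"
      using contr by (meson not_le)
    \<comment> \<open>Four outputs are perturbed, so each may use a quarter of the excess over
      \<open>e\<close>.\<close>
    define \<eta> where "\<eta> = (osc x x' i i' - e) / 4"
    have "\<eta> > 0"
      using osc by (simp add: \<eta>_def)
    have gen: "generic D x" "generic D x'"
      using p by (auto simp: paired_def)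
    obtain u1 where u1: "extends x u1" "\<forall>y. generic D y \<longrightarrow> extends y u1 \<longrightarrow> dist (\<Phi> x i) (\<Phi> y i) < \<eta>"
      using cont[OF gen(1) \<open>\<eta> > 0\<close>] by blast
    obtain u2 where u2: "extends x u2" "\<forall>y. generic D y \<longrightarrow> extends y u2 \<longrightarrow> dist (\<Phi> x i') (\<Phi> y i') < \<eta>"
      using cont[OF gen(1) \<open>\<eta> > 0\<close>] by blast
    obtain u3 where u3: "extends x' u3" "\<forall>y. generic D y \<longrightarrow> extends y u3 \<longrightarrow> dist (\<Phi> x' i) (\<Phi> y i) < \<eta>"
      using cont[OF gen(2) \<open>\<eta> > 0\<close>] by blast
    obtain u4 where u4: "extends x' u4" "\<forall>y. generic D y \<longrightarrow> extends y u4 \<longrightarrow> dist (\<Phi> x' i') (\<Phi> y i') < \<eta>"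
      using cont[OF gen(2) \<open>\<eta> > 0\<close>] by blast
    define N where "N = length u1 + length u2 + length u3 + length u4"
    define v where "v = map (\<lambda>k. x (length (w @ t) + k)) [0..<N]"
    have xv: "extends x (w @ t @ v)"
      using p extends_append_iff[of x "w @ t" v] by (simp add: paired_def v_def extends_def)
    have xv': "extends x' (w' @ t @ v)"
      using p len extends_append_iff[of x' "w' @ t" v] by (simp add: paired_def v_def extends_def)
    have long: "length u \<le> length (w @ t @ v)" "length u \<le> length (w' @ t @ v)" if "u \<in> {u1, u2, u3, u4}" for u
      using that by (auto simp: N_def v_def)
    have "t @ v \<in> E l"
      unfolding E_def
    proof (intro CollectI allI impI)
      fix y y' assume "paired (w @ t @ v) (w' @ t @ v) y y'"
      then have y: "generic D y" "extends y (w @ t @ v)" "generic D y'" "extends y' (w' @ t @ v)"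
        by (auto simp: paired_def)
      have "dist (\<Phi> x i) (\<Phi> y i) < \<eta>" "dist (\<Phi> x i') (\<Phi> y i') < \<eta>"
        using u1(2) u2(2) y extends_le[OF u1(1) xv long(1) y(2)] extends_le[OF u2(1) xv long(1) y(2)] by blast+
      moreover have "dist (\<Phi> x' i) (\<Phi> y' i) < \<eta>" "dist (\<Phi> x' i') (\<Phi> y' i') < \<eta>"
        using u3(2) u4(2) y extends_le[OF u3(1) xv' long(2) y(4)] extends_le[OF u4(1) xv' long(2) y(4)] by blast+
      ultimately have "osc x x' i i' < osc y y' i i' + 4 * \<eta>"
        using osc_diff[of x i x' i' y y'] by linarith
      moreover have "4 * \<eta> = osc x x' i i' - e"
        by (simp add: \<eta>_def)
      ultimately have "osc y y' i i' > e"
        by linarith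
      then show "\<exists>i\<ge>l. \<exists>i'\<ge>l. osc y y' i i' > e"
        using i by blast
    qed
    then show "\<exists>v. t @ v \<in> E l" ..
  next
    fix t u assume t: "t \<in> E l"
    have "paired (w @ t) (w' @ t) x x'" if "paired (w @ t @ u) (w' @ t @ u) x x'" for x x'
      using that len paired_appendD[of "w @ t" u "w' @ t" x x'] by simp
    then show "t @ u \<in> E l"
      using t unfolding E_def by simp
  qed
  \<comment> \<open>Three families are met at once: persistent oscillation, and genericity of the
    continuation after \<open>w\<close> and after \<open>w'\<close>.\<close>
  define D2 where "D2 n k = (if n = 0 then E k else if n = 1 then {t. w @ t \<in> D k} else {t. w' @ t \<in> D k})" for n k :: nat
  have "dense_open (D2 n k)" for n k
    unfolding D2_def using E dense_open_append[OF D] by simp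
  then have "dense_open (case prod_decode m of (n, k) \<Rightarrow> D2 n k)" for m
    by (simp split: prod.split)
  then obtain z where "generic (\<lambda>m. case prod_decode m of (n, k) \<Rightarrow> D2 n k) z"
    using generic_exists[of "\<lambda>m. case prod_decode m of (n, k) \<Rightarrow> D2 n k" "[]"] by blast
  then have "generic (D2 n) z" for n
    unfolding generic_prod_decode by blast
  from this[of 0] this[of 1] this[of 2]
  have z: "generic E z" "generic (\<lambda>k. {t. w @ t \<in> D k}) z" "generic (\<lambda>k. {t. w' @ t \<in> D k}) z"
    by (simp_all add: D2_def[abs_def])
  have gen: "generic D (glue w z)" "generic D (glue w' z)"
    using z(2,3) unfolding generic_def by (metis (no_types, lifting) extends_glue(2) mem_Collect_eq)+
  have tails: "glue w z i = glue w' z i" if "i \<ge> length w" for i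
    using that len by (simp add: glue_def)
  then have "Cauchy (\<lambda>i. \<Phi> (glue w z) i - \<Phi> (glue w' z) i)"
    using tail[of "length w"] by (simp add: convergent_Cauchy)
  then obtain l where l: "\<And>i i'. i \<ge> l \<Longrightarrow> i' \<ge> l \<Longrightarrow> osc (glue w z) (glue w' z) i i' < e"
    using \<open>e > 0\<close> unfolding Cauchy_def dist_torus_eq_size by meson
  obtain t where t: "t \<in> E l" "extends z t"
    using z(1) unfolding generic_def by blast
  then have "paired (w @ t) (w' @ t) (glue w z) (glue w' z)"
    using gen tails by (simp add: paired_def)
  then obtain i i' where "i \<ge> l" "i' \<ge> l" "osc (glue w z) (glue w' z) i i' > e"
    using t(1) unfolding E_def by blast
  then show False
    using l[of i i'] by linarith
qed

text \<open>The order matters: stabilising all pairs of prefixes fixes \<open>l\<close>; only then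
  can the outputs up to \<open>l\<close> be pinned down, and finally \<open>D n\<close> is entered.
  Each property survives further extension.\<close>

lemma stage:
  assumes fin: "finite V" and len: "\<forall>v\<in>V. length v = L" and "e > 0"
  shows "\<exists>s l. l0 < l \<and> (\<forall>v\<in>V. v @ s \<in> D n) \<and>
    (\<forall>v\<in>V. \<forall>x y. generic D x \<longrightarrow> generic D y \<longrightarrow> extends x (v @ s) \<longrightarrow> extends y (v @ s) \<longrightarrow>
      (\<forall>i\<le>l. size_torus (\<Phi> x i - \<Phi> y i) \<le> e)) \<and>
    (\<forall>v\<in>V. \<forall>v'\<in>V. \<forall>x x'. paired (v @ s) (v' @ s) x x' \<longrightarrow> (\<forall>i\<ge>l. \<forall>i'\<ge>l. osc x x' i i' \<le> e))"
proof -
  have len': "length v = L" if "v \<in> V" for v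
    using len that by blast
  define R1 where "R1 a s \<longleftrightarrow> (\<exists>l. \<forall>x x'. paired (fst a @ s) (snd a @ s) x x' \<longrightarrow> (\<forall>i\<ge>l. \<forall>i'\<ge>l. osc x x' i i' \<le> e))" for a s
  have "\<exists>t. \<forall>a\<in>V \<times> V. R1 a ([] @ t)"
  proof (rule finite_requirements)
    fix a s t assume "a \<in> V \<times> V" "R1 a s"
    moreover have "length (fst a) = length (snd a)"
      using \<open>a \<in> V \<times> V\<close> len'[of "fst a"] len'[of "snd a"] by auto
    then have "paired (fst a @ s) (snd a @ s) x x'" if "paired (fst a @ s @ t) (snd a @ s @ t) x x'" for x x'
      using that paired_appendD[of "fst a @ s" t "snd a @ s" x x'] by simp
    ultimately show "R1 a (s @ t)"
      unfolding R1_def by meson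
  next
    fix a s assume "a \<in> V \<times> V"
    then have "length (fst a @ s) = length (snd a @ s)"
      using len'[of "fst a"] len'[of "snd a"] by auto
    from stabilize_pair[OF this \<open>e > 0\<close>] show "\<exists>t. R1 a (s @ t)"
      unfolding R1_def by simp
  qed (use fin in simp)
  then obtain s1 where s1: "\<And>a. a \<in> V \<times> V \<Longrightarrow> R1 a s1"
    by auto
  then obtain la where la: "\<And>a x x' i i'. a \<in> V \<times> V \<Longrightarrow> paired (fst a @ s1) (snd a @ s1) x x' \<Longrightarrow>
      i \<ge> la a \<Longrightarrow> i' \<ge> la a \<Longrightarrow> osc x x' i i' \<le> e"
    unfolding R1_def by metis
  \<comment> \<open>The sum bounds the thresholds of all pairs simultaneously; \<open>Suc l0\<close>
    makes the thresholds of successive stages increase.\<close>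
  define l where "l = Suc l0 + (\<Sum>a\<in>V \<times> V. la a)"
  have la_le: "la a \<le> l" if "a \<in> V \<times> V" for a
    using member_le_sum[of a "V \<times> V" la] that fin by (simp add: l_def)
  define R2 where "R2 a s \<longleftrightarrow> (\<forall>x y. generic D x \<longrightarrow> generic D y \<longrightarrow> extends x (fst a @ s) \<longrightarrow> extends y (fst a @ s) \<longrightarrow>
      size_torus (\<Phi> x (snd a) - \<Phi> y (snd a)) \<le> e)" for a s
  have "\<exists>t. \<forall>a\<in>V \<times> {..l}. R2 a (s1 @ t)"
  proof (rule finite_requirements)
    fix a s t assume "R2 a s"
    then show "R2 a (s @ t)"
      unfolding R2_def by (metis append_assoc extends_appendD)
  next
    fix a :: "'a list \<times> nat" and s
    obtain x where x: "extends x (fst a @ s)" "generic D x"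
      using generic_exists[of D, OF D] by blast
    obtain u where u: "extends x u" "\<forall>y. generic D y \<longrightarrow> extends y u \<longrightarrow> dist (\<Phi> x (snd a)) (\<Phi> y (snd a)) < e / 2"
      using cont[OF x(2), of "e / 2"] \<open>e > 0\<close> by auto
    obtain t where t: "extends x ((fst a @ s) @ t)" "length ((fst a @ s) @ t) \<ge> length u"
      using extends_longer[OF x(1)] by blast
    have "R2 a (s @ t)"
      unfolding R2_def
    proof (intro allI impI)
      fix y z assume y: "generic D y" "generic D z" "extends y (fst a @ s @ t)" "extends z (fst a @ s @ t)"
      then have "dist (\<Phi> x (snd a)) (\<Phi> y (snd a)) < e / 2" "dist (\<Phi> x (snd a)) (\<Phi> z (snd a)) < e / 2"
        using u(2) extends_le[OF u(1) t] by auto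
      then show "size_torus (\<Phi> y (snd a) - \<Phi> z (snd a)) \<le> e"
        using dist_triangle3[of "\<Phi> y (snd a)" "\<Phi> z (snd a)" "\<Phi> x (snd a)"] unfolding dist_torus_eq_size[symmetric] by linarith
    qed
    then show "\<exists>t. R2 a (s @ t)" ..
  qed (use fin in simp)
  then obtain s2 where s2: "\<And>a. a \<in> V \<times> {..l} \<Longrightarrow> R2 a (s1 @ s2)"
    by blast
  have "\<exists>t. \<forall>v\<in>V. v @ ((s1 @ s2) @ t) \<in> D n"
    by (rule finite_requirements[where R = "\<lambda>v s. v @ s \<in> D n"])
      (use fin dense_openD[OF D] in \<open>auto simp flip: append_assoc\<close>)
  then obtain s3 where s3: "\<forall>v\<in>V. v @ ((s1 @ s2) @ s3) \<in> D n"
    by blast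
  show ?thesis
  proof (intro exI[of _ "(s1 @ s2) @ s3"] exI[of _ l] conjI s3)
    show "l0 < l"
      by (simp add: l_def)
    show "\<forall>v\<in>V. \<forall>x y. generic D x \<longrightarrow> generic D y \<longrightarrow> extends x (v @ (s1 @ s2) @ s3) \<longrightarrow> extends y (v @ (s1 @ s2) @ s3) \<longrightarrow>
        (\<forall>i\<le>l. size_torus (\<Phi> x i - \<Phi> y i) \<le> e)"
    proof (intro ballI allI impI)
      fix v x y i
      assume v: "v \<in> V" and g: "generic D x" "generic D y" and i: "i \<le> l"
        and ext: "extends x (v @ (s1 @ s2) @ s3)" "extends y (v @ (s1 @ s2) @ s3)"
      have "extends x (v @ s1 @ s2)" "extends y (v @ s1 @ s2)"
        using ext extends_appendD[of x "v @ s1 @ s2" s3] extends_appendD[of y "v @ s1 @ s2" s3] by auto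
      then show "size_torus (\<Phi> x i - \<Phi> y i) \<le> e"
        using s2[of "(v, i)"] v i g unfolding R2_def by auto
    qed
    show "\<forall>v\<in>V. \<forall>v'\<in>V. \<forall>x x'. paired (v @ (s1 @ s2) @ s3) (v' @ (s1 @ s2) @ s3) x x' \<longrightarrow>
        (\<forall>i\<ge>l. \<forall>i'\<ge>l. osc x x' i i' \<le> e)"
    proof (intro ballI allI impI)
      fix v v' x x' i i' assume v: "v \<in> V" "v' \<in> V" and i: "i \<ge> l" "i' \<ge> l"
        and p: "paired (v @ (s1 @ s2) @ s3) (v' @ (s1 @ s2) @ s3) x x'"
      have "paired (v @ s1) (v' @ s1) x x'"
        using p len'[OF v(1)] len'[OF v(2)] paired_appendD[of "v @ s1" "s2 @ s3" "v' @ s1" x x'] by simp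
      then show "osc x x' i i' \<le> e"
        using la[of "(v, v')" x x' i i'] la_le[of "(v, v')"] v i by auto
    qed
  qed
qed

end

section \<open>Assembly of the words and of the block reduction\<close>

lemma sum_extends:
  fixes x :: "nat \<Rightarrow> 'a::comm_monoid_add"
  shows "extends x w \<Longrightarrow> (\<Sum>i<length w. x i) = sum_list w"
  by (simp add: extends_def sum_list_sum_nth atLeast0LessThan)

context generic_map
begin

text \<open>
  The entries of \<open>y\<close> will be single letters of a sequence of words \<open>W n y\<close>. The filling words are
  chosen generically, so that at stage \<open>n\<close> the outputs up to \<open>l\<close> are nearly determined by \<open>W y\<close>,
  and changing the first \<open>n\<close> entries of \<open>y\<close> shifts the outputs beyond \<open>l\<close> by a nearly constant
  amount.
\<close>

definition stage_ok :: "(nat \<Rightarrow> 'a set) \<Rightarrow> nat \<Rightarrow> ((nat \<Rightarrow> 'a) \<Rightarrow> 'a list) \<times> nat \<Rightarrow> bool" where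
  "stage_ok F n = (\<lambda>(W, l). finite (W ` Pi UNIV F) \<and> (\<exists>L\<ge>n. \<forall>y\<in>Pi UNIV F. length (W y) = L) \<and>
     (\<forall>y y'. (\<forall>m<n. y m = y' m) \<longrightarrow> W y = W y') \<and>
     (\<forall>y\<in>Pi UNIV F. W y \<in> D n \<and> (\<forall>x x'. generic D x \<longrightarrow> generic D x' \<longrightarrow> extends x (W y) \<longrightarrow> extends x' (W y) \<longrightarrow>
        (\<forall>i\<le>l. size_torus (\<Phi> x i - \<Phi> x' i) \<le> (1 / 2) ^ n))) \<and>
     (\<forall>y\<in>Pi UNIV F. \<forall>y'\<in>Pi UNIV F. \<forall>x x'. paired (W y) (W y') x x' \<longrightarrow>
        (\<forall>i\<ge>l. \<forall>i'\<ge>l. osc x x' i i' \<le> (1 / 2) ^ n)))"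

lemma stage_ok_exists:
  assumes fin: "finite (v ` Pi UNIV F)" and len: "\<forall>y\<in>Pi UNIV F. length (v y) = L" and "L \<ge> n"
    and dep: "\<forall>y y'. (\<forall>m<n. y m = y' m) \<longrightarrow> v y = v y'"
  shows "\<exists>s l. l0 < l \<and> stage_ok F n (\<lambda>y. v y @ s, l)"
proof -
  have pos: "(1 / 2 :: real) ^ n > 0"
    by simp
  have len': "\<forall>w\<in>v ` Pi UNIV F. length w = L"
    using len by auto
  obtain s l where sl: "l0 < l" "\<forall>w\<in>v ` Pi UNIV F. w @ s \<in> D n"
    "\<forall>w\<in>v ` Pi UNIV F. \<forall>x y. generic D x \<longrightarrow> generic D y \<longrightarrow> extends x (w @ s) \<longrightarrow> extends y (w @ s) \<longrightarrow>
      (\<forall>i\<le>l. size_torus (\<Phi> x i - \<Phi> y i) \<le> (1 / 2) ^ n)"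
    "\<forall>w\<in>v ` Pi UNIV F. \<forall>w'\<in>v ` Pi UNIV F. \<forall>x x'. paired (w @ s) (w' @ s) x x' \<longrightarrow>
      (\<forall>i\<ge>l. \<forall>i'\<ge>l. osc x x' i i' \<le> (1 / 2) ^ n)"
    using stage[OF fin len' pos, of l0 n] by (elim exE conjE) (rule that; assumption)
  have "finite ((\<lambda>y. v y @ s) ` Pi UNIV F)"
    using finite_imageI[OF fin, of "\<lambda>w. w @ s"] by (simp add: image_image)
  moreover have "\<exists>L\<ge>n. \<forall>y\<in>Pi UNIV F. length (v y @ s) = L"
    using len \<open>L \<ge> n\<close> by (intro exI[of _ "L + length s"]) auto
  ultimately have "stage_ok F n (\<lambda>y. v y @ s, l)"
    unfolding stage_ok_def using sl(2-4) dep by simp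
  then show ?thesis
    using sl(1) by blast
qed

text \<open>The word before stage \<open>Suc n\<close> ends in the free letter \<open>y n\<close>;
  as the alphabets are finite, finitely many prefixes arise and one common filler \<open>s n\<close>
  serves them all.\<close>

lemma block_words:
  assumes F: "\<And>n. finite (F n)"
  obtains W l s where "\<And>n. stage_ok F n (W n, l n)" "strict_mono l" "\<And>n y. W (Suc n) y = W n y @ [y n] @ s n"
proof -
  have "\<exists>f. \<forall>n. stage_ok F n (f n) \<and> snd (f n) < snd (f (Suc n)) \<and> (\<exists>s. \<forall>y. fst (f (Suc n)) y = fst (f n) y @ [y n] @ s)"
  proof (rule dependent_nat_choice)
    show "\<exists>x. stage_ok F 0 x"
      using stage_ok_exists[of "\<lambda>_. []" F 0 0 0] finite_subset[of "(\<lambda>_. []) ` Pi UNIV F" "{[]}"] by auto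
  next
    fix x n assume x: "stage_ok F n x"
    obtain W l where Wl: "x = (W, l)"
      by (metis surj_pair)
    have finW: "finite (W ` Pi UNIV F)"
      using x by (simp add: stage_ok_def Wl)
    obtain L where L: "L \<ge> n" "\<forall>y\<in>Pi UNIV F. length (W y) = L"
      using x by (auto simp: stage_ok_def Wl)
    have "finite ((\<lambda>y. W y @ [y n]) ` Pi UNIV F)"
    proof (rule finite_subset)
      show "(\<lambda>y. W y @ [y n]) ` Pi UNIV F \<subseteq> (\<lambda>(w, a). w @ [a]) ` (W ` Pi UNIV F \<times> F n)"
        by force
      show "finite ((\<lambda>(w, a). w @ [a]) ` (W ` Pi UNIV F \<times> F n))"
        by (rule finite_imageI[OF finite_cartesian_product[OF finW F]])
    qed
    moreover have "\<forall>y\<in>Pi UNIV F. length (W y @ [y n]) = Suc L"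
      using L by simp
    moreover have "\<forall>y y'. (\<forall>m<Suc n. y m = y' m) \<longrightarrow> W y @ [y n] = W y' @ [y' n]"
      using x by (simp add: stage_ok_def Wl)
    ultimately obtain s l' where "l < l'" "stage_ok F (Suc n) (\<lambda>y. (W y @ [y n]) @ s, l')"
      using stage_ok_exists[of "\<lambda>y. W y @ [y n]" F "Suc L" "Suc n" l] L(1) by auto
    then show "\<exists>x'. stage_ok F (Suc n) x' \<and> snd x < snd x' \<and> (\<exists>s. \<forall>y. fst x' y = fst x y @ [y n] @ s)"
      by (intro exI[of _ "(\<lambda>y. (W y @ [y n]) @ s, l')"]) (auto simp: Wl)
  qed
  then obtain f where f: "\<forall>n. stage_ok F n (f n) \<and> snd (f n) < snd (f (Suc n)) \<and>
      (\<exists>s. \<forall>y. fst (f (Suc n)) y = fst (f n) y @ [y n] @ s)" ..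
  then obtain s where "\<forall>n. \<forall>y. fst (f (Suc n)) y = fst (f n) y @ [y n] @ s n"
    using choice[of "\<lambda>n s. \<forall>y. fst (f (Suc n)) y = fst (f n) y @ [y n] @ s"] by blast
  then show ?thesis
    using that[of "\<lambda>n. fst (f n)" "\<lambda>n. snd (f n)" s] f by (simp add: strict_mono_Suc_iff)
qed

end

text \<open>Away from the letter positions \<open>p n\<close> all sequences
  \<open>\<sigma> y\<close> carry the same fillers, so these cancel in differences and the
  equivalence of \<open>\<sigma> y\<close> and \<open>\<sigma> y'\<close> is that of the sums of
  \<open>y - y'\<close>.\<close>

lemma block_reduction_exists:
  fixes D :: "nat \<Rightarrow> rat list set" and \<Phi> :: "(nat \<Rightarrow> rat) \<Rightarrow> nat \<Rightarrow> torus"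
  assumes D: "\<And>k. dense_open (D k)"
    and cont: "\<And>x i e. generic D x \<Longrightarrow> e > 0 \<Longrightarrow>
      \<exists>s. extends x s \<and> (\<forall>y. generic D y \<longrightarrow> extends y s \<longrightarrow> dist (\<Phi> x i) (\<Phi> y i) < e)"
    and red: "\<And>x y. convergent (\<lambda>i. \<Phi> x i - \<Phi> y i) \<longleftrightarrow> convergent (\<lambda>k. orbit P (\<Sum>i<k. x i - y i))"
  obtains F l \<sigma> where "block_reduction P F l (\<lambda>y. \<Phi> (\<sigma> y))"
proof -
  have tail: "convergent (\<lambda>i. \<Phi> x i - \<Phi> y i)" if eq: "\<forall>i\<ge>n. x i = y i" for x y n
  proof -
    have "(\<Sum>i<k. x i - y i) = (\<Sum>i<n. x i - y i)" if "k \<ge> n" for k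
      using that eq by (intro sum.mono_neutral_right) auto
    then have "(\<lambda>k. orbit P (\<Sum>i<k. x i - y i)) \<longlonglongrightarrow> orbit P (\<Sum>i<n. x i - y i)"
      by (intro tendsto_eventually eventually_sequentiallyI[of n] arg_cong[where f = "orbit P"])
    then show ?thesis
      unfolding red convergent_def by blast
  qed
  interpret generic_map D \<Phi>
    using D cont tail by unfold_locales
  \<comment> \<open>An enumeration of the rationals makes the alphabets exhaust them; 0 is put into
    all of them for the entries left blank.\<close>
  define F :: "nat \<Rightarrow> rat set" where "F n = insert 0 (from_nat ` {..n})" for n
  have F_fin: "finite (F n)" for n
    by (simp add: F_def)
  have F0: "0 \<in> F n" for n
    by (simp add: F_def)
  have F_mono: "F m \<subseteq> F n" if "m \<le> n" for m n
    using that by (auto simp: F_def)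
  have "t \<in> F (to_nat t)" for t :: rat
    by (auto simp: F_def intro!: image_eqI[of _ _ "to_nat t"])
  then have F_UNIV: "(\<Union>n. F n) = UNIV"
    by blast
  obtain W l s where ok: "\<And>n. stage_ok F n (W n, l n)" and l: "strict_mono l"
    and W_Suc: "\<And>n y. W (Suc n) y = W n y @ [y n] @ s n"
    using block_words[of F, OF F_fin] by blast
  have "\<exists>x. \<forall>n. extends x (W n y)" for y
  proof -
    have "length (W n y) \<ge> n" for n
      by (induction n) (simp_all add: W_Suc)
    then show ?thesis
      using chain_limit[of "\<lambda>n. W n y"] W_Suc by metis
  qed
  then obtain \<sigma> where \<sigma>: "\<And>y n. extends (\<sigma> y) (W n y)"
    by metis
  define p where "p n = length (W n (\<lambda>_. 0))" for n
  have W0: "W 0 y = W 0 y'" for y y'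
    using ok[of 0] unfolding stage_ok_def by simp
  have len: "length (W n y) = p n" for n y
    by (induction n) (simp_all add: W_Suc p_def W0[of y "\<lambda>_. 0"])
  have p_Suc: "p (Suc n) = p n + 1 + length (s n)" for n
    by (simp add: p_def W_Suc)
  have p: "strict_mono p"
    by (simp add: strict_mono_Suc_iff p_Suc)
  have letter: "\<sigma> y (p n) = y n" for y n
    using \<sigma>[of y "Suc n"] len[of n y] unfolding W_Suc extends_def by (auto simp: nth_append)
  have same: "\<sigma> y i = \<sigma> y' i" if "i < p 0 \<or> p n < i \<and> i < p (Suc n)" for y y' n i
    using that
  proof
    assume "i < p 0"
    then show ?thesis
      using \<sigma>[of y 0] \<sigma>[of y' 0] W0[of y y'] len[of 0] by (simp add: extends_def)
  next
    assume i: "p n < i \<and> i < p (Suc n)"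
    define j where "j = i - (p n + 1)"
    have j: "i = p n + 1 + j" "j < length (s n)"
      using i unfolding j_def p_Suc by linarith+
    have "\<sigma> y i = s n ! j" for y
      using \<sigma>[of y "Suc n"] len[of n y] j unfolding W_Suc extends_def by (auto simp: nth_append)
    then show ?thesis by simp
  qed
  have pos_cases: "i < p 0 \<or> (\<exists>n. i = p n \<or> p n < i \<and> i < p (Suc n))" for i
  proof (cases "i < p 0")
    case False
    have "i < p (Suc i)"
      using strict_mono_imp_increasing[OF p, of "Suc i"] by simp
    define k where "k = (LEAST k. i < p k)"
    have k: "i < p k"
      unfolding k_def by (rule LeastI) (rule \<open>i < p (Suc i)\<close>)
    have "k \<noteq> 0"
    proof
      assume "k = 0"
      then show False using False k by simp
    qed
    then obtain n where n: "k = Suc n"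
      using not0_implies_Suc by blast
    then have "\<not> i < p n"
      unfolding k_def by (intro not_less_Least) (simp add: k_def n)
    then show ?thesis
      using k n by (metis linorder_neqE_nat)
  qed simp
  have gen: "generic D (\<sigma> y)" if "y \<in> Pi UNIV F" for y
    unfolding generic_def using ok \<sigma> that unfolding stage_ok_def by fast
  have agree: "\<sigma> y i = \<sigma> y' i" if "\<forall>m\<ge>n. y m = y' m" "p n \<le> i" for y y' n i
    using pos_cases[of i]
  proof (elim disjE exE)
    fix m assume m: "i = p m"
    then have "n \<le> m"
      using that(2) p by (simp add: strict_mono_less_eq)
    then show ?thesis
      using m letter that(1) by simp
  qed (use same in blast)+
  have partial: "(\<Sum>i<p n. \<sigma> y i - \<sigma> y' i) = (\<Sum>m<n. y m - y' m)" for y y' n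
  proof -
    have "(\<Sum>i<p n. \<sigma> y i - \<sigma> y' i) = sum_list (W n y) - sum_list (W n y')"
      using sum_extends[OF \<sigma>[of y n]] sum_extends[OF \<sigma>[of y' n]] len by (simp add: sum_subtractf)
    also have "\<dots> = (\<Sum>m<n. y m - y' m)"
      using W0[of y y'] by (induction n) (simp_all add: W_Suc algebra_simps)
    finally show ?thesis .
  qed
  have conv: "convergent (\<lambda>k. orbit P (\<Sum>i<k. \<sigma> y i - \<sigma> y' i)) \<longleftrightarrow> convergent (\<lambda>n. orbit P (\<Sum>m<n. y m - y' m))" for y y'
  proof
    assume "convergent (\<lambda>k. orbit P (\<Sum>i<k. \<sigma> y i - \<sigma> y' i))"
    then have "convergent ((\<lambda>k. orbit P (\<Sum>i<k. \<sigma> y i - \<sigma> y' i)) \<circ> p)"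
      using p by (rule convergent_subseq_convergent)
    then show "convergent (\<lambda>n. orbit P (\<Sum>m<n. y m - y' m))"
      by (simp add: o_def partial)
  next
    assume "convergent (\<lambda>n. orbit P (\<Sum>m<n. y m - y' m))"
    then obtain z where z: "(\<lambda>n. orbit P (\<Sum>m<n. y m - y' m)) \<longlonglongrightarrow> z"
      unfolding convergent_def by blast
    \<comment> \<open>The number of letter positions before \<open>k\<close>; between letter
      positions the partial sums stay constant.\<close>
    define N where "N k = (LEAST n. k \<le> p n)" for k
    have N: "k \<le> p (N k)" for k
      unfolding N_def by (rule LeastI[of _ k]) (rule strict_mono_imp_increasing[OF p])
    have N_lower: "p n < k" if "n < N k" for n k
      using not_less_Least[of n "\<lambda>n. k \<le> p n"] that unfolding N_def by simp
    have eq: "(\<Sum>i<k. \<sigma> y i - \<sigma> y' i) = (\<Sum>m<N k. y m - y' m)" for k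
    proof -
      have "\<sigma> y i - \<sigma> y' i = 0" if i: "k \<le> i" "i < p (N k)" for i
      proof (cases "N k")
        case 0
        then show ?thesis
          using same[of i 0 y y'] i by simp
      next
        case (Suc n)
        then have "p n < i"
          using N_lower[of n k] i by simp
        then show ?thesis
          using same[of i n y y'] i Suc by simp
      qed
      then have "(\<Sum>i<p (N k). \<sigma> y i - \<sigma> y' i) = (\<Sum>i<k. \<sigma> y i - \<sigma> y' i)"
        using N[of k] by (intro sum.mono_neutral_right) (auto simp: not_less)
      then show ?thesis
        using partial by simp
    qed
    have "filterlim N sequentially sequentially"
      unfolding filterlim_at_top eventually_sequentially
    proof
      fix n
      have "n \<le> N k" if "k \<ge> Suc (p n)" for k
      proof (rule ccontr)
        assume "\<not> n \<le> N k"
        then have "p (N k) \<le> p n"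
          using p by (simp add: strict_mono_less_eq)
        then show False
          using N[of k] that by simp
      qed
      then show "\<exists>M. \<forall>k\<ge>M. n \<le> N k" by blast
    qed
    then have "(\<lambda>k. orbit P (\<Sum>m<N k. y m - y' m)) \<longlonglongrightarrow> z"
      using z by (rule filterlim_compose[rotated])
    then show "convergent (\<lambda>k. orbit P (\<Sum>i<k. \<sigma> y i - \<sigma> y' i))"
      unfolding eq convergent_def by blast
  qed
  have "block_reduction P F l (\<lambda>y. \<Phi> (\<sigma> y))"
  proof
    show "0 \<in> F n" for n by (rule F0)
    show "F m \<subseteq> F n" if "m \<le> n" for m n using that by (rule F_mono)
    show "(\<Union>n. F n) = UNIV" by (rule F_UNIV)
    show "strict_mono l" by (rule l)
  next
    fix y y' :: "nat \<Rightarrow> rat" and n i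
    assume y: "\<forall>n. y n \<in> F n" "\<forall>n. y' n \<in> F n" and eq: "\<forall>m<n. y m = y' m" and i: "i \<le> l n"
    have mem: "y \<in> Pi UNIV F" "y' \<in> Pi UNIV F"
      using y by auto
    have "W n y = W n y'"
      using ok[of n] eq by (simp add: stage_ok_def)
    then have "extends (\<sigma> y') (W n y)"
      using \<sigma>[of y' n] by simp
    then show "size_torus (\<Phi> (\<sigma> y) i - \<Phi> (\<sigma> y') i) \<le> (1 / 2) ^ n"
      using ok[of n] mem(1) gen[OF mem(1)] gen[OF mem(2)] \<sigma>[of y n] i unfolding stage_ok_def by blast
  next
    fix y y' :: "nat \<Rightarrow> rat" and n i i'
    assume y: "\<forall>n. y n \<in> F n" "\<forall>n. y' n \<in> F n" and eq: "\<forall>m\<ge>n. y m = y' m" and i: "l n \<le> i" "l n \<le> i'"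
    have mem: "y \<in> Pi UNIV F" "y' \<in> Pi UNIV F"
      using y by auto
    have "paired (W n y) (W n y') (\<sigma> y) (\<sigma> y')"
      unfolding paired_def using gen mem \<sigma> agree[OF eq] len by simp
    then show "osc (\<sigma> y) (\<sigma> y') i i' \<le> (1 / 2) ^ n"
      using ok[of n] mem i unfolding stage_ok_def by blast
  next
    fix y y' :: "nat \<Rightarrow> rat"
    show "convergent (\<lambda>i. \<Phi> (\<sigma> y) i - \<Phi> (\<sigma> y') i) \<longleftrightarrow> convergent (\<lambda>n. orbit P (\<Sum>m<n. y m - y' m))"
      unfolding red by (rule conv)
  qed
  then show ?thesis
    by (rule that)
qed

text \<open>Running sums of rational increments, mapped into the solenoid, serve as test inputs:
  their quotients are orbit points of sums of differences, which is the form that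
  \<open>block_reduction_exists\<close> expects.\<close>

lemma dvd_of_borel_reducible:
  assumes P: "\<And>n. P n > 0" and Q: "\<And>n. Q n > 0"
    and red: "borel_reducible (seqs (solenoid P)) (coset_rel (solenoid P)) (seqs (solenoid Q)) (coset_rel (solenoid Q))"
  obtains c where "c > 0" "\<And>j. \<exists>k. (\<Prod>i<j. Q i) dvd c * (\<Prod>i<k. P i)"
proof -
  obtain \<theta> where meas: "\<theta> \<in> restrict_space borel (seqs (solenoid P)) \<rightarrow>\<^sub>M restrict_space borel (seqs (solenoid Q))"
    and \<theta>: "\<And>x y. x \<in> seqs (solenoid P) \<Longrightarrow> y \<in> seqs (solenoid P) \<Longrightarrow>
      (x, y) \<in> coset_rel (solenoid P) \<longleftrightarrow> (\<theta> x, \<theta> y) \<in> coset_rel (solenoid Q)"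
    using red unfolding borel_reducible_def by blast
  have \<theta>_in: "\<theta> x \<in> seqs (solenoid Q)" if "x \<in> seqs (solenoid P)" for x
    using measurable_space[OF meas, of x] that by (simp add: space_restrict_space)
  define X :: "(nat \<Rightarrow> rat) \<Rightarrow> nat \<Rightarrow> nat \<Rightarrow> complex" where
    "X x k = one_param P (of_rat (\<Sum>i<Suc k. x i))" for x k
  have X_in: "X x \<in> seqs (solenoid P)" for x
    using one_param_in_solenoid[of P, OF P] by (simp add: X_def seqs_def)
  \<comment> \<open>Continuity of \<open>X\<close> for discrete increments: its entry
    \<open>k\<close> depends only on the first \<open>Suc k\<close> of them.\<close>
  have X_open: "\<exists>s. extends x s \<and> (\<forall>y. extends y s \<longrightarrow> X y \<in> W)" if W: "open W" "X x \<in> W" for x W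
  proof (rule ccontr)
    assume "\<not> ?thesis"
    then have "\<forall>n. \<exists>y. extends y (map x [0..<n]) \<and> X y \<notin> W"
      using extends_map by blast
    then obtain y where y: "\<And>n. extends (y n) (map x [0..<n])" "\<And>n. X (y n) \<notin> W"
      by metis
    have "X (y n) k = X x k" if "n \<ge> Suc k" for n k
    proof -
      have "(\<Sum>i<Suc k. y n i) = (\<Sum>i<Suc k. x i)"
        using y(1)[of n] that by (intro sum.cong) (auto simp: extends_def)
      then show ?thesis by (simp add: X_def)
    qed
    then have "(\<lambda>n. X (y n) k) \<longlonglongrightarrow> X x k" for k
      by (intro tendsto_eventually) (auto simp: eventually_sequentially)
    then have "(\<lambda>n. X (y n)) \<longlonglongrightarrow> X x"
      by (simp add: tendsto_fun_iff)
    then have "\<forall>\<^sub>F n in sequentially. X (y n) \<in> W"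
      using W by (rule topological_tendstoD)
    then show False
      using y(2) by simp
  qed
  have meas_coord: "(\<lambda>z. \<theta> z i) \<in> restrict_space borel (seqs (solenoid P)) \<rightarrow>\<^sub>M borel" for i
  proof -
    have "\<theta> \<in> restrict_space borel (seqs (solenoid P)) \<rightarrow>\<^sub>M borel"
      using meas by (simp add: measurable_restrict_space2_iff)
    then show ?thesis
      by (rule borel_measurable_continuous_on[OF continuous_on_product_coordinates])
  qed
  obtain D where D: "\<And>k. dense_open (D k)"
    and cont: "\<And>x i e. generic D x \<Longrightarrow> e > 0 \<Longrightarrow>
      \<exists>s. extends x s \<and> (\<forall>y. generic D y \<longrightarrow> extends y s \<longrightarrow> dist (\<theta> (X x) i) (\<theta> (X y) i) < e)"
    using generic_continuity[of X "seqs (solenoid P)" "\<lambda>i z. \<theta> z i", OF X_open X_in meas_coord] by blast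
  define \<Phi> where "\<Phi> x i = Abs_torus (\<theta> (X x) i)" for x i
  have sol: "\<theta> (X x) i \<in> carrier (solenoid Q)" for x i
    using \<theta>_in[OF X_in[of x]] by (simp add: seqs_def)
  have coord_\<Phi>: "coord (\<Phi> x i) = \<theta> (X x) i" for x i
    unfolding \<Phi>_def by (rule coord_Abs_torus[OF solenoid_norm[OF sol]])
  have red': "convergent (\<lambda>i. \<Phi> x i - \<Phi> y i) \<longleftrightarrow> convergent (\<lambda>k. orbit P (\<Sum>i<k. x i - y i))" for x y
  proof -
    have "convergent (\<lambda>i. \<Phi> x i - \<Phi> y i) \<longleftrightarrow> convergent (\<lambda>i l. \<theta> (X x) i l / \<theta> (X y) i l)"
      unfolding convergent_torus_iff convergent_fun_iff by (simp add: coord_\<Phi>)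
    also have "\<dots> \<longleftrightarrow> (X x, X y) \<in> coset_rel (solenoid P)"
      using \<theta>[OF X_in X_in] coset_rel_solenoid_iff[OF \<theta>_in[OF X_in] \<theta>_in[OF X_in]] by simp
    also have "\<dots> \<longleftrightarrow> convergent (\<lambda>k l. X x k l / X y k l)"
      by (rule coset_rel_solenoid_iff[OF X_in X_in])
    also have "(\<lambda>k l. X x k l / X y k l) = (\<lambda>k. coord (orbit P (\<Sum>i<Suc k. x i - y i)))"
      unfolding coord_orbit X_def sum_subtractf of_rat_diff one_param_diff[symmetric] ..
    also have "convergent \<dots> \<longleftrightarrow> convergent (\<lambda>k. orbit P (\<Sum>i<Suc k. x i - y i))"
      unfolding convergent_torus_iff ..
    also have "\<dots> \<longleftrightarrow> convergent (\<lambda>k. orbit P (\<Sum>i<k. x i - y i))"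
      by (rule convergent_Suc_iff)
    finally show ?thesis .
  qed
  have cont': "\<exists>s. extends x s \<and> (\<forall>y. generic D y \<longrightarrow> extends y s \<longrightarrow> dist (\<Phi> x i) (\<Phi> y i) < e)"
    if "generic D x" "e > 0" for x i e
    using cont[OF that] by (simp add: dist_torus_def coord_\<Phi>)
  obtain F l \<sigma> where block: "block_reduction P F l (\<lambda>y. \<Phi> (\<sigma> y))"
    by (rule block_reduction_exists[OF D cont' red'])
  interpret block_reduction P F l "\<lambda>y. \<Phi> (\<sigma> y)"
    by (rule block)
  have "coord (S n g) \<in> carrier (solenoid Q)" for n g
  proof -
    have "coord (S n g) = (\<lambda>j. coord (\<Phi> (\<sigma> (\<lambda>m. if m = n then g else 0)) (l (Suc n))) j
        / coord (\<Phi> (\<sigma> (\<lambda>_. 0)) (l (Suc n))) j)"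
      by (simp add: S_def T_def fun_eq_iff)
    then show ?thesis
      unfolding coord_\<Phi> using solenoid_divide[OF sol sol] by simp
  qed
  then obtain H :: "rat \<Rightarrow> nat \<Rightarrow> complex" and t where "\<And>t. H t \<in> carrier (solenoid Q)"
    "\<And>s t j. H (s + t) j = H s j * H t j"
    "\<And>j. \<exists>d>0. \<forall>t. dist (one_param P (of_rat t)) (\<lambda>_. 1) < d \<longrightarrow> norm (H t j - 1) < 1"
    "H t \<noteq> (\<lambda>_. 1)"
    using limit_hom[of Q] by metis
  then show ?thesis
    using dvd_of_rat_hom[of P Q H t, OF P Q] that by metis
qed

theorem theorem1p4:
  fixes P Q :: "nat \<Rightarrow> nat"
  assumes "\<And>n. prime (P n)" and "\<And>n. prime (Q n)"
  shows "(borel_reducible (seqs (solenoid P)) (coset_rel (solenoid P))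
            (seqs (solenoid Q)) (coset_rel (solenoid Q)) \<longleftrightarrow> Q \<preceq> P) \<and>
         (Q \<preceq> P \<longleftrightarrow>
           (\<exists>h \<in> hom (solenoid P) (solenoid Q).
              continuous_on (carrier (solenoid P)) h \<and>
              (\<exists>g \<in> carrier (solenoid P). h g \<noteq> \<one>\<^bsub>solenoid Q\<^esub>)))"
proof -
  have P: "P n > 0" and Q: "Q n > 0" for n
    using assms by (simp_all add: prime_gt_0_nat)
  define crit where "crit \<longleftrightarrow> (\<exists>c>0. \<forall>j. \<exists>k. (\<Prod>i<j. Q i) dvd c * (\<Prod>i<k. P i))"
  have "Q \<preceq> P \<longleftrightarrow> crit"
    unfolding crit_def using prime_seq_leD[of P Q] prime_seq_leI[of P Q] assms by metis
  moreover have "borel_reducible (seqs (solenoid P)) (coset_rel (solenoid P))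
      (seqs (solenoid Q)) (coset_rel (solenoid Q)) \<longleftrightarrow> crit"
    unfolding crit_def using borel_reducible_of_dvd[of P Q] dvd_of_borel_reducible[of P Q] P Q by metis
  moreover have "(\<exists>h \<in> hom (solenoid P) (solenoid Q). continuous_on (carrier (solenoid P)) h \<and>
      (\<exists>g \<in> carrier (solenoid P). h g \<noteq> \<one>\<^bsub>solenoid Q\<^esub>)) \<longleftrightarrow> crit"
    unfolding crit_def using solenoid_nontrivial_hom_of_dvd[of P Q] dvd_of_solenoid_hom[of P Q] P Q by metis
  ultimately show ?thesis
    by blast
qed

end
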